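(* Let $p,q\in(0,1)$, $\theta\in[0,2\pi)$ and let $\beta\geq 0$ be an integer. The vectors $$\{\xi^kz^mb^n\mid k>0,\ m,n\in\mathbb{Z}\},\qquad \{(1-zz^*-\xi)^kz^ma^n\mid k\geq 0,\ m,n\in\mathbb{Z}\}$$ form a basis of $\vartheta(L^{p,q,\theta}_\beta)$. The algebras $\vartheta(L^{p,q,\theta}_\beta)$ and $P=P_1\oplus_{\chi^i_j}P_2$ are mutually isomorphic, where $P_1=\vartheta(D_p\times_\theta S^1)$, $P_2=\vartheta(D_q\times_\theta S^1)$ and the gluing maps are $$\chi^1_2((1-xx^* )^kx^mh^n)=\delta_{k0}V^mU^n,\qquad \chi^2_1((1-yy^* )^ky^mg^n)=\delta_{k0}\,e^{i\beta\theta\frac{n^2}{2}}V^{m+\beta n}U^n$$ for all $m,n\in\mathbb{Z}$ and integers $k\geq0$.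
   Context: All algebras are over $\mathbb{C}$. For an element $w$ of a $*$-algebra and $n\geq0$, write $w^{-n}=(w^* )^n$ (used for $w=x,y,z,a,b$ and for unitaries). Quantum solid torus: $P_1=\vartheta(D_p\times_\theta S^1)$ is the $*$-algebra generated by $x,h$ with relations $hh^*=1=h^*h$, $x^*x-pxx^*=1-p$, $hx=e^{i\theta}xh$, $hx^*=e^{-i\theta}x^*h$; it has linear basis $(1-xx^* )^kx^mh^n$, $k\geq0$, $m,n\in\mathbb{Z}$. $P_2=\vartheta(D_q\times_\theta S^1)$ is defined in the same way with generators $y,g$ in place of $x,h$ and $q$ in place of $p$. Quantum torus: $P_{12}=\vartheta(T_\theta)$ is the $*$-algebra generated by unitaries $U,V$ with $UV=e^{i\theta}VU$. The maps $\chi^1_2:P_1\to P_{12}$, $\chi^2_1:P_2\to P_{12}$ in the claim are surjective $*$-algebra maps, and the gluing is $P=P_1\oplus_{\chi^i_j}P_2=\{(p_1,p_2)\in P_1\oplus P_2\mid\chi^1_2(p_1)=\chi^2_1(p_2)\}$, with componentwise operations. Deformed binomials: for a number $r>0$, $[n]_r=1+r+\dots+r^{n-1}$, $[0]_r=0$, $[n]_r!=[1]_r\cdots[n]_r$, $[0]_r!=1$, and $\binom{n}{m}_r=\frac{[n]_r!}{[m]_r!\,[n-m]_r!}$. Quantum lens space: $\vartheta(L^{p,q,\theta}_\beta)$ is the quotient of the free $*$-algebra generated by $\xi,z,a,b$ modulo the relations $\xi^*=\xi$, $\ \xi z=pz\xi$, $\ z^*z-qzz^*=1-q-(p-q)\xi$,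 $\ (1-zz^*-\xi)\xi=0$, $\xi a=p^\beta a\xi$, $\ \xi b=b\xi$, $\ za=e^{-i\theta}az$, $\ zb=e^{i\theta}bz$, $za^*-e^{i\theta}a^*z=(p^\beta-1)\xi z^{1-\beta}b$, $z^*b-e^{-i\theta}bz^*=(1-q^\beta)z^{\beta-1}(1-zz^*-\xi)a^*$, $ab=e^{i\beta\theta}ba$, $\ ab^*=e^{-i\beta\theta}b^*a$, $\ ba=z^\beta$, $a^*a=\sum_{m=0}^\beta(-1)^mp^{\beta m-\frac{m(m-1)}{2}}\binom{\beta}{m}_{p^{-1}}\xi^m$, $aa^*=\sum_{m=0}^\beta(-1)^mp^{-\beta m+\frac{m(m+1)}{2}}\binom{\beta}{m}_{p}\xi^m$, $b^*b=\sum_{m=0}^\beta(-1)^mq^{\beta m-\frac{m(m-1)}{2}}\binom{\beta}{m}_{q^{-1}}(1-zz^*-\xi)^m$, $bb^*=\sum_{m=0}^\beta(-1)^mq^{-\beta m+\frac{m(m+1)}{2}}\binom{\beta}{m}_{q}(1-zz^*-\xi)^m$. *)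

theory Defs
  imports
    Complex_Main
    "HOL-Library.Poly_Mapping"
    "HOL-Algebra.QuotRing"
    "HOL-Algebra.Module"
begin

section \<open>Star-algebras over the complex numbers\<close>

text \<open>
  The locale \<open>algebra\<close> of HOL-Algebra is commutative, so only its record type is reused.
\<close>

record 'a star_algebra = "(complex, 'a) module" +
  invol :: "'a \<Rightarrow> 'a"

definition star_hom ::
  "('a, 'm) star_algebra_scheme \<Rightarrow> ('b, 'n) star_algebra_scheme \<Rightarrow> ('a \<Rightarrow> 'b) set" where
  "star_hom A B = {f \<in> ring_hom A B.
     (\<forall>c. \<forall>x\<in>carrier A. f (c \<odot>\<^bsub>A\<^esub> x) = c \<odot>\<^bsub>B\<^esub> f x) \<and>
     (\<forall>x\<in>carrier A. f (invol A x) = invol B (f x))}"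

definition star_isomorphic ::
  "('a, 'm) star_algebra_scheme \<Rightarrow> ('b, 'n) star_algebra_scheme \<Rightarrow> bool" where
  "star_isomorphic A B \<longleftrightarrow> (\<exists>f \<in> star_hom A B. bij_betw f (carrier A) (carrier B))"

text \<open>
  Linear independence is that of an indexed family; in particular it forbids repetitions.
\<close>

definition lin_comb ::
  "('a, 'm) star_algebra_scheme \<Rightarrow> ('i \<Rightarrow> 'a) \<Rightarrow> ('i \<Rightarrow> complex) \<Rightarrow> 'i set \<Rightarrow> 'a" where
  "lin_comb A v c F = (\<Oplus>\<^bsub>A\<^esub>i\<in>F. c i \<odot>\<^bsub>A\<^esub> v i)"

definition lin_independent_family ::
  "('a, 'm) star_algebra_scheme \<Rightarrow> 'i set \<Rightarrow> ('i \<Rightarrow> 'a) \<Rightarrow> bool" where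
  "lin_independent_family A I v \<longleftrightarrow>
     (\<forall>F c. finite F \<and> F \<subseteq> I \<and> lin_comb A v c F = \<zero>\<^bsub>A\<^esub> \<longrightarrow> (\<forall>i\<in>F. c i = 0))"

definition spanning_family ::
  "('a, 'm) star_algebra_scheme \<Rightarrow> 'i set \<Rightarrow> ('i \<Rightarrow> 'a) \<Rightarrow> bool" where
  "spanning_family A I v \<longleftrightarrow>
     (\<forall>x\<in>carrier A. \<exists>F c. finite F \<and> F \<subseteq> I \<and> x = lin_comb A v c F)"

definition basis_family ::
  "('a, 'm) star_algebra_scheme \<Rightarrow> 'i set \<Rightarrow> ('i \<Rightarrow> 'a) \<Rightarrow> bool" where
  "basis_family A I v \<longleftrightarrow>
     v \<in> I \<rightarrow> carrier A \<and> lin_independent_family A I v \<and> spanning_family A I v"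

definition gluing ::
  "('a, 'm) star_algebra_scheme \<Rightarrow> ('b, 'n) star_algebra_scheme \<Rightarrow>
   ('a \<Rightarrow> 'c) \<Rightarrow> ('b \<Rightarrow> 'c) \<Rightarrow> ('a \<times> 'b) star_algebra" where
  "gluing A B \<chi> \<chi>' =
     \<lparr>carrier = {(a, b) \<in> carrier A \<times> carrier B. \<chi> a = \<chi>' b},
      mult = (\<lambda>(a, b) (a', b'). (a \<otimes>\<^bsub>A\<^esub> a', b \<otimes>\<^bsub>B\<^esub> b')),
      one = (\<one>\<^bsub>A\<^esub>, \<one>\<^bsub>B\<^esub>),
      zero = (\<zero>\<^bsub>A\<^esub>, \<zero>\<^bsub>B\<^esub>),
      add = (\<lambda>(a, b) (a', b'). (a \<oplus>\<^bsub>A\<^esub> a', b \<oplus>\<^bsub>B\<^esub> b')),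
      smult = (\<lambda>c (a, b). (c \<odot>\<^bsub>A\<^esub> a, c \<odot>\<^bsub>B\<^esub> b)),
      invol = (\<lambda>(a, b). (invol A a, invol B b))\<rparr>"


section \<open>Free star-algebras and presentations\<close>

text \<open>
  The letter \<open>(g, False)\<close> stands for the generator \<open>g\<close>, the letter \<open>(g, True)\<close> for its adjoint.
  Words form a monoid, written additively because \<open>Poly_Mapping\<close> expects its exponents so;
  the type \<open>'g free_star\<close> is then the monoid algebra, with convolution as product.
\<close>

datatype 'g word = Word (letters: "('g \<times> bool) list")

instantiation word :: (type) monoid_add
begin

definition zero_word :: "'a word" where
  "0 = Word []"

definition plus_word :: "'a word \<Rightarrow> 'a word \<Rightarrow> 'a word" where
  "u + v = Word (letters u @ letters v)"

instance
  by standard (simp_all add: zero_word_def plus_word_def)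

end

type_synonym 'g free_star = "'g word \<Rightarrow>\<^sub>0 complex"

definition scal :: "complex \<Rightarrow> 'g free_star" where
  "scal c = Poly_Mapping.single 0 c"

definition gen :: "'g \<Rightarrow> 'g free_star" where
  "gen g = Poly_Mapping.single (Word [(g, False)]) 1"

definition word_star :: "'g word \<Rightarrow> 'g word" where
  "word_star w = Word (rev (map (\<lambda>(g, s). (g, \<not> s)) (letters w)))"

definition fstar :: "'g free_star \<Rightarrow> 'g free_star" (\<open>(_\<^sup>\<star>)\<close> [1000] 999) where
  "f\<^sup>\<star> = (\<Sum>w\<in>Poly_Mapping.keys f.
     Poly_Mapping.single (word_star w) (cnj (Poly_Mapping.lookup f w)))"

definition star_power :: "'g free_star \<Rightarrow> int \<Rightarrow> 'g free_star" (infixr \<open>\<^bold>^\<close> 80) where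
  "w \<^bold>^ n = (if 0 \<le> n then w ^ nat n else (w\<^sup>\<star>) ^ nat (- n))"

definition free_star_algebra :: "'g free_star star_algebra" where
  "free_star_algebra =
     \<lparr>carrier = UNIV, mult = (*), one = 1, zero = 0, add = (+),
      smult = (\<lambda>c f. scal c * f), invol = fstar\<rparr>"

text \<open>
  Relations are pairs (left-hand side, right-hand side). The ideal is closed under the
  involution because the adjoints of the relators are included.
\<close>

definition relation_ideal :: "('g free_star \<times> 'g free_star) set \<Rightarrow> 'g free_star set" where
  "relation_ideal E = Idl\<^bsub>free_star_algebra\<^esub>
     ({l - r |l r. (l, r) \<in> E} \<union> {(l - r)\<^sup>\<star> |l r. (l, r) \<in> E})"

definition residue_class ::
  "('g free_star \<times> 'g free_star) set \<Rightarrow> 'g free_star \<Rightarrow> 'g free_star set" where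
  "residue_class E f = relation_ideal E +>\<^bsub>free_star_algebra\<^esub> f"

definition presented :: "('g free_star \<times> 'g free_star) set \<Rightarrow> 'g free_star set star_algebra" where
  "presented E = ring.extend (free_star_algebra Quot relation_ideal E)
     \<lparr>smult = (\<lambda>c X. \<Union>f\<in>X. residue_class E (scal c * f)),
      invol = (\<lambda>X. \<Union>f\<in>X. residue_class E (f\<^sup>\<star>))\<rparr>"


section \<open>The quantum solid torus and the quantum torus\<close>

datatype solid_gen = Disc_Gen | Circle_Gen

abbreviation Sx :: "solid_gen free_star" where "Sx \<equiv> gen Disc_Gen"
abbreviation Sh :: "solid_gen free_star" where "Sh \<equiv> gen Circle_Gen"

definition solid_torus_rels :: "real \<Rightarrow> real \<Rightarrow> (solid_gen free_star \<times> solid_gen free_star) set" where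
  "solid_torus_rels p \<theta> =
    {(Sh * Sh\<^sup>\<star>, 1),
     (Sh\<^sup>\<star> * Sh, 1),
     (Sx\<^sup>\<star> * Sx - scal p * Sx * Sx\<^sup>\<star>, scal (1 - p)),
     (Sh * Sx, scal (cis \<theta>) * Sx * Sh),
     (Sh * Sx\<^sup>\<star>, scal (cis (- \<theta>)) * Sx\<^sup>\<star> * Sh)}"

definition solid_torus :: "real \<Rightarrow> real \<Rightarrow> solid_gen free_star set star_algebra" where
  "solid_torus p \<theta> = presented (solid_torus_rels p \<theta>)"

definition solid_torus_vec :: "real \<Rightarrow> real \<Rightarrow> nat \<Rightarrow> int \<Rightarrow> int \<Rightarrow> solid_gen free_star set" where
  "solid_torus_vec p \<theta> k m n =
     residue_class (solid_torus_rels p \<theta>) ((1 - Sx * Sx\<^sup>\<star>) ^ k * Sx \<^bold>^ m * Sh \<^bold>^ n)"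

datatype torus_gen = U_Gen | V_Gen

abbreviation Tu :: "torus_gen free_star" where "Tu \<equiv> gen U_Gen"
abbreviation Tv :: "torus_gen free_star" where "Tv \<equiv> gen V_Gen"

definition torus_rels :: "real \<Rightarrow> (torus_gen free_star \<times> torus_gen free_star) set" where
  "torus_rels \<theta> =
    {(Tu * Tu\<^sup>\<star>, 1), (Tu\<^sup>\<star> * Tu, 1), (Tv * Tv\<^sup>\<star>, 1), (Tv\<^sup>\<star> * Tv, 1),
     (Tu * Tv, scal (cis \<theta>) * Tv * Tu)}"

definition quantum_torus :: "real \<Rightarrow> torus_gen free_star set star_algebra" where
  "quantum_torus \<theta> = presented (torus_rels \<theta>)"

definition torus_vec :: "real \<Rightarrow> int \<Rightarrow> int \<Rightarrow> torus_gen free_star set" where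
  "torus_vec \<theta> m n = residue_class (torus_rels \<theta>) (Tv \<^bold>^ m * Tu \<^bold>^ n)"

definition surjective_star_hom ::
  "('a, 'm) star_algebra_scheme \<Rightarrow> ('b, 'n) star_algebra_scheme \<Rightarrow> ('a \<Rightarrow> 'b) \<Rightarrow> bool" where
  "surjective_star_hom A B f \<longleftrightarrow> f \<in> star_hom A B \<and> f ` carrier A = carrier B"

text \<open>
  In both gluing maps the values are prescribed on a linear basis of the solid torus, so the
  maps are determined on the carrier.
\<close>

definition gluing_map1 ::
  "real \<Rightarrow> real \<Rightarrow> (solid_gen free_star set \<Rightarrow> torus_gen free_star set) \<Rightarrow> bool" where
  "gluing_map1 p \<theta> \<chi> \<longleftrightarrow>
     surjective_star_hom (solid_torus p \<theta>) (quantum_torus \<theta>) \<chi> \<and>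
     (\<forall>k m n. \<chi> (solid_torus_vec p \<theta> k m n) =
        (if k = 0 then 1 else 0) \<odot>\<^bsub>quantum_torus \<theta>\<^esub> torus_vec \<theta> m n)"

definition gluing_map2 ::
  "real \<Rightarrow> real \<Rightarrow> nat \<Rightarrow> (solid_gen free_star set \<Rightarrow> torus_gen free_star set) \<Rightarrow> bool" where
  "gluing_map2 q \<theta> \<beta> \<chi> \<longleftrightarrow>
     surjective_star_hom (solid_torus q \<theta>) (quantum_torus \<theta>) \<chi> \<and>
     (\<forall>k m n. \<chi> (solid_torus_vec q \<theta> k m n) =
        ((if k = 0 then 1 else 0) * cis (real \<beta> * \<theta> * (real_of_int n)\<^sup>2 / 2))
          \<odot>\<^bsub>quantum_torus \<theta>\<^esub> torus_vec \<theta> (m + int \<beta> * n) n)"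


section \<open>The quantum lens space\<close>

definition qint :: "real \<Rightarrow> nat \<Rightarrow> real" where
  "qint r n = (\<Sum>i<n. r ^ i)"

definition qfact :: "real \<Rightarrow> nat \<Rightarrow> real" where
  "qfact r n = (\<Prod>i=1..n. qint r i)"

definition qbinom :: "real \<Rightarrow> nat \<Rightarrow> nat \<Rightarrow> real" where
  "qbinom r n m = qfact r n / (qfact r m * qfact r (n - m))"

text \<open>
  The right-hand sides of the relations for \<open>a\<^sup>\<star>a\<close>, \<open>b\<^sup>\<star>b\<close> and for \<open>aa\<^sup>\<star>\<close>, \<open>bb\<^sup>\<star>\<close>, respectively,
  as functions of \<open>r = p\<close>, \<open>t = \<xi>\<close>, or \<open>r = q\<close>, \<open>t = 1 - zz\<^sup>\<star> - \<xi>\<close>.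
\<close>

definition modulus_poly :: "real \<Rightarrow> nat \<Rightarrow> 'g free_star \<Rightarrow> 'g free_star" where
  "modulus_poly r \<beta> t = (\<Sum>m=0..\<beta>.
     scal ((- 1) ^ m * r powi (int \<beta> * int m - int m * (int m - 1) div 2)
           * qbinom (inverse r) \<beta> m) * t ^ m)"

definition comodulus_poly :: "real \<Rightarrow> nat \<Rightarrow> 'g free_star \<Rightarrow> 'g free_star" where
  "comodulus_poly r \<beta> t = (\<Sum>m=0..\<beta>.
     scal ((- 1) ^ m * r powi (- int \<beta> * int m + int m * (int m + 1) div 2)
           * qbinom r \<beta> m) * t ^ m)"

datatype lens_gen = Xi_Gen | Z_Gen | A_Gen | B_Gen

abbreviation L\<xi> :: "lens_gen free_star" where "L\<xi> \<equiv> gen Xi_Gen"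
abbreviation Lz :: "lens_gen free_star" where "Lz \<equiv> gen Z_Gen"
abbreviation La :: "lens_gen free_star" where "La \<equiv> gen A_Gen"
abbreviation Lb :: "lens_gen free_star" where "Lb \<equiv> gen B_Gen"

definition lens_rels ::
  "real \<Rightarrow> real \<Rightarrow> real \<Rightarrow> nat \<Rightarrow> (lens_gen free_star \<times> lens_gen free_star) set" where
  "lens_rels p q \<theta> \<beta> =
    {(L\<xi>\<^sup>\<star>, L\<xi>),
     (L\<xi> * Lz, scal p * Lz * L\<xi>),
     (Lz\<^sup>\<star> * Lz - scal q * Lz * Lz\<^sup>\<star>, scal (1 - q) - scal (p - q) * L\<xi>),
     ((1 - Lz * Lz\<^sup>\<star> - L\<xi>) * L\<xi>, 0),
     (L\<xi> * La, scal (p ^ \<beta>) * La * L\<xi>),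
     (L\<xi> * Lb, Lb * L\<xi>),
     (Lz * La, scal (cis (- \<theta>)) * La * Lz),
     (Lz * Lb, scal (cis \<theta>) * Lb * Lz),
     (Lz * La\<^sup>\<star> - scal (cis \<theta>) * La\<^sup>\<star> * Lz,
        scal (p ^ \<beta> - 1) * L\<xi> * Lz \<^bold>^ (1 - int \<beta>) * Lb),
     (Lz\<^sup>\<star> * Lb - scal (cis (- \<theta>)) * Lb * Lz\<^sup>\<star>,
        scal (1 - q ^ \<beta>) * Lz \<^bold>^ (int \<beta> - 1) * (1 - Lz * Lz\<^sup>\<star> - L\<xi>) * La\<^sup>\<star>),
     (La * Lb, scal (cis (real \<beta> * \<theta>)) * Lb * La),
     (La * Lb\<^sup>\<star>, scal (cis (- (real \<beta> * \<theta>))) * Lb\<^sup>\<star> * La),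
     (Lb * La, Lz ^ \<beta>),
     (La\<^sup>\<star> * La, modulus_poly p \<beta> L\<xi>),
     (La * La\<^sup>\<star>, comodulus_poly p \<beta> L\<xi>),
     (Lb\<^sup>\<star> * Lb, modulus_poly q \<beta> (1 - Lz * Lz\<^sup>\<star> - L\<xi>)),
     (Lb * Lb\<^sup>\<star>, comodulus_poly q \<beta> (1 - Lz * Lz\<^sup>\<star> - L\<xi>))}"

definition lens_space ::
  "real \<Rightarrow> real \<Rightarrow> real \<Rightarrow> nat \<Rightarrow> lens_gen free_star set star_algebra" where
  "lens_space p q \<theta> \<beta> = presented (lens_rels p q \<theta> \<beta>)"

text \<open>
  The summand \<open>Inl\<close> indexes the vectors built from \<open>\<xi>\<close> and \<open>b\<close>, where \<open>k > 0\<close>, the summand \<open>Inr\<close>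
  those built from \<open>1 - zz\<^sup>\<star> - \<xi>\<close> and \<open>a\<close>, where \<open>k \<ge> 0\<close>.
\<close>

type_synonym lens_index = "(nat \<times> int \<times> int) + (nat \<times> int \<times> int)"

definition lens_indices :: "lens_index set" where
  "lens_indices = {Inl (k, m, n) |k m n. 0 < k} \<union> {Inr (k, m, n) |k m n. 0 \<le> k}"

definition lens_vec ::
  "real \<Rightarrow> real \<Rightarrow> real \<Rightarrow> nat \<Rightarrow> lens_index \<Rightarrow> lens_gen free_star set" where
  "lens_vec p q \<theta> \<beta> i = residue_class (lens_rels p q \<theta> \<beta>)
     (case i of
        Inl (k, m, n) \<Rightarrow> L\<xi> ^ k * Lz \<^bold>^ m * Lb \<^bold>^ n
      | Inr (k, m, n) \<Rightarrow> (1 - Lz * Lz\<^sup>\<star> - L\<xi>) ^ k * Lz \<^bold>^ m * La \<^bold>^ n)"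

end

theory Submission
  imports Defs
begin

text \<open>
  The isomorphism sends \<open>\<xi>\<close>, \<open>z\<close>, \<open>a\<close>, \<open>b\<close> to \<open>(1 - x x\<^sup>*, 0)\<close>, \<open>(x, y)\<close>, \<open>(\<mu> x\<^sup>\<beta> h, g)\<close> and
  \<open>(\<mu> h\<^sup>*, y\<^sup>\<beta> g\<^sup>*)\<close>, where \<open>\<mu> = exp (i \<beta> \<theta> / 2)\<close>; the relations for the moduli of \<open>a\<close> and \<open>b\<close>
  reduce to the q-binomial theorem. Put \<open>\<eta> = 1 - z z\<^sup>* - \<xi>\<close>. In the lens space \<open>\<xi>\<close> and \<open>\<eta>\<close> are
  normal elements with \<open>\<xi> \<eta> = 0\<close>; the ideal of \<open>\<xi>\<close> is spanned by the monomials
  \<open>\<xi>\<^sup>k z\<^sup>m b\<^sup>n\<close>, that of \<open>\<eta>\<close> by the monomials \<open>\<eta>\<^sup>k z\<^sup>m a\<^sup>n\<close>, \<open>k > 0\<close>, and modulo both ideals the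
  algebra is a quotient of the quantum torus, spanned by the \<open>z\<^sup>m a\<^sup>n\<close>. Hence the claimed basis spans.
  It is mapped to a linearly independent family because the bases of the solid tori are
  independent, as weighted shifts show; this also gives injectivity. For surjectivity one
  lifts the second component and then uses that the kernel of the first gluing map is spanned by
  the monomials with \<open>k > 0\<close>, the quantum torus monomials being independent.
\<close>

section \<open>Free star-algebras\<close>

text \<open>The two components of the isomorphism see different parts of the basis. The second
  annihilates every \<open>Inl\<close> vector, because of the factor \<xi>, and sends the
  \<open>Inr\<close> vectors to the basis monomials of the second solid torus; the first sends the
  \<open>Inl\<close> vectors to non-zero multiples of basis monomials, with the sign of n reversed.
  The system is thus triangular, and coefficients are eliminated in two rounds. The obstacle is on
  the spanning side. The presentation does not say how \<eta> moves past \<open>a\<close> and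
  \<open>b\<close>; these rules have to be extracted from the mixed relations of \<open>z\<close>
  with \<open>qstar a\<close> and of \<open>qstar z\<close> with \<open>b\<close>, whose correction
  terms contain \<xi> or \<eta>. Moreover \<open>b\<close> is unitary only behind \<xi>, and
  \<open>a\<close> only behind \<eta>: their moduli are polynomials with constant term 1 in the
  other of the two elements, and \<xi> \<eta> = 0 removes all higher terms. This is why two kinds of
  monomials occur and why \<open>a\<close> is expressed by \<open>b\<close> on one ideal and
  \<open>b\<close> by \<open>a\<close> on the other.\<close>

lemma poly_mapping_sum_singles:
  fixes f :: "'a \<Rightarrow>\<^sub>0 'b :: comm_monoid_add"
  shows "f = (\<Sum>w\<in>Poly_Mapping.keys f. Poly_Mapping.single w (Poly_Mapping.lookup f w))"
proof (rule poly_mapping_eqI)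
  fix k
  have "(\<Sum>w\<in>Poly_Mapping.keys f. Poly_Mapping.lookup f w when w = k) = Poly_Mapping.lookup f k"
    by (cases "k \<in> Poly_Mapping.keys f")
      (auto simp: when_def sum.delta' not_in_keys_iff_lookup_eq_zero cong: sum.cong)
  then show "Poly_Mapping.lookup f k =
      Poly_Mapping.lookup (\<Sum>w\<in>Poly_Mapping.keys f. Poly_Mapping.single w (Poly_Mapping.lookup f w)) k"
    by (simp add: lookup_sum lookup_single)
qed

lemma poly_mapping_single_induct:
  fixes f :: "'a \<Rightarrow>\<^sub>0 'b :: comm_monoid_add"
  assumes "P 0" "\<And>w c. P (Poly_Mapping.single w c)" "\<And>f g. P f \<Longrightarrow> P g \<Longrightarrow> P (f + g)"
  shows "P f"
proof -
  have "P (\<Sum>w\<in>A. Poly_Mapping.single w (Poly_Mapping.lookup f w))" if "finite A" for A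
    using that by induction (use assms in auto)
  then show ?thesis
    by (subst poly_mapping_sum_singles) simp
qed

definition letter :: "'g \<times> bool \<Rightarrow> 'g free_star" where
  "letter l = Poly_Mapping.single (Word [l]) 1"

lemma letter_gen: "letter (g, False) = gen g"
  by (simp add: letter_def gen_def)

lemma single_Word_Cons:
  "Poly_Mapping.single (Word (l # ls)) c = letter l * Poly_Mapping.single (Word ls) c"
  by (simp add: letter_def mult_single plus_word_def)

lemma scal_add: "scal (c + d) = scal c + scal d"
  by (simp add: scal_def single_add)

lemma scal_mult: "scal (c * d) = scal c * scal d"
  by (simp add: scal_def mult_single)

lemma scal_0 [simp]: "scal 0 = 0"
  by (simp add: scal_def)

lemma scal_1 [simp]: "scal 1 = 1"
  by (simp add: scal_def)

lemma scal_minus: "scal (- c) = - scal c"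
  by (simp add: scal_def single_uminus)

lemma scal_commute: "f * scal c = scal c * f"
  by (induction f rule: poly_mapping_single_induct)
    (simp_all add: scal_def mult_single ring_distribs mult.commute)

lemma letter_induct [case_names scal letter add]:
  assumes "\<And>c. P (scal c)" "\<And>l f. P f \<Longrightarrow> P (letter l * f)"
    and "\<And>f g. P f \<Longrightarrow> P g \<Longrightarrow> P (f + g)"
  shows "P f"
proof (induction f rule: poly_mapping_single_induct)
  case (2 w c)
  have "P (Poly_Mapping.single (Word ls) c)" for ls
    by (induction ls)
      (use assms in \<open>auto simp: single_Word_Cons simp flip: zero_word_def scal_def\<close>)
  then show ?case by (cases w) auto
qed (use assms(1)[of 0] assms in auto)

subsection \<open>The involution\<close>

lemma fstar_add: "(f + g)\<^sup>\<star> = f\<^sup>\<star> + g\<^sup>\<star>"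
  unfolding fstar_def by (rule setsum_keys_plus_distrib) (simp_all add: single_add)

lemma fstar_single [simp]:
  "(Poly_Mapping.single w c)\<^sup>\<star> = Poly_Mapping.single (word_star w) (cnj c)"
  by (simp add: fstar_def)

lemma fstar_0 [simp]: "0\<^sup>\<star> = 0"
  by (simp add: fstar_def)

lemma word_star_plus: "word_star (u + v) = word_star v + word_star u"
  by (simp add: word_star_def plus_word_def)

lemma word_star_word_star [simp]: "word_star (word_star u) = u"
  by (cases u) (simp add: word_star_def rev_map comp_def case_prod_beta)

lemma fstar_mult: "(f * g)\<^sup>\<star> = g\<^sup>\<star> * f\<^sup>\<star>"
proof (induction f rule: poly_mapping_single_induct)
  case (2 w c)
  show ?case
    by (induction g rule: poly_mapping_single_induct)
      (simp_all add: mult_single word_star_plus ring_distribs fstar_add mult.commute)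
qed (simp_all add: ring_distribs fstar_add)

lemma fstar_fstar [simp]: "(f\<^sup>\<star>)\<^sup>\<star> = f"
  by (induction f rule: poly_mapping_single_induct) (simp_all add: fstar_add)

lemma fstar_scal [simp]: "(scal c)\<^sup>\<star> = scal (cnj c)"
  by (simp add: scal_def word_star_def zero_word_def)

lemma fstar_1 [simp]: "1\<^sup>\<star> = 1"
  using fstar_scal[of 1] by simp

lemma fstar_minus: "(- f)\<^sup>\<star> = - f\<^sup>\<star>"
  by (metis add.right_inverse add_eq_0_iff fstar_0 fstar_add)

lemma fstar_diff: "(f - g)\<^sup>\<star> = f\<^sup>\<star> - g\<^sup>\<star>"
  by (metis fstar_add fstar_minus uminus_add_conv_diff add.commute)

lemma letter_gen_star: "letter (g, True) = (gen g)\<^sup>\<star>"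
  by (simp add: letter_def gen_def word_star_def)

text \<open>Words grow by one letter on the left, so properties stable under left multiplication by
  generators and their adjoints need no induction over words of their own.\<close>

lemma free_star_induct [case_names scal gen star add]:
  assumes "\<And>c. P (scal c)" "\<And>g f. P f \<Longrightarrow> P (gen g * f)" "\<And>g f. P f \<Longrightarrow> P ((gen g)\<^sup>\<star> * f)"
    and "\<And>f g. P f \<Longrightarrow> P g \<Longrightarrow> P (f + g)"
  shows "P f"
proof (induction f rule: letter_induct)
  case (letter l f)
  then show ?case
    by (cases l; cases "snd l") (use assms in \<open>auto simp: letter_gen letter_gen_star\<close>)
qed (use assms in auto)

subsection \<open>Substitution of generators\<close>

definition subst_letter :: "('g \<Rightarrow> 'h free_star) \<Rightarrow> 'g \<times> bool \<Rightarrow> 'h free_star" where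
  "subst_letter s l = (if snd l then (s (fst l))\<^sup>\<star> else s (fst l))"

text \<open>The homomorphism provided by the universal property of the free star-algebra. Adjoint
  letters go to adjoints of the images, which makes it compatible with the involution.\<close>

definition subst_gens :: "('g \<Rightarrow> 'h free_star) \<Rightarrow> 'g free_star \<Rightarrow> 'h free_star" where
  "subst_gens s f = (\<Sum>w\<in>Poly_Mapping.keys f.
     scal (Poly_Mapping.lookup f w) * prod_list (map (subst_letter s) (letters w)))"

lemma subst_gens_add: "subst_gens s (f + g) = subst_gens s f + subst_gens s g"
  unfolding subst_gens_def by (rule setsum_keys_plus_distrib) (simp_all add: scal_add ring_distribs)

lemma subst_gens_single:
  "subst_gens s (Poly_Mapping.single w c) = scal c * prod_list (map (subst_letter s) (letters w))"
  by (simp add: subst_gens_def)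

lemma subst_gens_scal [simp]: "subst_gens s (scal c) = scal c"
  by (simp add: scal_def[of c] subst_gens_single zero_word_def)

lemma subst_gens_0 [simp]: "subst_gens s 0 = 0"
  by (simp add: subst_gens_def)

lemma subst_gens_1 [simp]: "subst_gens s 1 = 1"
  using subst_gens_scal[of s 1] by simp

lemma subst_gens_mult: "subst_gens (s :: 'b \<Rightarrow> 'c free_star) (f * g) = subst_gens s f * subst_gens s g"
proof (induction f rule: poly_mapping_single_induct)
  case (2 w c)
  show ?case
  proof (induction g rule: poly_mapping_single_induct)
    case (2 v d)
    have "scal (c * d) * (a * b) = scal c * a * (scal d * b)" for a b :: "'c free_star"
      by (metis scal_mult scal_commute mult.assoc)
    then show ?case
      by (simp add: mult_single subst_gens_single plus_word_def)
  qed (simp_all add: ring_distribs subst_gens_add)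
qed (simp_all add: ring_distribs subst_gens_add)

lemma subst_gens_gen [simp]: "subst_gens s (gen g) = s g"
  by (simp add: gen_def subst_gens_single subst_letter_def)

lemma subst_gens_gen_star [simp]: "subst_gens s ((gen g)\<^sup>\<star>) = (s g)\<^sup>\<star>"
  by (simp add: gen_def subst_gens_single subst_letter_def word_star_def)

lemma subst_gens_star: "subst_gens s (f\<^sup>\<star>) = (subst_gens s f)\<^sup>\<star>"
proof (induction f rule: letter_induct)
  case (letter l f)
  then show ?case
    by (cases l; cases "snd l")
      (auto simp: letter_gen letter_gen_star fstar_mult subst_gens_mult)
qed (simp_all add: fstar_add subst_gens_add)

lemma subst_gens_minus: "subst_gens s (- f) = - subst_gens s f"
  by (metis add.right_inverse add_eq_0_iff subst_gens_0 subst_gens_add)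

lemma subst_gens_diff: "subst_gens s (f - g) = subst_gens s f - subst_gens s g"
  by (metis subst_gens_add subst_gens_minus uminus_add_conv_diff add.commute)

lemma subst_gens_sum: "subst_gens s (\<Sum>i\<in>A. f i) = (\<Sum>i\<in>A. subst_gens s (f i))"
  by (induction A rule: infinite_finite_induct) (simp_all add: subst_gens_add)

lemma subst_gens_power: "subst_gens s (f ^ n) = subst_gens s f ^ n"
  by (induction n) (simp_all add: subst_gens_mult)

lemma subst_gens_star_power: "subst_gens s (f \<^bold>^ n) = subst_gens s f \<^bold>^ n"
  by (simp add: star_power_def subst_gens_power subst_gens_star)

lemmas subst_gens_simps = subst_gens_add subst_gens_diff subst_gens_minus subst_gens_mult
  subst_gens_sum subst_gens_power subst_gens_star subst_gens_star_power

lemma subst_gens_subst_gens: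
  "subst_gens s (subst_gens t f) = subst_gens (\<lambda>g. subst_gens s (t g)) f"
  by (induction f rule: free_star_induct) (simp_all add: subst_gens_simps)

lemma subst_gens_gen_id: "subst_gens gen f = f"
  by (induction f rule: free_star_induct) (simp_all add: subst_gens_simps)

section \<open>Presented star-algebras\<close>

lemma ring_free_star_algebra: "ring free_star_algebra"
proof (rule ringI)
  show "abelian_group (free_star_algebra :: 'a free_star star_algebra)"
  proof (rule abelian_groupI)
    show "\<exists>y\<in>carrier free_star_algebra. y \<oplus>\<^bsub>free_star_algebra\<^esub> x = \<zero>\<^bsub>free_star_algebra\<^esub>"
      for x :: "'a free_star"
      by (auto simp: free_star_algebra_def intro: exI[of _ "- x"])
  qed (auto simp: free_star_algebra_def add.commute add.left_commute)
  show "monoid (free_star_algebra :: 'a free_star star_algebra)"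
    by (rule monoidI) (auto simp: free_star_algebra_def mult.assoc)
qed (auto simp: free_star_algebra_def ring_distribs)

lemma ideal_relation_ideal: "ideal (relation_ideal E) free_star_algebra"
  unfolding relation_ideal_def
  by (rule ring.genideal_ideal[OF ring_free_star_algebra]) (simp add: free_star_algebra_def)

lemma relation_ideal_0: "0 \<in> relation_ideal E"
  using additive_subgroup.zero_closed[OF ideal.axioms(1)[OF ideal_relation_ideal[of E]]]
  by (simp add: free_star_algebra_def)

lemma relation_ideal_add: "f \<in> relation_ideal E \<Longrightarrow> g \<in> relation_ideal E \<Longrightarrow> f + g \<in> relation_ideal E"
  using additive_subgroup.a_closed[OF ideal.axioms(1)[OF ideal_relation_ideal[of E]], of f g]
  by (simp add: free_star_algebra_def)

lemma relation_ideal_mult_left: "f \<in> relation_ideal E \<Longrightarrow> g * f \<in> relation_ideal E"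
  using ideal.I_l_closed[OF ideal_relation_ideal[of E], of f g]
  by (simp add: free_star_algebra_def)

lemma relation_ideal_mult_right: "f \<in> relation_ideal E \<Longrightarrow> f * g \<in> relation_ideal E"
  using ideal.I_r_closed[OF ideal_relation_ideal[of E], of f g]
  by (simp add: free_star_algebra_def)

lemma relation_ideal_relator:
  assumes "(l, r) \<in> E"
  shows "l - r \<in> relation_ideal E" "(l - r)\<^sup>\<star> \<in> relation_ideal E"
  using assms ring.genideal_self[OF ring_free_star_algebra,
      of "{l - r |l r. (l, r) \<in> E} \<union> {(l - r)\<^sup>\<star> |l r. (l, r) \<in> E}"]
  unfolding relation_ideal_def by (auto simp: free_star_algebra_def)

text \<open>Stands in for induction over the generated ideal: \<open>K\<close> will each time be the
  preimage of an ideal or the kernel of some map. Closure under negation comes from multiplication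
  by -1.\<close>

lemma relation_ideal_least:
  assumes "0 \<in> K" "\<And>f g. f \<in> K \<Longrightarrow> g \<in> K \<Longrightarrow> f + g \<in> K"
    "\<And>f g. f \<in> K \<Longrightarrow> g * f \<in> K" "\<And>f g. f \<in> K \<Longrightarrow> f * g \<in> K"
    "\<And>l r. (l, r) \<in> E \<Longrightarrow> l - r \<in> K" "\<And>l r. (l, r) \<in> E \<Longrightarrow> (l - r)\<^sup>\<star> \<in> K"
  shows "relation_ideal E \<subseteq> K"
proof -
  let ?R = "free_star_algebra :: 'a free_star star_algebra"
  have uminus: "- f \<in> K" if "f \<in> K" for f
    using assms(3)[OF that, of "- 1"] by simp
  interpret ring ?R by (rule ring_free_star_algebra)
  have "\<ominus>\<^bsub>?R\<^esub> f = - f" for f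
    by (rule minus_equality) (auto simp: free_star_algebra_def)
  then have "additive_subgroup K ?R"
    by (intro additive_subgroup.intro add.subgroupI)
      (use assms(1,2) uminus in \<open>auto simp: free_star_algebra_def a_inv_def\<close>)
  then have "ideal K ?R"
    by (intro ideal.intro ring_free_star_algebra)
      (auto simp: free_star_algebra_def ideal_axioms_def assms(3,4))
  then show ?thesis
    unfolding relation_ideal_def
    by (rule genideal_minimal) (use assms(5,6) in auto)
qed

lemma relation_ideal_star: "f \<in> relation_ideal E \<Longrightarrow> f\<^sup>\<star> \<in> relation_ideal E"
proof -
  have "relation_ideal E \<subseteq> {f. f\<^sup>\<star> \<in> relation_ideal E}"
    by (rule relation_ideal_least)
      (auto simp: fstar_add fstar_mult relation_ideal_0 relation_ideal_add
        relation_ideal_mult_left relation_ideal_mult_right relation_ideal_relator)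
  then show "f \<in> relation_ideal E \<Longrightarrow> f\<^sup>\<star> \<in> relation_ideal E" by auto
qed

lemma relation_ideal_minus: "f \<in> relation_ideal E \<Longrightarrow> - f \<in> relation_ideal E"
  using relation_ideal_mult_left[of f E "- 1"] by simp

lemma residue_class_alt: "residue_class E f = {g. g - f \<in> relation_ideal E}"
proof -
  have "g \<in> (\<lambda>h. h + f) ` relation_ideal E" if "g - f \<in> relation_ideal E" for g
    using that by (rule rev_image_eqI) simp
  then show ?thesis
    by (auto simp: residue_class_def a_r_coset_def r_coset_def free_star_algebra_def)
qed

lemma residue_class_eq_iff: "residue_class E f = residue_class E g \<longleftrightarrow> f - g \<in> relation_ideal E"
proof
  assume "residue_class E f = residue_class E g"
  moreover have "f \<in> residue_class E f"
    by (simp add: residue_class_alt relation_ideal_0)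
  ultimately show "f - g \<in> relation_ideal E"
    by (simp add: residue_class_alt)
next
  assume fg: "f - g \<in> relation_ideal E"
  show "residue_class E f = residue_class E g"
    unfolding residue_class_alt
    using relation_ideal_add[OF _ fg] relation_ideal_add[OF _ relation_ideal_minus[OF fg]]
    by fastforce
qed

lemma carrier_presented: "carrier (presented E) = range (residue_class E)"
  by (auto simp: presented_def ring.defs FactRing_def A_RCOSETS_def' residue_class_def)
    (auto simp: free_star_algebra_def)

lemma residue_class_closed [simp]: "residue_class E f \<in> carrier (presented E)"
  by (simp add: carrier_presented)

lemma residue_class_ring_hom:
  "residue_class E \<in> ring_hom free_star_algebra (free_star_algebra Quot relation_ideal E)"
  using ideal.rcos_ring_hom[OF ideal_relation_ideal[of E]]
  by (simp add: residue_class_def[abs_def])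

lemma mult_presented [simp]:
  "residue_class E f \<otimes>\<^bsub>presented E\<^esub> residue_class E g = residue_class E (f * g)"
  using ring_hom_mult[OF residue_class_ring_hom[of E], of f g]
  by (simp add: presented_def ring.defs free_star_algebra_def)

lemma add_presented [simp]:
  "residue_class E f \<oplus>\<^bsub>presented E\<^esub> residue_class E g = residue_class E (f + g)"
  using ring_hom_add[OF residue_class_ring_hom[of E], of f g]
  by (simp add: presented_def ring.defs free_star_algebra_def)

lemma one_presented: "\<one>\<^bsub>presented E\<^esub> = residue_class E 1"
  using ring_hom_one[OF residue_class_ring_hom[of E]]
  by (simp add: presented_def ring.defs free_star_algebra_def)

lemma zero_presented: "\<zero>\<^bsub>presented E\<^esub> = residue_class E 0"
  by (simp add: presented_def ring.defs FactRing_def residue_class_alt)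

text \<open>Scalar multiplication is encoded as a union over all representatives; all members of
  this union are the same class, because the ideal is stable under multiplication by
  \<open>scal c\<close>.\<close>

lemma smult_presented [simp]:
  "c \<odot>\<^bsub>presented E\<^esub> residue_class E f = residue_class E (scal c * f)"
proof -
  have "residue_class E (scal c * g) = residue_class E (scal c * f)" if "g \<in> residue_class E f" for g
    using that relation_ideal_mult_left[of "g - f" E "scal c"]
    by (simp add: residue_class_eq_iff ring_distribs) (simp add: residue_class_alt ring_distribs)
  moreover have "f \<in> residue_class E f"
    by (simp add: residue_class_alt relation_ideal_0)
  ultimately have "(\<Union>g\<in>residue_class E f. residue_class E (scal c * g)) = residue_class E (scal c * f)"
    by (intro SUP_eq_const) blast+
  then show ?thesis
    by (simp add: presented_def ring.defs)
qed

lemma invol_presented [simp]: "invol (presented E) (residue_class E f) = residue_class E (f\<^sup>\<star>)"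
proof -
  have "residue_class E (g\<^sup>\<star>) = residue_class E (f\<^sup>\<star>)" if "g \<in> residue_class E f" for g
    using that relation_ideal_star[of "g - f" E]
    by (simp add: residue_class_eq_iff fstar_diff) (simp add: residue_class_alt fstar_diff)
  moreover have "f \<in> residue_class E f"
    by (simp add: residue_class_alt relation_ideal_0)
  ultimately have "(\<Union>g\<in>residue_class E f. residue_class E (g\<^sup>\<star>)) = residue_class E (f\<^sup>\<star>)"
    by (intro SUP_eq_const) blast+
  then show ?thesis
    by (simp add: presented_def ring.defs)
qed

lemma abelian_monoid_presented: "abelian_monoid (presented E)"
  by (rule abelian_monoidI) (auto simp: carrier_presented zero_presented add_ac)

lemma lin_comb_presented:
  assumes "finite F"
  shows "lin_comb (presented E) (\<lambda>i. residue_class E (v i)) c F =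
    residue_class E (\<Sum>i\<in>F. scal (c i) * v i)"
proof -
  interpret abelian_monoid "presented E" by (rule abelian_monoid_presented)
  show ?thesis
    using assms unfolding lin_comb_def
    by induction (auto simp: finsum_insert Pi_def zero_presented)
qed

section \<open>Homomorphisms between presented algebras induced by substitutions\<close>

lemma subst_gens_relation_ideal:
  assumes "\<And>l r. (l, r) \<in> E \<Longrightarrow> subst_gens s (l - r) \<in> relation_ideal E'"
    and "f \<in> relation_ideal E"
  shows "subst_gens s f \<in> relation_ideal E'"
proof -
  have "relation_ideal E \<subseteq> {f. subst_gens s f \<in> relation_ideal E'}"
  proof (rule relation_ideal_least)
    \<comment> \<open>Adjoint relators require no separate check, since substitution commutes with
      the involution and the target ideal is a star-ideal.\<close>
    show "(l - r)\<^sup>\<star> \<in> {f. subst_gens s f \<in> relation_ideal E'}" if "(l, r) \<in> E" for l r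
      using relation_ideal_star[OF assms(1)[OF that]] by (simp add: subst_gens_star)
  qed (auto simp: subst_gens_add subst_gens_mult relation_ideal_0 relation_ideal_add
      relation_ideal_mult_left relation_ideal_mult_right assms(1))
  with assms(2) show ?thesis by auto
qed

definition quotient_map ::
  "('g free_star \<times> 'g free_star) set \<Rightarrow> ('g \<Rightarrow> 'h free_star) \<Rightarrow>
   ('h free_star \<times> 'h free_star) set \<Rightarrow> 'g free_star set \<Rightarrow> 'h free_star set" where
  "quotient_map E s E' X = (THE Y. \<exists>f. X = residue_class E f \<and> Y = residue_class E' (subst_gens s f))"

lemma quotient_map_residue_class:
  assumes "\<And>l r. (l, r) \<in> E \<Longrightarrow> subst_gens s (l - r) \<in> relation_ideal E'"
  shows "quotient_map E s E' (residue_class E f) = residue_class E' (subst_gens s f)"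
  unfolding quotient_map_def
proof (rule the_equality)
  fix Y
  assume "\<exists>g. residue_class E f = residue_class E g \<and> Y = residue_class E' (subst_gens s g)"
  then obtain g where "f - g \<in> relation_ideal E" "Y = residue_class E' (subst_gens s g)"
    by (auto simp: residue_class_eq_iff)
  with subst_gens_relation_ideal[where f = "f - g", OF assms]
  show "Y = residue_class E' (subst_gens s f)"
    using residue_class_eq_iff[of E' "subst_gens s f" "subst_gens s g"] by (simp add: subst_gens_diff)
qed auto

lemma quotient_map_star_hom:
  assumes "\<And>l r. (l, r) \<in> E \<Longrightarrow> subst_gens s (l - r) \<in> relation_ideal E'"
  shows "quotient_map E s E' \<in> star_hom (presented E) (presented E')"
  unfolding star_hom_def ring_hom_def
  by (auto simp: carrier_presented one_presented quotient_map_residue_class[OF assms] subst_gens_simps)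

section \<open>A ring type containing all quotients\<close>

text \<open>
  The presented algebras depend on parameters and hence are not types. The type below is the
  product of all quotients of the free star-algebra by star-ideals: each presented
  algebra is a corner of it, cut out by a central idempotent, and equations in the
  quotient become equations in a ring type.
\<close>

definition star_ideals :: "'g free_star set set" where
  "star_ideals = {I. 0 \<in> I \<and> (\<forall>f\<in>I. \<forall>g\<in>I. f + g \<in> I) \<and> (\<forall>f\<in>I. \<forall>g. g * f \<in> I \<and> f * g \<in> I) \<and>
     (\<forall>f\<in>I. f\<^sup>\<star> \<in> I)}"

lemma star_idealsD:
  assumes "I \<in> star_ideals"
  shows "0 \<in> I" "f \<in> I \<Longrightarrow> g \<in> I \<Longrightarrow> f + g \<in> I" "f \<in> I \<Longrightarrow> h * f \<in> I" "f \<in> I \<Longrightarrow> f * h \<in> I"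
    "f \<in> I \<Longrightarrow> f\<^sup>\<star> \<in> I" "f \<in> I \<Longrightarrow> - f \<in> I"
proof -
  show *: "f \<in> I \<Longrightarrow> h * f \<in> I" for h f
    using assms by (auto simp: star_ideals_def)
  show "f \<in> I \<Longrightarrow> - f \<in> I"
    using *[of f "- 1"] by simp
qed (use assms in \<open>auto simp: star_ideals_def\<close>)

lemma relation_ideal_in_star_ideals: "relation_ideal E \<in> star_ideals"
  by (auto simp: star_ideals_def relation_ideal_0 relation_ideal_add relation_ideal_mult_left
      relation_ideal_mult_right relation_ideal_star)

definition quotients_rel ::
  "('g free_star set \<Rightarrow> 'g free_star) \<Rightarrow> ('g free_star set \<Rightarrow> 'g free_star) \<Rightarrow> bool" where
  "quotients_rel F G \<longleftrightarrow> (\<forall>I\<in>star_ideals. F I - G I \<in> I)"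

lemma quotients_rel_sym: "quotients_rel F G \<Longrightarrow> quotients_rel G F"
  unfolding quotients_rel_def by (metis minus_diff_eq star_idealsD(6))

lemma quotients_rel_trans: "quotients_rel F G \<Longrightarrow> quotients_rel G H \<Longrightarrow> quotients_rel F H"
  unfolding quotients_rel_def by (metis (no_types, lifting) diff_add_cancel add_diff_eq star_idealsD(2))

lemma equivp_quotients_rel: "equivp quotients_rel"
proof (rule equivpI)
  show "reflp quotients_rel"
    by (auto simp: reflp_def quotients_rel_def star_idealsD)
qed (blast intro: sympI transpI quotients_rel_sym quotients_rel_trans)+

quotient_type 'g quotients = "'g free_star set \<Rightarrow> 'g free_star" / quotients_rel
  by (rule equivp_quotients_rel)

instantiation quotients :: (type) ring_1
begin

lift_definition zero_quotients :: "'a quotients" is "\<lambda>I. 0" .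

lift_definition one_quotients :: "'a quotients" is "\<lambda>I. 1" .

lift_definition plus_quotients :: "'a quotients \<Rightarrow> 'a quotients \<Rightarrow> 'a quotients" is
  "\<lambda>F G I. F I + G I"
  unfolding quotients_rel_def by (metis (no_types, lifting) add_diff_add star_idealsD(2))

lift_definition uminus_quotients :: "'a quotients \<Rightarrow> 'a quotients" is "\<lambda>F I. - F I"
  unfolding quotients_rel_def by (metis minus_diff_minus star_idealsD(6))

lift_definition minus_quotients :: "'a quotients \<Rightarrow> 'a quotients \<Rightarrow> 'a quotients" is
  "\<lambda>F G I. F I - G I"
proof (unfold quotients_rel_def, rule ballI)
  fix F F' G G' :: "'a free_star set \<Rightarrow> 'a free_star" and I :: "'a free_star set"
  assume "\<forall>I\<in>star_ideals. F I - F' I \<in> I" "\<forall>I\<in>star_ideals. G I - G' I \<in> I" "I \<in> star_ideals"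
  then show "F I - G I - (F' I - G' I) \<in> I"
    using star_idealsD(2)[of I "F I - F' I" "- (G I - G' I)"] star_idealsD(6)[of I "G I - G' I"]
    by (simp add: algebra_simps)
qed

lift_definition times_quotients :: "'a quotients \<Rightarrow> 'a quotients \<Rightarrow> 'a quotients" is
  "\<lambda>F G I. F I * G I"
proof (unfold quotients_rel_def, rule ballI)
  fix F F' G G' :: "'a free_star set \<Rightarrow> 'a free_star" and I :: "'a free_star set"
  assume "\<forall>I\<in>star_ideals. F I - F' I \<in> I" "\<forall>I\<in>star_ideals. G I - G' I \<in> I" "I \<in> star_ideals"
  then show "F I * G I - F' I * G' I \<in> I"
    using star_idealsD(2)[of I "(F I - F' I) * G I" "F' I * (G I - G' I)"]
      star_idealsD(3)[of I "G I - G' I" "F' I"] star_idealsD(4)[of I "F I - F' I" "G I"]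
    by (simp add: algebra_simps)
qed

instance
proof
  \<comment> \<open>The zero ideal is itself a star-ideal, so the product has a coordinate in which
    0 and 1 differ.\<close>
  have "{0} \<in> (star_ideals :: 'a free_star set set)"
    by (auto simp: star_ideals_def)
  then show "(0 :: 'a quotients) \<noteq> 1"
    by (auto simp: zero_quotients_def one_quotients_def quotients.abs_eq_iff quotients_rel_def
        intro!: bexI[of _ "{0}"])
qed (transfer; simp add: quotients_rel_def algebra_simps star_idealsD)+

end

section \<open>Scalars, involution and residues in the product of all quotients\<close>

lift_definition cscale :: "complex \<Rightarrow> 'g quotients \<Rightarrow> 'g quotients" (infixr \<open>*s\<close> 75) is
  "\<lambda>c F I. scal c * F I"
  unfolding quotients_rel_def by (metis right_diff_distrib star_idealsD(3))

lift_definition qstar :: "'g quotients \<Rightarrow> 'g quotients" is "\<lambda>F I. (F I)\<^sup>\<star>"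
  unfolding quotients_rel_def by (metis fstar_diff star_idealsD(5))

text \<open>All coordinates except the one at \<open>relation_ideal E\<close> are 0. Hence
  \<open>residue E 1\<close> is the idempotent that cuts out the corner and not the unit of the
  type; it appears as \<open>e\<close> in the later locales.\<close>

definition residue :: "('g free_star \<times> 'g free_star) set \<Rightarrow> 'g free_star \<Rightarrow> 'g quotients" where
  "residue E f = abs_quotients (\<lambda>I. if I = relation_ideal E then f else 0)"

lemma cscale_mult_left [simp]: "c *s x * y = c *s (x * y)"
  by transfer (simp add: quotients_rel_def mult.assoc star_idealsD)

lemma cscale_mult_right [simp]: "x * c *s y = c *s (x * y)"
proof (transfer, unfold quotients_rel_def, rule ballI)
  fix x y :: "'a free_star set \<Rightarrow> 'a free_star" and c and I :: "'a free_star set"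
  assume "I \<in> star_ideals"
  moreover have "x I * (scal c * y I) = scal c * (x I * y I)"
    by (metis scal_commute mult.assoc)
  ultimately show "x I * (scal c * y I) - scal c * (x I * y I) \<in> I"
    by (simp add: star_idealsD)
qed

lemma cscale_cscale [simp]: "c *s d *s x = (c * d) *s x"
  by transfer (simp add: quotients_rel_def scal_mult mult.assoc star_idealsD)

lemma cscale_1 [simp]: "1 *s x = x"
  by transfer (simp add: quotients_rel_def star_idealsD)

lemma cscale_add_right: "c *s (x + y) = c *s x + c *s y"
  by transfer (simp add: quotients_rel_def ring_distribs star_idealsD)

lemma cscale_add_left: "(c + d) *s x = c *s x + d *s x"
  by transfer (simp add: quotients_rel_def ring_distribs scal_add star_idealsD)

interpretation quotients: vector_space cscale
  by standard (simp_all add: cscale_add_left cscale_add_right)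

lemmas cscale_simps = cscale_add_right quotients.scale_right_diff_distrib

lemma qstar_mult: "qstar (x * y) = qstar y * qstar x"
  by transfer (simp add: quotients_rel_def fstar_mult star_idealsD)

lemma qstar_add: "qstar (x + y) = qstar x + qstar y"
  by transfer (simp add: quotients_rel_def fstar_add star_idealsD)

lemma qstar_diff: "qstar (x - y) = qstar x - qstar y"
  by transfer (simp add: quotients_rel_def fstar_diff star_idealsD)

lemma qstar_0 [simp]: "qstar 0 = 0"
  by transfer (simp add: quotients_rel_def star_idealsD)

lemma qstar_1 [simp]: "qstar 1 = 1"
  by transfer (simp add: quotients_rel_def star_idealsD)

lemma qstar_cscale: "qstar (c *s x) = cnj c *s qstar x"
proof (transfer, unfold quotients_rel_def, rule ballI)
  fix x :: "'a free_star set \<Rightarrow> 'a free_star" and c and I :: "'a free_star set"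
  assume "I \<in> star_ideals"
  then show "(scal c * x I)\<^sup>\<star> - scal (cnj c) * (x I)\<^sup>\<star> \<in> I"
    by (simp add: fstar_mult scal_commute star_idealsD)
qed

lemma qstar_qstar [simp]: "qstar (qstar x) = x"
  by transfer (simp add: quotients_rel_def star_idealsD)

lemma qstar_power: "qstar (x ^ n) = qstar x ^ n"
  by (induction n) (simp_all add: qstar_mult power_commutes)

lemmas qstar_simps = qstar_mult qstar_add qstar_diff qstar_cscale qstar_power

lemma residue_mult: "residue E (f * g) = residue E f * residue E g"
  by (auto simp: residue_def times_quotients.abs_eq intro!: arg_cong[of _ _ abs_quotients])

lemma residue_add: "residue E (f + g) = residue E f + residue E g"
  by (auto simp: residue_def plus_quotients.abs_eq intro!: arg_cong[of _ _ abs_quotients])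

lemma residue_diff: "residue E (f - g) = residue E f - residue E g"
  by (auto simp: residue_def minus_quotients.abs_eq intro!: arg_cong[of _ _ abs_quotients])

lemma residue_0 [simp]: "residue E 0 = 0"
  using residue_diff[of E 0 0] by simp

lemma residue_minus: "residue E (- f) = - residue E f"
  using residue_diff[of E 0 f] by simp

lemma residue_star: "residue E (f\<^sup>\<star>) = qstar (residue E f)"
  by (auto simp: residue_def qstar.abs_eq intro!: arg_cong[of _ _ abs_quotients])

lemma residue_scal_mult: "residue E (scal c * f) = c *s residue E f"
  by (auto simp: residue_def cscale.abs_eq intro!: arg_cong[of _ _ abs_quotients])

lemma residue_scal: "residue E (scal c) = c *s residue E 1"
  using residue_scal_mult[of E c 1] by simp

lemma residue_sum: "residue E (\<Sum>i\<in>A. f i) = (\<Sum>i\<in>A. residue E (f i))"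
  by (induction A rule: infinite_finite_induct) (simp_all add: residue_add)

text \<open>Only the coordinate at \<open>relation_ideal E\<close> can be non-zero, and there
  equality means equality modulo the ideal. This makes equations in the ring type and in the
  presented algebra interchangeable.\<close>

lemma residue_eq_0_iff: "residue E f = 0 \<longleftrightarrow> f \<in> relation_ideal E"
  using relation_ideal_in_star_ideals[of E]
  by (auto simp: residue_def zero_quotients_def quotients.abs_eq_iff quotients_rel_def star_idealsD)

lemma residue_eq_iff: "residue E f = residue E g \<longleftrightarrow> residue_class E f = residue_class E g"
  using residue_eq_0_iff[of E "f - g"] by (simp add: residue_diff residue_class_eq_iff)

lemma residue_relation: "(l, r) \<in> E \<Longrightarrow> residue E l = residue E r"
  by (simp add: residue_eq_iff residue_class_eq_iff relation_ideal_relator)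

lemma residue_1_mult [simp]: "residue E 1 * residue E f = residue E f" "residue E f * residue E 1 = residue E f"
  by (simp_all flip: residue_mult)

text \<open>The power with exponent 0 is the unit of the whole product, not of the corner; this is
  the origin of the factor \<open>residue E 1\<close> in front of residues of powers.\<close>

definition qpow :: "'g quotients \<Rightarrow> int \<Rightarrow> 'g quotients" where
  "qpow x n = (if 0 \<le> n then x ^ nat n else qstar x ^ nat (- n))"

lemma residue_power: "residue E (f ^ n) = residue E 1 * residue E f ^ n"
  by (induction n) (simp_all add: residue_mult mult.assoc[symmetric])

lemma residue_star_power: "residue E (f \<^bold>^ n) = residue E 1 * qpow (residue E f) n"
  by (simp add: star_power_def qpow_def residue_power residue_star)

lemmas residue_simps = residue_add residue_diff residue_minus residue_mult residue_sum residue_power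
  residue_star residue_star_power residue_scal

section \<open>Spanning by ordered monomials\<close>

lemma skew_power_right:
  fixes t w :: "'g quotients"
  assumes "t * w = d *s (w * t)"
  shows "t * w ^ j = d ^ j *s (w ^ j * t)"
proof (induction j)
  case (Suc j)
  have "t * w ^ Suc j = (t * w) * w ^ j" by (simp add: mult.assoc)
  also have "\<dots> = d *s (w * (t * w ^ j))" by (simp add: assms mult.assoc)
  also have "\<dots> = d ^ Suc j *s (w ^ Suc j * t)" by (simp add: Suc mult.assoc)
  finally show ?case .
qed simp

lemma skew_power_left:
  fixes t w :: "'g quotients"
  assumes "w * t = d *s (t * w)"
  shows "w ^ j * t = d ^ j *s (t * w ^ j)"
proof (induction j)
  case (Suc j)
  have "w ^ Suc j * t = w * (w ^ j * t)" by (simp add: mult.assoc)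
  also have "\<dots> = d ^ j *s ((w * t) * w ^ j)" by (simp add: Suc mult.assoc)
  also have "\<dots> = d ^ Suc j *s (t * w ^ Suc j)" by (simp add: assms mult.assoc mult.commute)
  finally show ?case .
qed simp

text \<open>Here \<open>y\<close> can be moved past \<open>w\<close> only behind \<open>t\<close>.
  One factor \<open>w\<close> is pulled in front of \<open>t\<close> at the cost of
  \<open>d\<close>, so that the induction hypothesis again finds \<open>t\<close> next to
  \<open>y\<close>, and is then pushed back.\<close>

lemma skew_power_under:
  fixes t w y :: "'g quotients"
  assumes tw: "t * w = d *s (w * t)" and "d \<noteq> 0" and tyw: "t * (y * w) = c *s (t * (w * y))"
  shows "t * (y * w ^ j) = c ^ j *s (t * (w ^ j * y))"
proof (induction j)
  case (Suc j)
  have "t * (y * w ^ Suc j) = (t * (y * w)) * w ^ j" by (simp add: mult.assoc)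
  also have "\<dots> = c *s ((t * w) * (y * w ^ j))" by (simp add: tyw mult.assoc)
  also have "\<dots> = (c * d) *s (w * (t * (y * w ^ j)))" by (simp add: tw mult.assoc)
  also have "\<dots> = (c * c ^ j) *s (d *s (w * t) * (w ^ j * y))" by (simp add: Suc mult_ac)
  also have "\<dots> = c ^ Suc j *s (t * (w ^ Suc j * y))" by (simp flip: tw add: mult.assoc)
  finally show ?case .
qed simp

lemma qpow_simps [simp]:
  "qpow x 0 = 1" "qpow x (int j) = x ^ j" "qpow x (- int j) = qstar x ^ j"
  by (simp_all add: qpow_def)

lemma int_cases_Suc:
  obtains j where "n = int j" | j where "n = - int (Suc j)"
  by (metis int_cases)

lemma qpow_Suc:
  "qpow x (int j + 1) = x ^ Suc j" "qpow x (- int (Suc j) + 1) = qstar x ^ j"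
  "qpow x (- int (Suc j)) = qstar x * qstar x ^ j"
  "qpow x (- 1 - int j) = qstar x * qstar x ^ j"
  "qpow x (- int j - 1) = qstar x ^ Suc j" "qpow x (int (Suc j) - 1) = x ^ j"
  by (simp_all add: qpow_def nat_add_distrib)

text \<open>
  The locale is instantiated three times: with \<open>t = 1 - x x\<^sup>*\<close>, \<open>u = h\<close> in a solid torus, and with
  \<open>t = \<xi>\<close>, \<open>u = b\<close> and \<open>t = 1 - z z\<^sup>* - \<xi>\<close>, \<open>u = a\<close> in the lens space. Most relations are only
  available after multiplication by \<open>t\<close>.
\<close>

locale disc_part =
  fixes t z u :: "'g quotients" and r \<kappa> :: complex
  assumes r_nonzero: "r \<noteq> 0"
    and t_z: "t * z = r *s (z * t)" and t_zs: "t * qstar z = inverse r *s (qstar z * t)"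
    and t_u: "t * u = u * t" and t_us: "t * qstar u = qstar u * t"
    and t_z_zs: "t * (z * qstar z) = t - t * t"
    and t_zs_z: "t * (qstar z * z) = t - r *s (t * t)"
    and t_u_us: "t * (u * qstar u) = t" and t_us_u: "t * (qstar u * u) = t"
    and t_u_z: "t * (u * z) = \<kappa> *s (t * (z * u))"
    and t_u_zs: "t * (u * qstar z) = inverse \<kappa> *s (t * (qstar z * u))"
    and t_us_z: "t * (qstar u * z) = inverse \<kappa> *s (t * (z * qstar u))"
    and t_us_zs: "t * (qstar u * qstar z) = \<kappa> *s (t * (qstar z * qstar u))"
begin

definition monomial :: "nat \<Rightarrow> int \<Rightarrow> int \<Rightarrow> 'g quotients" where
  "monomial k m n = t ^ k * qpow z m * qpow u n"

text \<open>A positive exponent leaves a factor \<open>t\<close> in front of every monomial, so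
  relations that hold only behind \<open>t\<close> can be applied to it.\<close>

definition part :: "'g quotients set" where
  "part = quotients.span {monomial k m n |k m n. 0 < k}"

lemma monomial_in_part: "0 < k \<Longrightarrow> monomial k m n \<in> part"
  unfolding part_def by (rule quotients.span_base) auto

lemma t_in_part: "t \<in> part"
  using monomial_in_part[of 1 0 0] by (simp add: monomial_def)

lemma part_closed:
  assumes "\<And>k m n. y * monomial (Suc k) m n \<in> part" and "x \<in> part"
  shows "y * x \<in> part"
  using assms(2) unfolding part_def
proof (induction rule: quotients.span_induct_alt)
  case (step c x w)
  then obtain k m n where "x = monomial (Suc k) m n"
    by (auto simp: gr0_conv_Suc)
  with assms(1)[of k m n] step show ?case
    unfolding part_def by (auto simp: ring_distribs intro: quotients.span_add quotients.span_scale)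
qed (simp add: quotients.span_zero)

lemma z_t: "z * t = inverse r *s (t * z)"
  using r_nonzero by (simp add: t_z)

lemma zs_t: "qstar z * t = r *s (t * qstar z)"
  using r_nonzero by (simp add: t_zs)

lemma t_monomial: "t * monomial k m n = monomial (Suc k) m n"
  by (simp add: monomial_def mult.assoc)

lemma t_closed: "x \<in> part \<Longrightarrow> t * x \<in> part"
  by (rule part_closed) (simp_all add: t_monomial monomial_in_part)

lemma part_scale: "x \<in> part \<Longrightarrow> c *s x \<in> part"
  unfolding part_def by (rule quotients.span_scale)

lemma part_add: "x \<in> part \<Longrightarrow> y \<in> part \<Longrightarrow> x + y \<in> part"
  unfolding part_def by (rule quotients.span_add)

lemma part_diff: "x \<in> part \<Longrightarrow> y \<in> part \<Longrightarrow> x - y \<in> part"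
  unfolding part_def by (rule quotients.span_diff)

lemma tpow_intro: "t ^ k * x \<in> part" if "x \<in> part"
  by (induction k) (simp_all add: that mult.assoc t_closed)

text \<open>\<open>y\<close> passes the powers of \<open>t\<close> up to a scalar, and all of these
  powers but one can be left outside because \<open>part\<close> is stable under them. What remains
  is the case of a single \<open>t\<close>, where the relations behind \<open>t\<close>
  apply.\<close>

lemma left_closed:
  assumes y_t: "y * t = d *s (t * y)" and y: "\<And>m n. t * (y * (qpow z m * qpow u n)) \<in> part"
    and "x \<in> part"
  shows "y * x \<in> part"
proof (rule part_closed[OF _ assms(3)])
  fix k m n
  have "y * monomial (Suc k) m n = d ^ Suc k *s (t ^ k * (t * (y * (qpow z m * qpow u n))))"
    using skew_power_right[OF y_t, of "Suc k"]
    by (simp add: monomial_def power_Suc2 flip: mult.assoc del: power_Suc)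
  then show "y * monomial (Suc k) m n \<in> part"
    by (simp only: part_scale tpow_intro y)
qed

text \<open>Meant for generators that do not occur in the monomials: their action on the ideal is
  determined by their product with \<open>t\<close>, so a word \<open>w\<close> with the same
  product may replace them.\<close>

lemma left_closed_via:
  assumes "y * t = w * t" and "\<And>x. x \<in> part \<Longrightarrow> w * x \<in> part" and "x \<in> part"
  shows "y * x \<in> part"
proof (rule part_closed[OF _ assms(3)])
  fix k m n
  have "y * monomial (Suc k) m n = w * monomial (Suc k) m n"
    unfolding t_monomial[symmetric] mult.assoc[symmetric] assms(1) ..
  then show "y * monomial (Suc k) m n \<in> part"
    by (simp add: assms(2) monomial_in_part)
qed

lemma z_closed: "x \<in> part \<Longrightarrow> z * x \<in> part"
proof (rule left_closed[OF z_t])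
  fix m n
  show "t * (z * (qpow z m * qpow u n)) \<in> part"
  proof (cases m rule: int_cases_Suc)
    case (1 j)
    then have "t * (z * (qpow z m * qpow u n)) = monomial (Suc 0) (m + 1) n"
      by (simp add: monomial_def qpow_Suc mult.assoc)
    then show ?thesis by (simp add: monomial_in_part)
  next
    case (2 j)
    have "t * (z * (qpow z m * qpow u n)) = (t * (z * qstar z)) * (qstar z ^ j * qpow u n)"
      by (simp only: 2 qpow_Suc mult.assoc)
    also have "\<dots> = monomial (Suc 0) (- int j) n - monomial (Suc (Suc 0)) (- int j) n"
      by (simp add: t_z_zs monomial_def algebra_simps)
    finally show ?thesis by (simp add: part_diff monomial_in_part)
  qed
qed

lemma zs_closed: "x \<in> part \<Longrightarrow> qstar z * x \<in> part"
proof (rule left_closed[OF zs_t])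
  fix m n
  show "t * (qstar z * (qpow z m * qpow u n)) \<in> part"
  proof (cases "- m" rule: int_cases_Suc)
    case (1 j)
    then have m: "m = - int j" by simp
    then have "t * (qstar z * (qpow z m * qpow u n)) = monomial (Suc 0) (m - 1) n"
      by (simp only: monomial_def qpow_Suc mult.assoc) (simp add: mult.assoc)
    then show ?thesis by (simp add: monomial_in_part)
  next
    case (2 j)
    then have m: "m = int (Suc j)" by simp
    have "t * (qstar z * (qpow z m * qpow u n)) = (t * (qstar z * z)) * (z ^ j * qpow u n)"
      by (simp only: m qpow_simps power_Suc mult.assoc)
    also have "\<dots> = monomial (Suc 0) (int j) n - r *s monomial (Suc (Suc 0)) (int j) n"
      by (simp add: t_zs_z monomial_def algebra_simps)
    finally show ?thesis by (simp add: part_diff part_scale monomial_in_part)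
  qed
qed

lemma z_power_closed: "x \<in> part \<Longrightarrow> z ^ n * x \<in> part" "x \<in> part \<Longrightarrow> qstar z ^ n * x \<in> part"
  by (induction n; simp add: mult.assoc z_closed zs_closed)+

lemma t_qpow_z: "\<exists>c. c \<noteq> 0 \<and> t * qpow z m = c *s (qpow z m * t)"
proof (cases m rule: int_cases_Suc)
  case (1 j)
  then show ?thesis
    using skew_power_right[OF t_z, of j] r_nonzero by (intro exI[of _ "r ^ j"]) simp
next
  case (2 j)
  then show ?thesis
    using skew_power_right[OF t_zs, of "Suc j"] r_nonzero
    by (intro exI[of _ "inverse r ^ Suc j"]) (simp add: qpow_Suc)
qed

lemma t_u_qpow_z: "\<exists>c. t * (u * qpow z m) = c *s (t * (qpow z m * u))"
proof (cases m rule: int_cases_Suc)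
  case (1 j)
  then show ?thesis
    using skew_power_under[OF t_z r_nonzero t_u_z, of j] by auto
next
  case (2 j)
  then show ?thesis
    using skew_power_under[OF t_zs _ t_u_zs, of "Suc j"] r_nonzero by (auto simp: qpow_Suc)
qed

lemma t_us_qpow_z: "\<exists>c. t * (qstar u * qpow z m) = c *s (t * (qpow z m * qstar u))"
proof (cases m rule: int_cases_Suc)
  case (1 j)
  then show ?thesis
    using skew_power_under[OF t_z r_nonzero t_us_z, of j] by auto
next
  case (2 j)
  then show ?thesis
    using skew_power_under[OF t_zs _ t_us_zs, of "Suc j"] r_nonzero by (auto simp: qpow_Suc)
qed

text \<open>\<open>t\<close> passes \<open>qpow z m\<close> up to a non-zero scalar, absorbs
  \<open>v\<close>, and returns with the same scalar.\<close>

lemma cancel_in_part: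
  assumes "t * v = t"
  shows "t * (qpow z m * (v * x)) = t * (qpow z m * x)"
proof -
  obtain c where c: "t * qpow z m = c *s (qpow z m * t)" using t_qpow_z by blast
  have "t * (qpow z m * (v * x)) = c *s (qpow z m * (t * v) * x)"
    by (simp add: c flip: mult.assoc)
  also have "\<dots> = t * (qpow z m * x)"
    by (simp add: assms c flip: mult.assoc)
  finally show ?thesis .
qed

lemma left_closed_u:
  assumes "y * t = t * y" and yz: "\<And>m. \<exists>c. t * (y * qpow z m) = c *s (t * (qpow z m * y))"
    and y: "\<And>m n. t * (qpow z m * (y * qpow u n)) \<in> part" and "x \<in> part"
  shows "y * x \<in> part"
proof (rule left_closed[OF _ _ assms(4)])
  show "y * t = 1 *s (t * y)" using assms(1) by simp
  fix m n
  obtain c where c: "t * (y * qpow z m) = c *s (t * (qpow z m * y))" using yz by blast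
  have "t * (y * (qpow z m * qpow u n)) = (t * (y * qpow z m)) * qpow u n"
    by (simp only: mult.assoc)
  also have "\<dots> = c *s (t * (qpow z m * (y * qpow u n)))"
    by (simp add: c mult.assoc)
  finally show "t * (y * (qpow z m * qpow u n)) \<in> part"
    by (simp add: y part_scale)
qed

lemma u_closed: "x \<in> part \<Longrightarrow> u * x \<in> part"
proof (rule left_closed_u[OF t_u[symmetric] t_u_qpow_z])
  fix m n
  show "t * (qpow z m * (u * qpow u n)) \<in> part"
  proof (cases n rule: int_cases_Suc)
    case (1 j)
    then have "t * (qpow z m * (u * qpow u n)) = monomial (Suc 0) m (n + 1)"
      by (simp add: monomial_def qpow_Suc mult.assoc)
    then show ?thesis by (simp add: monomial_in_part)
  next
    case (2 j)
    have "t * (qpow z m * (u * qpow u n)) = monomial (Suc 0) m (- int j)"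
      using cancel_in_part[OF t_u_us, of m "qstar u ^ j"]
      by (simp add: 2 qpow_Suc monomial_def mult.assoc)
    then show ?thesis by (simp add: monomial_in_part)
  qed
qed

lemma us_closed: "x \<in> part \<Longrightarrow> qstar u * x \<in> part"
proof (rule left_closed_u[OF t_us[symmetric] t_us_qpow_z])
  fix m n
  show "t * (qpow z m * (qstar u * qpow u n)) \<in> part"
  proof (cases "- n" rule: int_cases_Suc)
    case (1 j)
    then have n: "n = - int j" by simp
    then have "t * (qpow z m * (qstar u * qpow u n)) = monomial (Suc 0) m (n - 1)"
      by (simp only: monomial_def qpow_Suc mult.assoc) (simp add: mult.assoc)
    then show ?thesis by (simp add: monomial_in_part)
  next
    case (2 j)
    then have n: "n = int (Suc j)" by simp
    have "t * (qpow z m * (qstar u * qpow u n)) = monomial (Suc 0) m (int j)"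
      using cancel_in_part[OF t_us_u, of m "u ^ j"]
      unfolding n qpow_simps power_Suc by (simp add: monomial_def mult.assoc)
    then show ?thesis by (simp add: monomial_in_part)
  qed
qed

lemmas closed = t_closed z_closed zs_closed u_closed us_closed

end

lemma span_left_mult:
  fixes x y :: "'g quotients"
  assumes "x \<in> quotients.span B" "\<And>b. b \<in> B \<Longrightarrow> y * b \<in> quotients.span B'"
  shows "y * x \<in> quotients.span B'"
  using assms(1)
proof (induction rule: quotients.span_induct_alt)
  case (step c x w)
  then show ?case
    using assms(2)[of x] by (auto simp: ring_distribs intro: quotients.span_add quotients.span_scale)
qed (simp add: quotients.span_zero)

lemma residue_in_span:
  assumes "residue E 1 \<in> quotients.span B"
    and "\<And>g x. x \<in> quotients.span B \<Longrightarrow> residue E (gen g) * x \<in> quotients.span B"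
    and "\<And>g x. x \<in> quotients.span B \<Longrightarrow> qstar (residue E (gen g)) * x \<in> quotients.span B"
  shows "residue E f \<in> quotients.span B"
  by (induction f rule: free_star_induct)
    (simp_all add: assms residue_simps quotients.span_add quotients.span_scale)

subsection \<open>Quantum tori\<close>

locale corner_unitary =
  fixes e w :: "'g quotients"
  assumes e_e: "e * e = e" and e_w: "e * w = w" and w_e: "w * e = w" and qstar_e: "qstar e = e"
    and w_ws: "w * qstar w = e" and ws_w: "qstar w * w = e"
begin

text \<open>The factor \<open>e\<close> makes the formula uniform in the sign of n: cancelling
  \<open>w\<close> against its adjoint leaves \<open>e\<close>, whereas \<open>qpow w 0\<close> is
  1.\<close>

lemma mult_qpow: "e * (w * qpow w n) = e * qpow w (n + 1)"
proof (cases n rule: int_cases_Suc)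
  case (2 j)
  have "e * (w * qpow w n) = e * (w * qstar w) * qstar w ^ j"
    by (simp only: 2 qpow_Suc mult.assoc)
  also have "\<dots> = e * qpow w (n + 1)"
    by (simp only: 2 qpow_Suc w_ws e_e)
  finally show ?thesis .
qed (simp add: qpow_Suc)

lemma star_mult_qpow: "e * (qstar w * qpow w n) = e * qpow w (n - 1)"
proof (cases "- n" rule: int_cases_Suc)
  case (1 j)
  then have n: "n = - int j" by simp
  show ?thesis unfolding n qpow_Suc by simp
next
  case (2 j)
  then have n: "n = int (Suc j)" by simp
  have "e * (qstar w * qpow w n) = e * (qstar w * w) * w ^ j"
    by (simp only: n qpow_simps power_Suc mult.assoc)
  also have "\<dots> = e * qpow w (n - 1)"
    by (simp only: n qpow_Suc ws_w e_e)
  finally show ?thesis .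
qed

end

lemma skew_qpow:
  fixes t w :: "'g quotients"
  assumes "t * w = d *s (w * t)" "t * qstar w = d' *s (qstar w * t)"
  obtains c where "t * qpow w m = c *s (qpow w m * t)"
proof (cases m rule: int_cases_Suc)
  case (1 j)
  then show ?thesis
    using skew_power_right[OF assms(1), of j] that[of "d ^ j"] by simp
next
  case (2 j)
  then show ?thesis
    using skew_power_right[OF assms(2), of "Suc j"] that[of "d' ^ Suc j"]
    by (simp add: qpow_Suc)
qed

lemma commute_qpow:
  fixes t w :: "'g quotients"
  assumes "t * w = w * t" "t * qstar w = qstar w * t"
  shows "t * qpow w m = qpow w m * t"
  using skew_power_right[of t w 1] skew_power_right[of t "qstar w" 1] assms
  by (auto simp: qpow_def)

locale corner_torus = Z: corner_unitary e z + U: corner_unitary e u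
  for e z u :: "'g quotients" +
  fixes \<kappa> :: complex
  assumes u_z: "u * z = \<kappa> *s (z * u)" and u_zs: "u * qstar z = inverse \<kappa> *s (qstar z * u)"
    and us_z: "qstar u * z = inverse \<kappa> *s (z * qstar u)" and us_zs: "qstar u * qstar z = \<kappa> *s (qstar z * qstar u)"
begin

definition monomials :: "'g quotients set" where
  "monomials = {e * (qpow z m * qpow u n) |m n. True}"

lemma monomialI: "e * (qpow z m * qpow u n) \<in> quotients.span monomials"
  by (rule quotients.span_base) (auto simp: monomials_def)

lemma monomials_left_mult:
  assumes "x \<in> quotients.span monomials"
    and "\<And>m n. y * (e * (qpow z m * qpow u n)) \<in> quotients.span monomials"
  shows "y * x \<in> quotients.span monomials"
  using assms(1) by (rule span_left_mult) (use assms(2) in \<open>auto simp: monomials_def\<close>)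

lemma e_in_span: "e \<in> quotients.span monomials"
  using monomialI[of 0 0] by simp

lemma e_zs: "e * qstar z = qstar z" "qstar z * e = qstar z"
  using Z.e_w Z.w_e Z.qstar_e by (metis qstar_mult)+

lemma e_us: "e * qstar u = qstar u" "qstar u * e = qstar u"
  using U.e_w U.w_e U.qstar_e by (metis qstar_mult)+

lemma e_qpow_z: "e * qpow z m = qpow z m * e"
  by (rule commute_qpow) (simp_all add: e_zs Z.e_w Z.w_e)

text \<open>Treats \<open>u\<close> and its adjoint together; \<open>f\<close> records the shift of
  the exponent by 1 or by -1.\<close>

lemma span_closed:
  assumes "y * e = e * y" "y * z = d *s (z * y)" "y * qstar z = d' *s (qstar z * y)"
    and pow: "\<And>n. e * (y * qpow u n) = e * qpow u (f n)"
    and x: "x \<in> quotients.span monomials"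
  shows "y * x \<in> quotients.span monomials"
  using x
proof (rule monomials_left_mult)
  fix m n
  obtain c where c: "y * qpow z m = c *s (qpow z m * y)"
    using skew_qpow[OF assms(2,3)] .
  have "y * (e * (qpow z m * qpow u n)) = e * (y * qpow z m) * qpow u n"
    by (simp add: assms(1) flip: mult.assoc)
  also have "\<dots> = c *s (e * qpow z m * (y * qpow u n))"
    by (simp add: c mult.assoc)
  also have "\<dots> = c *s (qpow z m * (e * (y * qpow u n)))"
    by (simp add: e_qpow_z mult.assoc)
  also have "\<dots> = c *s (e * (qpow z m * qpow u (f n)))"
    unfolding pow by (simp add: e_qpow_z flip: mult.assoc)
  finally show "y * (e * (qpow z m * qpow u n)) \<in> quotients.span monomials"
    by (simp add: monomialI quotients.span_scale)
qed

lemma u_closed: "x \<in> quotients.span monomials \<Longrightarrow> u * x \<in> quotients.span monomials"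
  by (rule span_closed[OF _ u_z u_zs U.mult_qpow]) (simp_all add: U.e_w U.w_e)

lemma us_closed: "x \<in> quotients.span monomials \<Longrightarrow> qstar u * x \<in> quotients.span monomials"
  by (rule span_closed[OF _ us_z us_zs U.star_mult_qpow]) (simp_all add: e_us)

lemma z_closed: "x \<in> quotients.span monomials \<Longrightarrow> z * x \<in> quotients.span monomials"
proof (erule monomials_left_mult)
  fix m n
  have "z * (e * (qpow z m * qpow u n)) = e * (z * qpow z m) * qpow u n"
    by (simp add: Z.e_w Z.w_e flip: mult.assoc)
  then show "z * (e * (qpow z m * qpow u n)) \<in> quotients.span monomials"
    using monomialI[of "m + 1" n] by (simp add: Z.mult_qpow mult.assoc)
qed

lemma zs_closed: "x \<in> quotients.span monomials \<Longrightarrow> qstar z * x \<in> quotients.span monomials"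
proof (erule monomials_left_mult)
  fix m n
  have "qstar z * (e * (qpow z m * qpow u n)) = e * (qstar z * qpow z m) * qpow u n"
    by (simp add: e_zs flip: mult.assoc)
  then show "qstar z * (e * (qpow z m * qpow u n)) \<in> quotients.span monomials"
    using monomialI[of "m - 1" n] by (simp add: Z.star_mult_qpow mult.assoc)
qed

end

lemma residue_1_star_mult [simp]:
  "residue E 1 * qstar (residue E f) = qstar (residue E f)"
  "qstar (residue E f) * residue E 1 = qstar (residue E f)"
  by (simp_all flip: residue_star)

lemma residue_1_qpow_commute: "qpow (residue E f) m * residue E 1 = residue E 1 * qpow (residue E f) m"
  by (rule commute_qpow[symmetric]) simp_all

lemma residue_star_powers:
  "residue E (f \<^bold>^ m * g \<^bold>^ n) = residue E 1 * (qpow (residue E f) m * qpow (residue E g) n)"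
proof -
  have "residue E (f \<^bold>^ m * g \<^bold>^ n) =
      residue E 1 * ((qpow (residue E f) m * residue E 1) * qpow (residue E g) n)"
    by (simp add: residue_mult residue_star_power mult.assoc)
  also have "\<dots> = residue E 1 * (qpow (residue E f) m * qpow (residue E g) n)"
    unfolding residue_1_qpow_commute by (simp flip: mult.assoc)
  finally show ?thesis .
qed

subsection \<open>The ideal of a normal element\<close>

text \<open>The presentation enters here. \<open>part\<close> is stable under left multiplication by
  all generators, and the fact that \<open>t\<close> commutes with each of them up to a scalar
  upgrades this left ideal to a two-sided one. The primed elements are representatives in the free
  algebra.\<close>

locale ideal_part = disc_part t z u r \<kappa>
  for t z u :: "'g quotients" and r \<kappa> +
  fixes E :: "('g free_star \<times> 'g free_star) set" and t' z' u' :: "'g free_star"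
  assumes t': "residue E t' = t" and z': "residue E z' = z" and u': "residue E u' = u"
    and gen_closed: "\<And>g x. x \<in> part \<Longrightarrow> residue E (gen g) * x \<in> part"
    and gen_star_closed: "\<And>g x. x \<in> part \<Longrightarrow> qstar (residue E (gen g)) * x \<in> part"
    and normal: "\<And>g. \<exists>c. t * residue E (gen g) = c *s (residue E (gen g) * t)"
    and normal_star: "\<And>g. \<exists>c. t * qstar (residue E (gen g)) = c *s (qstar (residue E (gen g)) * t)"
begin

lemma unit_t: "residue E 1 * t = t" "t * residue E 1 = t"
  by (simp_all flip: t')

lemma monomial_residue: "monomial (Suc k) m n = residue E (t' ^ Suc k * (z' \<^bold>^ m * u' \<^bold>^ n))"
proof -
  have "residue E (t' ^ Suc k) = t ^ Suc k"
    unfolding residue_power t' by (simp add: unit_t flip: mult.assoc)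
  then have "residue E (t' ^ Suc k) * residue E 1 = t ^ Suc k * residue E 1"
    by simp
  also have "\<dots> = t ^ Suc k"
    by (simp only: power_Suc2 mult.assoc unit_t)
  finally have "residue E (t' ^ Suc k) * residue E 1 = t ^ Suc k" .
  then have "residue E (t' ^ Suc k) * (residue E 1 * x) = t ^ Suc k * x" for x
    by (metis mult.assoc)
  then show ?thesis
    unfolding residue_mult[of _ "t' ^ Suc k"] residue_star_powers z' u' monomial_def
    by (simp only: mult.assoc)
qed

lemma part_mult_left: "x \<in> part \<Longrightarrow> residue E f * x \<in> part"
proof (induction f rule: free_star_induct)
  case (scal c)
  have unit: "residue E 1 * monomial (Suc k) m n = monomial (Suc k) m n" for k m n
    by (simp add: monomial_def unit_t flip: mult.assoc)
  have "residue E 1 * x \<in> part"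
    by (rule part_closed) (simp_all add: unit monomial_in_part scal)
  then show ?case by (simp add: residue_scal part_scale)
next
  case (gen g f)
  then show ?case by (simp add: residue_mult mult.assoc gen_closed)
next
  case (star g f)
  then show ?case by (simp add: residue_mult residue_star mult.assoc gen_star_closed)
next
  case (add f g)
  then show ?case by (simp add: residue_add ring_distribs part_add)
qed

lemma normal_residue: "\<exists>f'. t * residue E f = residue E f' * t"
proof (induction f rule: free_star_induct)
  case (scal c)
  show ?case
    by (rule exI[of _ "scal c"]) (simp add: residue_scal unit_t)
next
  case (gen g f)
  then obtain f' c where f: "t * residue E f = residue E f' * t" "t * residue E (gen g) = c *s (residue E (gen g) * t)"
    using normal by blast
  have "t * residue E (gen g * f) = (t * residue E (gen g)) * residue E f"
    by (simp add: residue_mult mult.assoc)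
  also have "\<dots> = residue E (scal c * (gen g * f')) * t"
    unfolding residue_scal_mult by (simp add: f residue_mult mult.assoc)
  finally show ?case by blast
next
  case (star g f)
  then obtain f' c where f: "t * residue E f = residue E f' * t"
      "t * qstar (residue E (gen g)) = c *s (qstar (residue E (gen g)) * t)"
    using normal_star by blast
  have "t * residue E ((gen g)\<^sup>\<star> * f) = (t * qstar (residue E (gen g))) * residue E f"
    by (simp add: residue_mult residue_star mult.assoc)
  also have "\<dots> = residue E (scal c * ((gen g)\<^sup>\<star> * f')) * t"
    unfolding residue_scal_mult by (simp add: f residue_mult residue_star mult.assoc)
  finally show ?case by blast
next
  case (add f g)
  then obtain f' g' where "t * residue E f = residue E f' * t" "t * residue E g = residue E g' * t"
    by blast
  then have "t * residue E (f + g) = residue E (f' + g') * t"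
    by (simp add: residue_add ring_distribs)
  then show ?case by blast
qed

text \<open>Each spanning monomial is \<open>t\<close> times a residue. Normality carries this
  \<open>t\<close> past everything to the right end, and left multiples of \<open>t\<close> are
  already known to lie in \<open>part\<close>.\<close>

lemma part_mult_right:
  assumes x: "x \<in> part"
  shows "x * residue E g \<in> part"
  using x unfolding part_def
proof (induction rule: quotients.span_induct_alt)
  case (step c x y)
  then obtain k m n where "x = monomial (Suc k) m n"
    by (auto simp: gr0_conv_Suc)
  moreover have "residue E (t' ^ Suc k * f) = t * residue E (t' ^ k * f)" for f
    by (simp add: t' residue_mult[of _ t'] mult.assoc)
  ultimately obtain f where "x = t * residue E f"
    unfolding monomial_residue by blast
  then have "x * residue E g = t * residue E (f * g)"
    by (simp add: residue_mult mult.assoc)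
  also obtain f' where "\<dots> = residue E f' * t"
    using normal_residue by blast
  finally have "x * residue E g \<in> part"
    using part_mult_left[OF t_in_part] by simp
  with step show ?case
    unfolding part_def by (auto simp: ring_distribs intro: quotients.span_add quotients.span_scale)
qed (simp add: quotients.span_zero)

end

text \<open>
  \<open>F\<close> consists of the normal elements that vanish on the common boundary, and \<open>N\<close> is the ideal
  they generate, so that spanning can be checked separately in \<open>N\<close> and in the quantum torus.
\<close>

lemma spanning_modulo_ideal:
  assumes "E' = E \<union> F" and "residue E' f \<in> quotients.span ((\<lambda>i. residue E' (v i)) ` A)"
    and "N = quotients.span B" and "\<And>f. f \<in> N \<Longrightarrow> f \<in> quotients.span C" and "\<And>i. i \<in> A \<Longrightarrow> residue E (v i) \<in> quotients.span C"
    and "\<And>g x. x \<in> N \<Longrightarrow> residue E g * x \<in> N" "\<And>g x. x \<in> N \<Longrightarrow> x * residue E g \<in> N"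
    and "\<And>l r. (l, r) \<in> F \<Longrightarrow> residue E (l - r) \<in> N" "\<And>l r. (l, r) \<in> F \<Longrightarrow> residue E ((l - r)\<^sup>\<star>) \<in> N"
  shows "residue E f \<in> quotients.span C"
proof -
  have N: "residue E g \<in> N" if "g \<in> relation_ideal E'" for g
  proof -
    \<comment> \<open>\<open>N\<close> is stable under multiplication by residues on both sides, so
      its preimage in the free algebra is an ideal and only the relators of \<open>E'\<close> have
      to be inspected.\<close>
    have "relation_ideal E' \<subseteq> {f. residue E f \<in> N}"
    proof (rule relation_ideal_least)
      fix l r assume "(l, r) \<in> E'"
      then have "residue E (l - r) \<in> N \<and> residue E ((l - r)\<^sup>\<star>) \<in> N"
      proof (cases "(l, r) \<in> E")
        case True
        then have "residue E (l - r) = 0"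
          by (simp add: residue_diff residue_relation)
        then show ?thesis
          by (simp only: residue_star) (simp add: assms(3) quotients.span_zero)
      qed (use assms(1,8,9) in auto)
      then show "l - r \<in> {f. residue E f \<in> N}" "(l - r)\<^sup>\<star> \<in> {f. residue E f \<in> N}"
        by simp_all
    qed (auto simp: assms(6,7) residue_add residue_mult, auto simp: assms(3) quotients.span_zero quotients.span_add)
    with that show ?thesis by auto
  qed
  \<comment> \<open>A combination that represents the class modulo \<open>E'\<close> is read with
    the same coefficients modulo \<open>E\<close>. The representative \<open>h\<close> changes along
    the induction, hence it is kept arbitrary.\<close>
  have "\<exists>g. residue E' h = residue E' g \<and> residue E g \<in> quotients.span C"
    if "x = residue E' h" "x \<in> quotients.span ((\<lambda>i. residue E' (v i)) ` A)" for x h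
    using that(2,1)
  proof (induction arbitrary: h rule: quotients.span_induct_alt)
    case base
    then show ?case by (intro exI[of _ 0]) (simp add: quotients.span_zero)
  next
    case (step c x y)
    then obtain i where i: "i \<in> A" "x = residue E' (v i)" by auto
    have "y = residue E' (h - scal c * v i)"
      using step(3) by (simp add: residue_diff residue_scal_mult i eq_diff_eq add.commute flip: step.prems)
    with step.IH obtain g where g: "residue E' (h - scal c * v i) = residue E' g" "residue E g \<in> quotients.span C"
      by blast
    show ?case
    proof (intro exI conjI)
      show "residue E' h = residue E' (g + scal c * v i)"
        using g(1) by (simp add: residue_diff residue_add diff_eq_eq)
      show "residue E (g + scal c * v i) \<in> quotients.span C"
        using g(2) assms(5)[OF i(1)]
        by (simp add: residue_add residue_scal_mult quotients.span_add quotients.span_scale)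
    qed
  qed
  from this[OF refl assms(2)] obtain g where g: "residue E' f = residue E' g" "residue E g \<in> quotients.span C"
    by blast
  then have "residue E (f - g) \<in> quotients.span C"
    using N[of "f - g"] assms(4) by (simp add: residue_eq_iff residue_class_eq_iff)
  with g(2) show ?thesis
    using quotients.span_add by (fastforce simp: residue_diff)
qed

section \<open>The quantum solid torus\<close>

locale solid_torus_relations =
  fixes e x h :: "'g quotients" and p \<theta> :: real
  assumes p_nonzero: "p \<noteq> 0"
    and e_e [simp]: "e * e = e" and qstar_e [simp]: "qstar e = e"
    and e_x [simp]: "e * x = x" and x_e [simp]: "x * e = x"
    and e_h [simp]: "e * h = h" and h_e [simp]: "h * e = h"
    and h_hs: "h * qstar h = e" and hs_h: "qstar h * h = e"
    and xs_x': "qstar x * x = p *s (x * qstar x) + (1 - p) *s e"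
    and h_x: "h * x = cis \<theta> *s (x * h)" and h_xs: "h * qstar x = cis (- \<theta>) *s (qstar x * h)"
begin

definition X :: "'g quotients" where
  "X = e - x * qstar x"

lemma e_stars [simp]: "e * qstar x = qstar x" "qstar x * e = qstar x"
    "e * qstar h = qstar h" "qstar h * e = qstar h"
  by (metis e_x x_e e_h h_e qstar_e qstar_mult)+

lemma e_left [simp]: "e * (e * w) = e * w" "e * (x * w) = x * w" "e * (qstar x * w) = qstar x * w"
    "e * (h * w) = h * w" "e * (qstar h * w) = qstar h * w"
  by (simp_all flip: mult.assoc)

lemma h_left: "h * (qstar h * w) = e * w" "qstar h * (h * w) = e * w"
  by (simp_all add: h_hs hs_h flip: mult.assoc)

lemma qstar_X [simp]: "qstar X = X"
  by (simp add: X_def qstar_simps)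

lemma e_X [simp]: "e * X = X" "X * e = X"
  by (simp_all add: X_def algebra_simps)

lemma x_xs: "x * qstar x = e - X"
  by (simp add: X_def)

lemma xs_x: "qstar x * x = e - p *s X"
  by (simp add: xs_x' X_def quotients.scale_left_diff_distrib cscale_simps)

lemma hs_xs: "qstar h * qstar x = cis \<theta> *s (qstar x * qstar h)"
proof -
  have "qstar x * qstar h = cis (- \<theta>) *s (qstar h * qstar x)"
    using arg_cong[OF h_x, of qstar] by (simp add: qstar_simps cis_cnj)
  then show ?thesis by (simp add: cis_mult)
qed

lemma hs_x: "qstar h * x = cis (- \<theta>) *s (x * qstar h)"
proof -
  have "x * qstar h = cis \<theta> *s (qstar h * x)"
    using arg_cong[OF h_xs, of qstar] by (simp add: qstar_simps cis_cnj)
  then show ?thesis by (simp add: cis_mult)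
qed

lemma X_x: "X * x = p *s (x * X)"
proof -
  have "X * x = x - x * (qstar x * x)"
    by (simp add: X_def algebra_simps)
  then show ?thesis by (simp add: xs_x algebra_simps)
qed

lemma xs_X: "qstar x * X = p *s (X * qstar x)"
  using arg_cong[OF X_x, of qstar] by (simp add: qstar_simps)

lemma X_xs: "X * qstar x = inverse p *s (qstar x * X)"
  using p_nonzero by (simp add: xs_X)

lemma X_h: "X * h = h * X"
proof -
  have "x * (qstar x * h) = h * (x * qstar x)"
    by (simp add: h_x h_xs cis_mult mult.assoc[symmetric]) (simp add: h_xs cis_mult mult.assoc)
  then show ?thesis by (simp add: X_def algebra_simps)
qed

lemma X_hs: "X * qstar h = qstar h * X"
  using arg_cong[OF X_h, of qstar] by (simp add: qstar_simps)

lemma disc_part: "disc_part X x h (of_real p) (cis \<theta>)"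
proof
  have inv: "inverse (cis \<theta>) = cis (- \<theta>)" by simp
  show "X * (x * qstar x) = X - X * X" "X * (qstar x * x) = X - of_real p *s (X * X)"
    by (simp_all add: x_xs xs_x algebra_simps)
qed (use p_nonzero in \<open>simp_all add: X_x X_xs X_h X_hs h_hs hs_h h_x h_xs hs_x hs_xs\<close>)

text \<open>The innermost pair equals \<open>e - p *s X\<close>, and carrying \<open>X\<close>
  through the remaining \<open>x ^ n\<close> contributes \<open>p ^ n\<close>; this gives the
  exponent \<open>Suc n\<close>. In the opposite order the innermost pair is \<open>e - X\<close>,
  whence the exponent n of \<open>inverse p\<close> in the companion lemma.\<close>

lemma xs_power_x_power_Suc:
  "qstar x ^ Suc n * x ^ Suc n = qstar x ^ n * x ^ n * (e - (of_real p) ^ Suc n *s X)"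
proof -
  have X: "X * x ^ n = (of_real p) ^ n *s (x ^ n * X)"
    by (rule skew_power_right) (rule X_x)
  have e: "e * x ^ n = x ^ n * e"
    using skew_power_right[of e x 1 n] by simp
  have "qstar x ^ Suc n * x ^ Suc n = qstar x ^ n * (qstar x * x) * x ^ n"
    by (simp only: power_Suc2[of "qstar x"] power_Suc[of x] mult.assoc)
  also have "\<dots> = qstar x ^ n * (e * x ^ n) - (of_real p) *s (qstar x ^ n * (X * x ^ n))"
    by (simp add: xs_x algebra_simps)
  also have "\<dots> = qstar x ^ n * x ^ n * (e - (of_real p) ^ Suc n *s X)"
    unfolding X e by (simp add: algebra_simps)
  finally show ?thesis .
qed

lemma x_power_xs_power_Suc:
  "x ^ Suc n * qstar x ^ Suc n = x ^ n * qstar x ^ n * (e - (inverse (of_real p)) ^ n *s X)"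
proof -
  have X: "X * qstar x ^ n = (inverse (of_real p)) ^ n *s (qstar x ^ n * X)"
    by (rule skew_power_right) (simp add: X_xs)
  have e: "e * qstar x ^ n = qstar x ^ n * e"
    using skew_power_right[of e "qstar x" 1 n] by simp
  have "x ^ Suc n * qstar x ^ Suc n = x ^ n * (x * qstar x) * qstar x ^ n"
    by (simp only: power_Suc2[of x] power_Suc[of "qstar x"] mult.assoc)
  also have "\<dots> = x ^ n * (e * qstar x ^ n) - x ^ n * (X * qstar x ^ n)"
    by (simp add: x_xs algebra_simps)
  also have "\<dots> = x ^ n * qstar x ^ n * (e - (inverse (of_real p)) ^ n *s X)"
    unfolding X e by (simp add: algebra_simps)
  finally show ?thesis .
qed

end

subsection \<open>The presented algebra\<close>

text \<open>Stated for an arbitrary substitution so that it works in two ways: with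
  \<open>gen\<close> it extracts the relations of the presented algebra, with other substitutions it
  shows that a map out of the solid torus is well defined.\<close>

lemma solid_torus_relations_iff:
  fixes p \<theta> :: real
  assumes "p \<noteq> 0"
  shows "solid_torus_relations (residue E 1) (residue E (s Disc_Gen)) (residue E (s Circle_Gen)) p \<theta> \<longleftrightarrow>
    (\<forall>(l, r) \<in> solid_torus_rels p \<theta>. residue E (subst_gens s l) = residue E (subst_gens s r))"
  using residue_star[of E 1] assms
  by (auto simp: solid_torus_relations_def solid_torus_rels_def subst_gens_simps residue_simps diff_eq_eq add.commute)

lemma solid_torus_relations_residue:
  fixes p \<theta> :: real
  assumes "p \<noteq> 0" "solid_torus_rels p \<theta> \<subseteq> E"
  shows "solid_torus_relations (residue E 1) (residue E Sx) (residue E Sh) p \<theta>"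
  using residue_relation assms(2) by (subst solid_torus_relations_iff[OF assms(1)]) (auto simp: subst_gens_gen_id)

definition solid_monomial :: "nat \<Rightarrow> int \<Rightarrow> int \<Rightarrow> solid_gen free_star" where
  "solid_monomial k m n = (1 - Sx * Sx\<^sup>\<star>) ^ k * Sx \<^bold>^ m * Sh \<^bold>^ n"

lemma solid_torus_vec_alt: "solid_torus_vec p \<theta> k m n = residue_class (solid_torus_rels p \<theta>) (solid_monomial k m n)"
  by (simp add: solid_torus_vec_def solid_monomial_def)

lemma solid_torus_spanned:
  fixes p \<theta> :: real and f :: "solid_gen free_star"
  assumes "p \<noteq> 0"
  defines "E \<equiv> solid_torus_rels p \<theta>"
  shows "residue E f \<in> quotients.span ((\<lambda>(k, m, n). residue E (solid_monomial k m n)) ` UNIV)"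
proof -
  \<comment> \<open>Adding this relation makes \<open>x\<close> unitary, so the enlarged
    presentation is that of a quantum torus.\<close>
  define F where "F = {(1 - Sx * Sx\<^sup>\<star>, 0 :: solid_gen free_star)}"
  define E' where "E' = E \<union> F"
  interpret S: solid_torus_relations "residue E 1" "residue E Sx" "residue E Sh" p \<theta>
    by (rule solid_torus_relations_residue) (auto simp: assms)
  interpret S': solid_torus_relations "residue E' 1" "residue E' Sx" "residue E' Sh" p \<theta>
    by (rule solid_torus_relations_residue) (auto simp: assms E'_def E_def)
  have X: "S.X = residue E (1 - Sx * Sx\<^sup>\<star>)"
    by (simp add: S.X_def residue_simps)
  have "S'.X = residue E' (1 - Sx * Sx\<^sup>\<star>)"
    by (simp add: S'.X_def residue_simps)
  also have "\<dots> = 0"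
    using residue_relation[of "1 - Sx * Sx\<^sup>\<star>" 0 E'] by (simp add: E'_def F_def)
  finally have X': "S'.X = 0" .
  interpret P: disc_part S.X "residue E Sx" "residue E Sh" "of_real p" "cis \<theta>"
    by (rule S.disc_part)
  interpret P: ideal_part S.X "residue E Sx" "residue E Sh" "of_real p" "cis \<theta>" E
    "1 - Sx * Sx\<^sup>\<star>" Sx Sh
  proof
    show "x \<in> P.part \<Longrightarrow> residue E (gen g) * x \<in> P.part" for x g
      by (cases g) (auto intro: P.closed)
    show "x \<in> P.part \<Longrightarrow> qstar (residue E (gen g)) * x \<in> P.part" for x g
      by (cases g) (auto intro: P.closed)
    show "\<exists>c. S.X * residue E (gen g) = c *s (residue E (gen g) * S.X)" for g
      by (cases g) (auto simp: S.X_x S.X_h intro: exI[of _ 1])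
    show "\<exists>c. S.X * qstar (residue E (gen g)) = c *s (qstar (residue E (gen g)) * S.X)" for g
      by (cases g) (auto simp: S.X_xs S.X_hs intro: exI[of _ 1])
  qed (simp_all add: X)
  interpret T: corner_torus "residue E' 1" "residue E' Sx" "residue E' Sh" "cis \<theta>"
    by unfold_locales (use S'.x_xs S'.xs_x in
      \<open>simp_all add: X' S'.h_x S'.h_xs S'.hs_x S'.hs_xs S'.h_hs S'.hs_h\<close>)
  let ?C = "(\<lambda>(k, m, n). residue E (solid_monomial k m n)) ` UNIV"
  have E'_span: "residue E' f \<in> quotients.span T.monomials"
  proof (rule residue_in_span)
    show "x \<in> quotients.span T.monomials \<Longrightarrow> residue E' (gen g) * x \<in> quotients.span T.monomials" for x g
      by (cases g) (auto intro: T.z_closed T.u_closed)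
    show "x \<in> quotients.span T.monomials \<Longrightarrow> qstar (residue E' (gen g)) * x \<in> quotients.span T.monomials" for x g
      by (cases g) (auto intro: T.zs_closed T.us_closed)
  qed (rule T.e_in_span)
  have mono: "residue E' (solid_monomial 0 m n) = residue E' 1 * (qpow (residue E' Sx) m * qpow (residue E' Sh) n)" for m n
    by (simp add: solid_monomial_def residue_star_powers)
  have monomials: "T.monomials = (\<lambda>i. residue E' (solid_monomial 0 (fst i) (snd i))) ` UNIV"
    unfolding mono by (force simp: T.monomials_def image_def)
  have part: "P.monomial (Suc k) m n = residue E (solid_monomial (Suc k) m n)" for k m n
    unfolding P.monomial_residue solid_monomial_def by (simp only: mult.assoc)
  show ?thesis
  proof (rule spanning_modulo_ideal[OF E'_def E'_span[unfolded monomials] P.part_def, of ?C])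
    show "x \<in> quotients.span ?C" if "x \<in> P.part" for x
    proof -
      have "residue E (solid_monomial k m n) \<in> ?C" for k m n
        by (rule range_eqI[of _ _ "(k, m, n)"]) simp
      then have "{P.monomial k m n |k m n. 0 < k} \<subseteq> ?C"
        by (auto simp: gr0_conv_Suc part)
      with that show ?thesis
        unfolding P.part_def using quotients.span_mono by blast
    qed
    show "residue E (solid_monomial 0 (fst i) (snd i)) \<in> quotients.span ?C" for i
      by (rule quotients.span_base, rule range_eqI[of _ _ "(0, fst i, snd i)"])
        (simp add: case_prod_beta)
    show "residue E (l - r) \<in> P.part" if "(l, r) \<in> F" for l r
      using that P.t_in_part by (simp add: F_def X)
    show "residue E ((l - r)\<^sup>\<star>) \<in> P.part" if "(l, r) \<in> F" for l r
      using that P.t_in_part by (simp add: F_def X residue_star[symmetric] fstar_diff fstar_mult)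
  qed (use P.part_mult_left P.part_mult_right in auto)
qed

section \<open>Representations and linear independence\<close>

definition linear_operator :: "(('i \<Rightarrow> complex) \<Rightarrow> 'i \<Rightarrow> complex) \<Rightarrow> bool" where
  "linear_operator T \<longleftrightarrow> (\<forall>u v. T (\<lambda>i. u i + v i) = (\<lambda>i. T u i + T v i)) \<and>
     (\<forall>c v. T (\<lambda>i. c * v i) = (\<lambda>i. c * T v i))"

text \<open>A letter and its adjoint receive operators independently of each other. No inner product
  is involved, which permits rescaled shifts; the price is that adjoints of relations have to be
  verified as well.\<close>

locale operator_representation =
  fixes Op :: "'g \<times> bool \<Rightarrow> ('i \<Rightarrow> complex) \<Rightarrow> 'i \<Rightarrow> complex"
  assumes linear_O: "linear_operator (Op l)"
begin

definition rep :: "'g free_star \<Rightarrow> ('i \<Rightarrow> complex) \<Rightarrow> 'i \<Rightarrow> complex" where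
  "rep f v i = (\<Sum>w\<in>Poly_Mapping.keys f. Poly_Mapping.lookup f w * foldr Op (letters w) v i)"

lemma O_add: "Op l (\<lambda>i. u i + v i) = (\<lambda>i. Op l u i + Op l v i)"
  and O_scale: "Op l (\<lambda>i. c * v i) = (\<lambda>i. c * Op l v i)"
  using linear_O[of l] by (auto simp: linear_operator_def)

lemma O_0: "Op l (\<lambda>i. 0) = (\<lambda>i. 0)"
  using O_scale[of l 0 "\<lambda>i. 0"] by simp

lemma rep_add: "rep (f + g) v i = rep f v i + rep g v i"
  unfolding rep_def by (rule setsum_keys_plus_distrib) (simp_all add: ring_distribs)

lemma rep_single: "rep (Poly_Mapping.single w c) v i = c * foldr Op (letters w) v i"
  by (simp add: rep_def)

lemma rep_0 [simp]: "rep 0 v = (\<lambda>i. 0)"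
  by (simp add: rep_def fun_eq_iff)

lemma rep_scal [simp]: "rep (scal c) v = (\<lambda>i. c * v i)"
  by (simp add: rep_single scal_def zero_word_def fun_eq_iff)

lemma rep_1 [simp]: "rep 1 v = v"
  using rep_scal[of 1] by simp

lemma rep_letter_mult: "rep (letter l * f) v = Op l (rep f v)"
proof (induction f rule: poly_mapping_single_induct)
  case (2 w c)
  have "rep (Poly_Mapping.single w c) v = (\<lambda>i. c * foldr Op (letters w) v i)"
    by (simp add: rep_single fun_eq_iff)
  then show ?case
    by (simp add: letter_def mult_single rep_single plus_word_def O_scale fun_eq_iff)
next
  case (3 f g)
  have "rep (f + g) v = (\<lambda>i. rep f v i + rep g v i)"
    by (simp add: rep_add fun_eq_iff)
  with 3 show ?case by (simp add: ring_distribs rep_add O_add fun_eq_iff)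
qed (simp add: O_0)

lemma rep_scal_mult: "rep (scal c * f) v = (\<lambda>i. c * rep f v i)"
  by (induction f rule: poly_mapping_single_induct)
    (simp_all add: fun_eq_iff scal_def mult_single rep_single ring_distribs rep_add)

lemma rep_mult: "rep (f * g) v = rep f (rep g v)"
proof (induction f rule: letter_induct)
  case (add f h)
  then show ?case by (simp add: ring_distribs rep_add fun_eq_iff)
qed (simp_all add: rep_scal_mult rep_letter_mult mult.assoc)

lemma rep_gen: "rep (gen g) v = Op (g, False) v"
  using rep_letter_mult[of "(g, False)" 1 v] by (simp add: letter_gen)

lemma rep_gen_star: "rep ((gen g)\<^sup>\<star>) v = Op (g, True) v"
  using rep_letter_mult[of "(g, True)" 1 v] by (simp add: letter_gen_star)

lemma rep_minus: "rep (- f) v i = - rep f v i"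
  using rep_add[of f "- f" v i] by (simp add: add_eq_0_iff)

lemma rep_diff: "rep (f - g) v i = rep f v i - rep g v i"
  using rep_add[of f "- g"] by (simp add: rep_minus)

lemma rep_zero: "rep f (\<lambda>i. 0) = (\<lambda>i. 0)"
proof (induction f rule: letter_induct)
  case (add f g)
  then show ?case by (simp add: rep_add fun_eq_iff)
qed (simp_all add: rep_letter_mult O_0)

lemma rep_sum: "rep (\<Sum>i\<in>A. f i) v j = (\<Sum>i\<in>A. rep (f i) v j)"
  by (induction A rule: infinite_finite_induct) (simp_all add: rep_add)

lemma rep_relation_ideal:
  assumes "\<And>l r v. (l, r) \<in> E \<Longrightarrow> rep l v = rep r v"
    "\<And>l r v. (l, r) \<in> E \<Longrightarrow> rep (l\<^sup>\<star>) v = rep (r\<^sup>\<star>) v"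
    and "f \<in> relation_ideal E"
  shows "rep f v = (\<lambda>i. 0)"
proof -
  have "relation_ideal E \<subseteq> {f. \<forall>v. rep f v = (\<lambda>i. 0)}"
  proof (rule relation_ideal_least)
    show "f + g \<in> {f. \<forall>v. rep f v = (\<lambda>i. 0)}"
      if "f \<in> {f. \<forall>v. rep f v = (\<lambda>i. 0)}" "g \<in> {f. \<forall>v. rep f v = (\<lambda>i. 0)}" for f g
      using that by (simp add: rep_add fun_eq_iff)
    show "l - r \<in> {f. \<forall>v. rep f v = (\<lambda>i. 0)}" "(l - r)\<^sup>\<star> \<in> {f. \<forall>v. rep f v = (\<lambda>i. 0)}"
      if "(l, r) \<in> E" for l r
      using assms(1,2)[OF that] by (simp_all add: rep_diff fstar_diff fun_eq_iff)
  qed (simp_all add: rep_mult rep_zero)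
  with assms(3) show ?thesis by auto
qed

end

lemma cis_mult_left: "cis a * (cis b * z) = cis (a + b) * z"
  by (simp add: cis_mult flip: mult.assoc)

lemma cis_mult_right: "cis a * (z * cis b) = cis (a + b) * z"
  by (simp add: cis_mult mult.assoc[symmetric] mult.commute[of z])

subsection \<open>The quantum torus\<close>

fun torus_operator :: "real \<Rightarrow> torus_gen \<times> bool \<Rightarrow> (int \<times> int \<Rightarrow> complex) \<Rightarrow> int \<times> int \<Rightarrow> complex" where
  "torus_operator \<theta> (V_Gen, False) v (j, l) = v (j - 1, l)"
| "torus_operator \<theta> (V_Gen, True) v (j, l) = v (j + 1, l)"
| "torus_operator \<theta> (U_Gen, False) v (j, l) = cis (\<theta> * j) * v (j, l - 1)"
| "torus_operator \<theta> (U_Gen, True) v (j, l) = cis (- \<theta> * j) * v (j, l + 1)"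

interpretation torus: operator_representation "torus_operator \<theta>" for \<theta>
proof
  fix l :: "torus_gen \<times> bool"
  obtain g b where l: "l = (g, b)" by (cases l)
  show "linear_operator (torus_operator \<theta> l)"
    by (cases g; cases b) (auto simp: l linear_operator_def fun_eq_iff algebra_simps)
qed

lemma torus_rep_ideal:
  assumes "f \<in> relation_ideal (torus_rels \<theta>)"
  shows "torus.rep \<theta> f v = (\<lambda>i. 0)"
  using _ _ assms
proof (rule torus.rep_relation_ideal)
  fix l r v assume "(l, r) \<in> torus_rels \<theta>"
  then show "torus.rep \<theta> l v = torus.rep \<theta> r v" "torus.rep \<theta> (l\<^sup>\<star>) v = torus.rep \<theta> (r\<^sup>\<star>) v"
    by (auto simp: torus_rels_def fun_eq_iff torus.rep_mult fstar_mult torus.rep_gen torus.rep_gen_star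
        torus.rep_scal_mult cis_mult cis_mult_left cis_cnj algebra_simps)
qed

lemma torus_rep_V: "torus.rep \<theta> (Tv \<^bold>^ m) v (j, l) = v (j - m, l)"
proof -
  have "torus.rep \<theta> (Tv ^ n) v (j, l) = v (j - int n, l)" for n j
    by (induction n arbitrary: j) (simp_all add: torus.rep_mult torus.rep_gen algebra_simps)
  moreover have "torus.rep \<theta> ((Tv\<^sup>\<star>) ^ n) v (j, l) = v (j + int n, l)" for n j
    by (induction n arbitrary: j) (simp_all add: torus.rep_mult torus.rep_gen_star algebra_simps)
  ultimately show ?thesis by (simp add: star_power_def)
qed

lemma torus_rep_U: "torus.rep \<theta> (Tu \<^bold>^ m) v (j, l) = cis (\<theta> * j * m) * v (j, l - m)"
proof -
  have "torus.rep \<theta> (Tu ^ n) v (j, l) = cis (\<theta> * j * n) * v (j, l - int n)" for n l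
    by (induction n arbitrary: l) (simp_all add: torus.rep_mult torus.rep_gen cis_mult cis_mult_left algebra_simps)
  moreover have "torus.rep \<theta> ((Tu\<^sup>\<star>) ^ n) v (j, l) = cis (- \<theta> * j * n) * v (j, l + int n)" for n l
    by (induction n arbitrary: l) (simp_all add: torus.rep_mult torus.rep_gen_star cis_mult cis_mult_left algebra_simps)
  ultimately show ?thesis by (simp add: star_power_def)
qed

lemma torus_independent:
  assumes "finite F" "(\<Sum>(m, n)\<in>F. scal (c m n) * (Tv \<^bold>^ m * Tu \<^bold>^ n)) \<in> relation_ideal (torus_rels \<theta>)"
    and "(m, n) \<in> F"
  shows "c m n = 0"
proof -
  \<comment> \<open>The point mass at the origin is sent by \<open>V^m U^n\<close> exactly to the
    point mass at (m, n): the phase of \<open>U\<close> is 1 where the first coordinate is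
    0.\<close>
  define v :: "int \<times> int \<Rightarrow> complex" where "v = (\<lambda>i. if i = (0, 0) then 1 else 0)"
  have "0 = torus.rep \<theta> (\<Sum>(m, n)\<in>F. scal (c m n) * (Tv \<^bold>^ m * Tu \<^bold>^ n)) v (m, n)"
    using torus_rep_ideal[OF assms(2)] by simp
  also have "\<dots> = (\<Sum>i\<in>F. if i = (m, n) then c m n else 0)"
    unfolding torus.rep_sum
    by (rule sum.cong) (auto simp: torus.rep_scal_mult torus.rep_mult torus_rep_V torus_rep_U v_def split: if_splits)
  also have "\<dots> = c m n"
    using assms(1,3) by simp
  finally show ?thesis by simp
qed

subsection \<open>The quantum solid torus\<close>

text \<open>
  The usual weighted shift, rescaled so that no square roots occur; \<open>1 - x x\<^sup>*\<close> acts as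
  multiplication by \<open>p ^ j\<close>, which separates the powers \<open>k\<close> by a Vandermonde argument.
\<close>

fun solid_operator ::
  "real \<Rightarrow> real \<Rightarrow> solid_gen \<times> bool \<Rightarrow> (nat \<times> int \<Rightarrow> complex) \<Rightarrow> nat \<times> int \<Rightarrow> complex" where
  "solid_operator p \<theta> (Disc_Gen, False) v (j, l) = (if j = 0 then 0 else v (j - 1, l))"
| "solid_operator p \<theta> (Disc_Gen, True) v (j, l) = (1 - p ^ Suc j) * v (Suc j, l)"
| "solid_operator p \<theta> (Circle_Gen, False) v (j, l) = cis (\<theta> * j) * v (j, l - 1)"
| "solid_operator p \<theta> (Circle_Gen, True) v (j, l) = cis (- \<theta> * j) * v (j, l + 1)"

interpretation solid: operator_representation "solid_operator p \<theta>" for p \<theta>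
proof
  fix l :: "solid_gen \<times> bool"
  obtain g b where l: "l = (g, b)" by (cases l)
  show "linear_operator (solid_operator p \<theta> l)"
    by (cases g; cases b) (auto simp: l linear_operator_def fun_eq_iff algebra_simps)
qed

lemma solid_rep_ideal:
  assumes "f \<in> relation_ideal (solid_torus_rels p \<theta>)"
  shows "solid.rep p \<theta> f v = (\<lambda>i. 0)"
  using _ _ assms
proof (rule solid.rep_relation_ideal)
  have "\<forall>(l, r) \<in> solid_torus_rels p \<theta>. \<forall>v. solid.rep p \<theta> l v = solid.rep p \<theta> r v \<and>
      solid.rep p \<theta> (l\<^sup>\<star>) v = solid.rep p \<theta> (r\<^sup>\<star>) v"
    unfolding solid_torus_rels_def
    by (auto simp: fun_eq_iff solid.rep_mult fstar_mult fstar_diff solid.rep_gen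
        solid.rep_diff gr0_conv_Suc solid.rep_gen_star solid.rep_scal_mult cis_mult cis_mult_left
        cis_mult_right cis_cnj algebra_simps)
  then show "solid.rep p \<theta> l v = solid.rep p \<theta> r v" "solid.rep p \<theta> (l\<^sup>\<star>) v = solid.rep p \<theta> (r\<^sup>\<star>) v"
    if "(l, r) \<in> solid_torus_rels p \<theta>" for l r v
    using that by blast+
qed

lemma solid_rep_disc: "solid.rep p \<theta> ((1 - Sx * Sx\<^sup>\<star>) ^ k) v (j, l) = (p ^ j) ^ k * v (j, l)"
proof -
  have "solid.rep p \<theta> (1 - Sx * Sx\<^sup>\<star>) v (j, l) = p ^ j * v (j, l)" for v :: "nat \<times> int \<Rightarrow> complex"
    by (cases j) (simp_all add: solid.rep_diff solid.rep_mult solid.rep_gen solid.rep_gen_star algebra_simps)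
  then show ?thesis
    by (induction k) (simp_all add: solid.rep_mult)
qed

lemma solid_rep_h: "solid.rep p \<theta> (Sh \<^bold>^ m) v (j, l) = cis (\<theta> * j * m) * v (j, l - m)"
proof -
  have "solid.rep p \<theta> (Sh ^ n) v (j, l) = cis (\<theta> * j * n) * v (j, l - int n)" for n l
    by (induction n arbitrary: l) (simp_all add: solid.rep_mult solid.rep_gen cis_mult cis_mult_left algebra_simps)
  moreover have "solid.rep p \<theta> ((Sh\<^sup>\<star>) ^ n) v (j, l) = cis (- \<theta> * j * n) * v (j, l + int n)" for n l
    by (induction n arbitrary: l) (simp_all add: solid.rep_mult solid.rep_gen_star cis_mult cis_mult_left algebra_simps)
  ultimately show ?thesis by (simp add: star_power_def)
qed

text \<open>For negative m the weight \<open>w\<close> is a product of factors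
  \<open>1 - p ^ i\<close> with i > 0, non-zero because p lies strictly between 0 and 1. Its precise
  value is irrelevant; what counts is that it does not depend on \<open>v\<close> and
  \<open>l\<close>.\<close>

lemma solid_rep_x:
  assumes p: "0 < p" "p < 1"
  shows "\<exists>w. w \<noteq> 0 \<and> (\<forall>v l. solid.rep p \<theta> (Sx \<^bold>^ m) v (j, l) =
    w * (if m \<le> int j then v (nat (int j - m), l) else 0))"
proof (cases "0 \<le> m")
  case True
  have "solid.rep p \<theta> (Sx ^ n) v (j, l) = (if n \<le> j then v (j - n, l) else 0)" for n j v l
    by (induction n arbitrary: j) (auto simp: solid.rep_mult solid.rep_gen)
  with True show ?thesis
    by (intro exI[of _ 1]) (auto simp: star_power_def nat_diff_distrib nat_le_iff)
next
  case False
  have "\<exists>w. w \<noteq> 0 \<and> (\<forall>v l. solid.rep p \<theta> ((Sx\<^sup>\<star>) ^ n) v (j, l) = w * v (j + n, l))" for n j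
  proof (induction n arbitrary: j)
    case (Suc n)
    obtain w where w: "w \<noteq> 0" "\<And>v l. solid.rep p \<theta> ((Sx\<^sup>\<star>) ^ n) v (Suc j, l) = w * v (Suc j + n, l)"
      using Suc[of "Suc j"] by blast
    have "p ^ Suc j < 1" using p by (simp only: power_less_one_iff) simp
    then have "complex_of_real (1 - p ^ Suc j) \<noteq> 0" by (simp only: of_real_eq_0_iff)
    with w show ?case
      by (intro exI[of _ "complex_of_real (1 - p ^ Suc j) * w"])
        (simp add: solid.rep_mult solid.rep_gen_star)
  qed (auto intro: exI[of _ 1])
  moreover have "nat (int j - m) = j + nat (- m)"
    using False by simp
  ultimately show ?thesis
    using False by (simp add: star_power_def)
qed


lemma solid_independent:
  fixes c :: "nat \<times> int \<times> int \<Rightarrow> complex"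
  assumes p: "0 < p" "p < 1" and "finite F"
    and sum: "(\<Sum>i\<in>F. scal (c i) * (case i of (k, m, n) \<Rightarrow> solid_monomial k m n)) \<in> relation_ideal (solid_torus_rels p \<theta>)"
    and i0: "i0 \<in> F"
  shows "c i0 = 0"
proof (rule ccontr)
  assume c: "c i0 \<noteq> 0"
  obtain k0 m0 n0 where i0_eq: "i0 = (k0, m0, n0)" by (cases i0)
  \<comment> \<open>The coefficients with the fixed exponents \<open>m0\<close>, \<open>n0\<close>,
    extended by 0, are read as those of a polynomial whose values at the numbers
    \<open>p ^ j\<close> will vanish.\<close>
  define d where "d k = (if (k, m0, n0) \<in> F then c (k, m0, n0) else 0)" for k
  define N where "N = Max (fst ` F)"
  have N: "k \<le> N" if "(k, m, n) \<in> F" for k m n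
    using Max_ge[of "fst ` F" k] imageI[OF that, of fst] \<open>finite F\<close> by (simp add: N_def)
  have root: "(\<Sum>k\<le>N. d k * (complex_of_real (p ^ j)) ^ k) = 0" if j: "m0 \<le> int j" for j
  proof -
    \<comment> \<open>The point mass at (j - m0, 0), evaluated at (j, n0), detects exactly the
      monomials with exponents \<open>m0\<close> and \<open>n0\<close>. The bound on j ensures that
      this position exists.\<close>
    define a where "a = nat (int j - m0)"
    define v :: "nat \<times> int \<Rightarrow> complex" where "v = (\<lambda>i. if i = (a, 0) then 1 else 0)"
    have "\<forall>m. \<exists>w. w \<noteq> 0 \<and> (\<forall>u l. solid.rep p \<theta> (Sx \<^bold>^ m) u (j, l) =
        w * (if m \<le> int j then u (nat (int j - m), l) else 0))"
      using solid_rep_x[OF p] by blast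
    from choice[OF this] obtain w where w: "\<And>m. w m \<noteq> 0" "\<And>m u l. solid.rep p \<theta> (Sx \<^bold>^ m) u (j, l) =
        w m * (if m \<le> int j then u (nat (int j - m), l) else 0)"
      by blast
    have mono: "solid.rep p \<theta> (solid_monomial k m n) v (j, n0) =
        (if m = m0 \<and> n = n0 then w m0 * cis (\<theta> * a * n0) * complex_of_real (p ^ j) ^ k else 0)" for k m n
    proof -
      have "m \<le> int j \<and> nat (int j - m) = a \<longleftrightarrow> m = m0"
        using j by (auto simp: a_def)
      then show ?thesis
        by (auto simp: solid_monomial_def solid.rep_mult mult.assoc solid_rep_disc w(2) solid_rep_h v_def a_def)
    qed
    have "0 = solid.rep p \<theta> (\<Sum>i\<in>F. scal (c i) * (case i of (k, m, n) \<Rightarrow> solid_monomial k m n)) v (j, n0)"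
      using solid_rep_ideal[OF sum] by simp
    also have "\<dots> = (\<Sum>i\<in>F. c i * (case i of (k, m, n) \<Rightarrow> solid.rep p \<theta> (solid_monomial k m n) v (j, n0)))"
      unfolding solid.rep_sum by (rule sum.cong) (auto simp: solid.rep_scal_mult)
    also have "\<dots> = w m0 * cis (\<theta> * a * n0) *
        (\<Sum>i\<in>F. case i of (k, m, n) \<Rightarrow> if m = m0 \<and> n = n0 then c i * complex_of_real (p ^ j) ^ k else 0)"
      unfolding sum_distrib_left by (rule sum.cong) (auto simp: mono)
    finally have "0 = (\<Sum>i\<in>F. case i of (k, m, n) \<Rightarrow> if m = m0 \<and> n = n0 then c i * complex_of_real (p ^ j) ^ k else 0)"
      using w(1) by simp
    also have "\<dots> = (\<Sum>i\<in>(\<lambda>k. (k, m0, n0)) ` {k. k \<le> N \<and> (k, m0, n0) \<in> F}. c i * complex_of_real (p ^ j) ^ fst i)"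
      by (rule sum.mono_neutral_cong_right) (use \<open>finite F\<close> N in \<open>auto split: if_splits\<close>)
    also have "\<dots> = (\<Sum>k | k \<le> N \<and> (k, m0, n0) \<in> F. d k * complex_of_real (p ^ j) ^ k)"
      by (subst sum.reindex) (auto simp: inj_on_def d_def)
    also have "\<dots> = (\<Sum>k\<le>N. d k * (complex_of_real (p ^ j)) ^ k)"
      by (rule sum.mono_neutral_left) (auto simp: d_def)
    finally show ?thesis by simp
  qed
  \<comment> \<open>The polynomial is non-zero because of its coefficient at \<open>k0\<close>, so
    it cannot vanish at the infinitely many distinct numbers \<open>p ^ j\<close>.\<close>
  have "finite {z. (\<Sum>k\<le>N. d k * z ^ k) = 0}"
    by (subst polyfun_finite_roots) (use c i0 N[of k0] in \<open>auto simp: d_def i0_eq\<close>)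
  then have "finite ((\<lambda>j. complex_of_real (p ^ j)) ` {nat m0..})"
    by (rule rev_finite_subset) (use root in auto)
  moreover have "inj_on (\<lambda>j. complex_of_real (p ^ j)) {nat m0..}"
    using p by (auto simp: inj_on_def of_real_eq_iff power_inject_exp' simp del: of_real_power)
  ultimately show False
    using finite_imageD infinite_Ici by blast
qed

section \<open>Deformed binomials\<close>

lemma qint_pos: "0 < r \<Longrightarrow> 0 < qint r (Suc n)"
  unfolding qint_def by (rule sum_pos) auto

lemma qfact_Suc: "qfact r (Suc n) = qfact r n * qint r (Suc n)"
  by (simp add: qfact_def)

lemma qfact_pos: "0 < r \<Longrightarrow> 0 < qfact r n"
  by (induction n) (simp_all add: qfact_Suc qint_pos, simp add: qfact_def)

lemma qint_add: "qint r (m + n) = qint r m + r ^ m * qint r n"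
  by (induction n) (simp_all add: qint_def power_add algebra_simps)

lemma qbinom_0 [simp]: "0 < r \<Longrightarrow> qbinom r n 0 = 1"
  using qfact_pos[of r n] by (simp add: qbinom_def qfact_def[of r 0])

lemma qbinom_self [simp]: "0 < r \<Longrightarrow> qbinom r n n = 1"
  using qfact_pos[of r n] by (simp add: qbinom_def qfact_def[of r 0])

text \<open>Rests on splitting \<open>qint r (Suc n)\<close> after its first \<open>Suc m\<close>
  summands. Because subtraction of natural numbers truncates, \<open>qbinom r n (Suc n)\<close> is
  not 0; the case m = n is therefore excluded, and the top coefficients are treated separately
  below.\<close>

lemma qbinom_pascal:
  assumes r: "0 < r" and "m < n"
  shows "qbinom r (Suc n) (Suc m) = r ^ Suc m * qbinom r n (Suc m) + qbinom r n m"
proof -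
  obtain l where n: "n = m + Suc l"
    using less_imp_Suc_add[OF \<open>m < n\<close>] by auto
  have "qint r (Suc n) = qint r (Suc m) + r ^ Suc m * qint r (Suc l)"
    using qint_add[of r "Suc m" "Suc l"] by (simp add: n)
  moreover have "qfact r (Suc m) > 0" "qfact r m > 0" "qfact r (Suc l) > 0" "qfact r l > 0"
    "qint r (Suc m) > 0" "qint r (Suc l) > 0"
    by (simp_all add: qfact_pos qint_pos r del: qfact_Suc)
  ultimately show ?thesis
    by (simp add: n qbinom_def qfact_Suc field_simps)
qed

definition modulus_coeff :: "real \<Rightarrow> nat \<Rightarrow> nat \<Rightarrow> real" where
  "modulus_coeff r n m = (- 1) ^ m * r powi (int n * int m - int m * (int m - 1) div 2)
     * qbinom (inverse r) n m"

definition comodulus_coeff :: "real \<Rightarrow> nat \<Rightarrow> nat \<Rightarrow> real" where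
  "comodulus_coeff r n m = (- 1) ^ m * r powi (- int n * int m + int m * (int m + 1) div 2)
     * qbinom r n m"

lemma coeff_0 [simp]: "0 < r \<Longrightarrow> modulus_coeff r n 0 = 1" "0 < r \<Longrightarrow> comodulus_coeff r n 0 = 1"
  by (simp_all add: modulus_coeff_def comodulus_coeff_def)

lemma triangle_Suc: "int (Suc m) * (int (Suc m) - 1) div 2 = int m * (int m - 1) div 2 + int m"
  "int (Suc m) * (int (Suc m) + 1) div 2 = int m * (int m + 1) div 2 + int m + 1"
proof -
  have "int (Suc m) * (int (Suc m) - 1) = int m * (int m - 1) + 2 * int m"
    by (simp add: algebra_simps)
  then show "int (Suc m) * (int (Suc m) - 1) div 2 = int m * (int m - 1) div 2 + int m"
    by simp
  have "int (Suc m) * (int (Suc m) + 1) = int m * (int m + 1) + 2 * (int m + 1)"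
    by (simp add: algebra_simps)
  then show "int (Suc m) * (int (Suc m) + 1) div 2 = int m * (int m + 1) div 2 + int m + 1"
    by simp
qed

text \<open>
  Coefficient recursions for the products of the factors \<open>1 - r ^ i * t\<close> over \<open>1 \<le> i \<le> n\<close> and of
  \<open>1 - r powi (- i) * t\<close> over \<open>0 \<le> i < n\<close>; both are instances of the q-Pascal rule.
\<close>

lemma powi_shift: "0 < r \<Longrightarrow> a = int n + b \<Longrightarrow> r powi a = r ^ n * r powi b" for r :: real
  by (simp add: power_int_add)

lemma powi_shift_back: "0 < r \<Longrightarrow> a = - int n + b \<Longrightarrow> r powi a = inverse r ^ n * r powi b" for r :: real
  using powi_shift[of r b n a] by (simp add: field_simps)

lemma modulus_coeff_Suc:
  assumes r: "0 < r" and m: "m < n"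
  shows "modulus_coeff r (Suc n) (Suc m) = modulus_coeff r n (Suc m) - r ^ Suc n * modulus_coeff r n m"
proof -
  define T where "T = int m * (int m - 1) div 2"
  \<comment> \<open>The Pascal rule is used for the parameter \<open>inverse r\<close>; its factor
    \<open>inverse r ^ Suc m\<close> is just the change in the exponent when \<open>Suc n\<close> is
    replaced by n.\<close>
  have 1: "r powi (int (Suc n) * int (Suc m) - (T + int m)) * inverse r ^ Suc m = r powi (int n * int (Suc m) - (T + int m))"
    using r by (simp add: power_int_diff power_int_add algebra_simps power_inverse field_simps)
  have 2: "r powi (int (Suc n) * int (Suc m) - (T + int m)) = r ^ Suc n * r powi (int n * int m - T)"
    by (rule powi_shift[OF r]) (simp add: algebra_simps)
  have "modulus_coeff r (Suc n) (Suc m) = (- 1) ^ Suc m *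
      (r powi (int (Suc n) * int (Suc m) - (T + int m)) * inverse r ^ Suc m * qbinom (inverse r) n (Suc m) +
       r powi (int (Suc n) * int (Suc m) - (T + int m)) * qbinom (inverse r) n m)"
    using qbinom_pascal[of "inverse r" m n] r m
    by (simp only: modulus_coeff_def triangle_Suc T_def) (simp add: algebra_simps)
  also have "\<dots> = modulus_coeff r n (Suc m) - r ^ Suc n * modulus_coeff r n m"
    by (simp only: 1) (simp only: 2, simp only: modulus_coeff_def triangle_Suc T_def, simp add: algebra_simps)
  finally show ?thesis .
qed

lemma modulus_coeff_top:
  assumes r: "0 < r"
  shows "modulus_coeff r (Suc n) (Suc n) = - (r ^ Suc n) * modulus_coeff r n n"
proof -
  define T where "T = int n * (int n - 1) div 2"
  have "r powi (int (Suc n) * int (Suc n) - (T + int n)) = r ^ Suc n * r powi (int n * int n - T)"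
    by (rule powi_shift[OF r]) (simp add: algebra_simps)
  then show ?thesis
    using r by (simp only: modulus_coeff_def triangle_Suc T_def) simp
qed

lemma comodulus_coeff_Suc:
  assumes r: "0 < r" and m: "m < n"
  shows "comodulus_coeff r (Suc n) (Suc m) = comodulus_coeff r n (Suc m) - inverse r ^ n * comodulus_coeff r n m"
proof -
  define T where "T = int m * (int m + 1) div 2"
  have 1: "r powi (- int (Suc n) * int (Suc m) + (T + int m + 1)) * r ^ Suc m = r powi (- int n * int (Suc m) + (T + int m + 1))"
    unfolding mult.commute[of _ "r ^ Suc m"]
    by (rule powi_shift[OF r, symmetric]) (simp add: algebra_simps)
  have 2: "r powi (- int (Suc n) * int (Suc m) + (T + int m + 1)) = inverse r ^ n * r powi (- int n * int m + T)"
    by (rule powi_shift_back[OF r]) (simp add: algebra_simps)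
  have "comodulus_coeff r (Suc n) (Suc m) = (- 1) ^ Suc m *
      (r powi (- int (Suc n) * int (Suc m) + (T + int m + 1)) * r ^ Suc m * qbinom r n (Suc m) +
       r powi (- int (Suc n) * int (Suc m) + (T + int m + 1)) * qbinom r n m)"
    using qbinom_pascal[of r m n] r m
    by (simp only: comodulus_coeff_def triangle_Suc T_def) (simp add: algebra_simps)
  also have "\<dots> = comodulus_coeff r n (Suc m) - inverse r ^ n * comodulus_coeff r n m"
    by (simp only: 1) (simp only: 2, simp only: comodulus_coeff_def triangle_Suc T_def, simp add: algebra_simps)
  finally show ?thesis .
qed

lemma comodulus_coeff_top:
  assumes r: "0 < r"
  shows "comodulus_coeff r (Suc n) (Suc n) = - (inverse r ^ n) * comodulus_coeff r n n"
proof -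
  define T where "T = int n * (int n + 1) div 2"
  have "r powi (- int (Suc n) * int (Suc n) + (T + int n + 1)) = inverse r ^ n * r powi (- int n * int n + T)"
    by (rule powi_shift_back[OF r]) (simp add: algebra_simps)
  then show ?thesis
    using r by (simp only: comodulus_coeff_def triangle_Suc T_def) simp
qed

text \<open>Multiplication by one further linear factor, expressed through coefficients; it serves
  the modulus and the comodulus polynomials alike.\<close>

lemma sum_coeff_recursion:
  fixes t :: "'g quotients" and c c' :: "nat \<Rightarrow> real"
  assumes "c' 0 = c 0" and "\<And>m. m < n \<Longrightarrow> c' (Suc m) = c (Suc m) - s * c m" and "c' (Suc n) = - s * c n"
  shows "(\<Sum>m\<le>Suc n. of_real (c' m) *s t ^ m) =
    (\<Sum>m\<le>n. of_real (c m) *s t ^ m) * (1 - of_real s *s t)"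
proof -
  have t: "t ^ m * t = t ^ Suc m" for m by (simp add: power_Suc2 del: power_Suc)
  have "(\<Sum>m\<le>Suc n. of_real (c' m) *s t ^ m) =
      of_real (c' 0) *s t ^ 0 + (\<Sum>m<n. of_real (c' (Suc m)) *s t ^ Suc m)
      + of_real (c' (Suc n)) *s t ^ Suc n"
    by (simp only: sum.atMost_shift sum.lessThan_Suc add.assoc)
  also have "\<dots> = (of_real (c 0) *s t ^ 0 + (\<Sum>m<n. of_real (c (Suc m)) *s t ^ Suc m))
      - ((\<Sum>m<n. of_real (s * c m) *s t ^ Suc m) + of_real (s * c n) *s t ^ Suc n)"
    by (simp add: assms quotients.scale_left_diff_distrib sum_subtractf del: power_Suc)
  also have "of_real (c 0) *s t ^ 0 + (\<Sum>m<n. of_real (c (Suc m)) *s t ^ Suc m) =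
      (\<Sum>m\<le>n. of_real (c m) *s t ^ m)"
    by (simp add: sum.atMost_shift del: power_Suc)
  also have "(\<Sum>m<n. of_real (s * c m) *s t ^ Suc m) + of_real (s * c n) *s t ^ Suc n =
      (\<Sum>m\<le>n. of_real (c m) *s t ^ m) * of_real s *s t"
    by (simp add: sum_distrib_right t mult.commute lessThan_Suc_atMost[symmetric] del: power_Suc)
       (simp add: t[symmetric] distrib_right sum_distrib_right cscale_simps quotients.scale_sum_right mult.commute del: power_Suc)
  finally show ?thesis by (simp add: algebra_simps)
qed

section \<open>The quantum lens space\<close>

text \<open>The factor \<open>e\<close> in front replaces the constant term, a multiple of the unit
  of the product ring, by a multiple of the corner unit.\<close>

definition corner_poly :: "'g quotients \<Rightarrow> (nat \<Rightarrow> real) \<Rightarrow> nat \<Rightarrow> 'g quotients \<Rightarrow> 'g quotients" where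
  "corner_poly e c n t = e * (\<Sum>m\<le>n. of_real (c m) *s t ^ m)"

text \<open>Only the constant term survives multiplication by \<open>s\<close>. With \<xi> and
  \<eta> in the roles of \<open>s\<close> and \<open>t\<close>, in either order, this makes
  \<open>b\<close> unitary behind \<xi> and \<open>a\<close> unitary behind \<eta>.\<close>

lemma corner_poly_annihilated:
  assumes "s * t = 0" and "c 0 = 1" and "s * e = s"
  shows "s * corner_poly e c n t = s"
proof -
  have "s * t ^ m = (if m = 0 then s else 0)" for m
    by (cases m) (simp_all add: assms(1) flip: mult.assoc)
  then have "s * (\<Sum>m\<le>n. of_real (c m) *s t ^ m) = s"
    by (simp add: sum_distrib_left if_distrib[of "\<lambda>x. _ *s x"] assms(2) cong: if_cong)
  with assms(3) show ?thesis
    by (simp add: corner_poly_def flip: mult.assoc)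
qed

lemma corner_poly_0: "c 0 = 1 \<Longrightarrow> corner_poly e c n 0 = e"
  by (simp add: corner_poly_def power_0_left if_distrib[of "\<lambda>x. _ *s x"] cong: if_cong)

locale lens_relations =
  fixes e \<xi> z a b :: "'g quotients" and p q \<theta> :: real and \<beta> :: nat
  assumes p_pos: "0 < p" and q_pos: "0 < q"
    and e_e [simp]: "e * e = e" and qstar_e [simp]: "qstar e = e"
    and e_mult [simp]: "e * \<xi> = \<xi>" "\<xi> * e = \<xi>" "e * z = z" "z * e = z" "e * a = a" "a * e = a" "e * b = b" "b * e = b"
    and qstar_\<xi> [simp]: "qstar \<xi> = \<xi>"
    and \<xi>_z: "\<xi> * z = p *s (z * \<xi>)"
    and zs_z': "qstar z * z - q *s (z * qstar z) = (1 - q) *s e - (p - q) *s \<xi>"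
    and \<eta>_\<xi>': "(e - z * qstar z - \<xi>) * \<xi> = 0"
    and \<xi>_a: "\<xi> * a = (p ^ \<beta>) *s (a * \<xi>)" and \<xi>_b: "\<xi> * b = b * \<xi>"
    and z_a: "z * a = cis (- \<theta>) *s (a * z)" and z_b: "z * b = cis \<theta> *s (b * z)"
    and z_as: "z * qstar a - cis \<theta> *s (qstar a * z) = (p ^ \<beta> - 1) *s (\<xi> * (qpow z (1 - int \<beta>) * b))"
    and zs_b: "qstar z * b - cis (- \<theta>) *s (b * qstar z) =
      (1 - q ^ \<beta>) *s (qpow z (int \<beta> - 1) * ((e - z * qstar z - \<xi>) * qstar a))"
    and b_a: "b * a = e * z ^ \<beta>"
    and as_a: "qstar a * a = corner_poly e (modulus_coeff p \<beta>) \<beta> \<xi>"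
    and a_as: "a * qstar a = corner_poly e (comodulus_coeff p \<beta>) \<beta> \<xi>"
    and bs_b: "qstar b * b = corner_poly e (modulus_coeff q \<beta>) \<beta> (e - z * qstar z - \<xi>)"
    and b_bs: "b * qstar b = corner_poly e (comodulus_coeff q \<beta>) \<beta> (e - z * qstar z - \<xi>)"
begin

section \<open>Commutation rules of \<xi> and \<eta> with the generators of the lens space\<close>

definition \<eta> :: "'g quotients" where
  "\<eta> = e - z * qstar z - \<xi>"

lemma e_stars [simp]: "e * qstar z = qstar z" "qstar z * e = qstar z" "e * qstar a = qstar a" "qstar a * e = qstar a"
    "e * qstar b = qstar b" "qstar b * e = qstar b"
  by (metis e_mult qstar_e qstar_mult)+

lemma e_\<eta> [simp]: "e * \<eta> = \<eta>" "\<eta> * e = \<eta>"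
  by (simp_all add: \<eta>_def algebra_simps, simp add: mult.assoc[symmetric])

lemma qstar_\<eta> [simp]: "qstar \<eta> = \<eta>"
  by (simp add: \<eta>_def qstar_simps)

lemma \<eta>_\<xi> [simp]: "\<eta> * \<xi> = 0"
  using \<eta>_\<xi>' by (simp add: \<eta>_def)

lemma \<xi>_\<eta> [simp]: "\<xi> * \<eta> = 0"
  by (metis \<eta>_\<xi> qstar_0 qstar_\<eta> qstar_mult qstar_\<xi>)

lemma \<xi>_\<eta>_left [simp]: "\<eta> * (\<xi> * w) = 0" "\<xi> * (\<eta> * w) = 0"
  by (simp_all flip: mult.assoc)

lemma z_zs: "z * qstar z = e - \<xi> - \<eta>"
  by (simp add: \<eta>_def)

text \<open>In terms of \<eta> the relation becomes symmetric under exchanging (\<xi>, p) with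
  (\<eta>, q), which allows both ideals to be handled by \<open>disc_part\<close>.\<close>

lemma zs_z: "qstar z * z = e - p *s \<xi> - q *s \<eta>"
proof -
  have "qstar z * z = q *s (e - \<xi> - \<eta>) + ((1 - q) *s e - (p - q) *s \<xi>)"
    using zs_z' by (simp only: z_zs diff_eq_eq) (simp add: add.commute)
  then show ?thesis
    by (simp add: quotients.scale_left_diff_distrib cscale_simps)
qed

lemma zs_\<xi>: "qstar z * \<xi> = p *s (\<xi> * qstar z)"
  using arg_cong[OF \<xi>_z, of qstar] by (simp add: qstar_simps)

lemma \<xi>_zs: "\<xi> * qstar z = inverse p *s (qstar z * \<xi>)"
  using p_pos by (simp add: zs_\<xi>)

lemma \<eta>_z: "\<eta> * z = q *s (z * \<eta>)"
proof -
  have "\<eta> * z = z - z * (qstar z * z) - \<xi> * z"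
    by (simp add: \<eta>_def algebra_simps)
  then show ?thesis by (simp add: zs_z \<xi>_z algebra_simps)
qed

lemma zs_\<eta>: "qstar z * \<eta> = q *s (\<eta> * qstar z)"
  using arg_cong[OF \<eta>_z, of qstar] by (simp add: qstar_simps)

lemma \<eta>_zs: "\<eta> * qstar z = inverse q *s (qstar z * \<eta>)"
  using q_pos by (simp add: zs_\<eta>)

lemma bs_\<xi>: "qstar b * \<xi> = \<xi> * qstar b"
  using arg_cong[OF \<xi>_b, of qstar] by (simp add: qstar_simps)

lemma as_\<xi>: "qstar a * \<xi> = (p ^ \<beta>) *s (\<xi> * qstar a)"
  using arg_cong[OF \<xi>_a, of qstar] by (simp add: qstar_simps)

lemma a_z: "a * z = cis \<theta> *s (z * a)"
  by (simp add: z_a cis_mult)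

lemma as_zs: "qstar a * qstar z = cis \<theta> *s (qstar z * qstar a)"
  using arg_cong[OF z_a, of qstar] by (simp add: qstar_simps cis_cnj)

lemma b_z: "b * z = cis (- \<theta>) *s (z * b)"
  by (simp add: z_b cis_mult)

lemma bs_zs: "qstar b * qstar z = cis (- \<theta>) *s (qstar z * qstar b)"
  using arg_cong[OF z_b, of qstar] by (simp add: qstar_simps cis_cnj)

lemma qpow_cases_nat: "qpow z (int \<beta> - 1) = (if \<beta> = 0 then qstar z else z ^ (\<beta> - 1))"
  "qpow z (1 - int \<beta>) = (if \<beta> = 0 then z else qstar z ^ (\<beta> - 1))"
  by (cases \<beta>; simp add: qpow_def nat_diff_distrib')+

lemma \<xi>_z_power: "\<xi> * z ^ n = of_real p ^ n *s (z ^ n * \<xi>)"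
  by (rule skew_power_right) (simp add: \<xi>_z)

lemma \<xi>_zs_power: "\<xi> * qstar z ^ n = (inverse (of_real p)) ^ n *s (qstar z ^ n * \<xi>)"
  by (rule skew_power_right) (simp add: \<xi>_zs)

lemma \<eta>_z_power: "\<eta> * z ^ n = of_real q ^ n *s (z ^ n * \<eta>)"
  by (rule skew_power_right) (simp add: \<eta>_z)

lemma \<eta>_zs_power: "\<eta> * qstar z ^ n = (inverse (of_real q)) ^ n *s (qstar z ^ n * \<eta>)"
  by (rule skew_power_right) (simp add: \<eta>_zs)

text \<open>Lets \<xi> reach an \<eta> hidden behind a power of \<open>z\<close>; this removes the
  correction term from the relation between \<open>qstar z\<close> and \<open>b\<close>.\<close>

lemma \<xi>_qpow_\<eta> [simp]: "\<xi> * (qpow z m * (\<eta> * w)) = 0"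
proof -
  obtain c where "\<xi> * qpow z m = c *s (qpow z m * \<xi>)"
    by (rule skew_qpow[of \<xi> z p "inverse p"]) (simp_all add: \<xi>_z \<xi>_zs)
  then have "\<xi> * (qpow z m * (\<eta> * w)) = c *s (qpow z m * (\<xi> * (\<eta> * w)))"
    by (metis cscale_mult_left mult.assoc)
  then show ?thesis by simp
qed

lemma \<xi>_b_bs: "\<xi> * (b * qstar b) = \<xi>" "\<xi> * (qstar b * b) = \<xi>"
  unfolding b_bs bs_b \<eta>_def[symmetric]
  by (rule corner_poly_annihilated; simp add: q_pos)+

lemma \<eta>_a_as: "\<eta> * (a * qstar a) = \<eta>" "\<eta> * (qstar a * a) = \<eta>"
  unfolding a_as as_a
  by (rule corner_poly_annihilated; simp add: p_pos)+

lemma \<xi>_b_zs: "\<xi> * (b * qstar z) = cis \<theta> *s (\<xi> * (qstar z * b))"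
proof -
  have "\<xi> * (qstar z * b) - cis (- \<theta>) *s (\<xi> * (b * qstar z)) = \<xi> * (qstar z * b - cis (- \<theta>) *s (b * qstar z))"
    by (simp add: algebra_simps)
  also have "\<dots> = 0"
    unfolding zs_b \<eta>_def[symmetric] by simp
  finally show ?thesis by (simp add: cis_mult)
qed

lemma bs_z: "qstar b * z - cis \<theta> *s (z * qstar b) = of_real (1 - q ^ \<beta>) *s (a * (\<eta> * qstar (qpow z (int \<beta> - 1))))"
  using arg_cong[OF zs_b, of qstar] by (simp add: \<eta>_def[symmetric] qstar_simps cis_cnj mult.assoc)

lemma a_zs: "a * qstar z - cis (- \<theta>) *s (qstar z * a) =
    of_real (p ^ \<beta> - 1) *s (qstar b * (qstar (qpow z (1 - int \<beta>)) * \<xi>))"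
  using arg_cong[OF z_as, of qstar] by (simp add: qstar_simps cis_cnj mult.assoc)

lemma \<xi>_bs_z: "\<xi> * (qstar b * z) = cis \<theta> *s (\<xi> * (z * qstar b))"
proof -
  have "\<xi> * (qstar b * z) - cis \<theta> *s (\<xi> * (z * qstar b)) = \<xi> * (qstar b * z - cis \<theta> *s (z * qstar b))"
    by (simp add: algebra_simps)
  also have "\<dots> = of_real (1 - q ^ \<beta>) *s ((\<xi> * a) * (\<eta> * qstar (qpow z (int \<beta> - 1))))"
    unfolding bs_z by (simp add: mult.assoc)
  also have "\<dots> = 0"
    unfolding \<xi>_a by (simp add: mult.assoc)
  finally show ?thesis by simp
qed

lemma \<xi>_disc_part: "disc_part \<xi> z b (of_real p) (cis (- \<theta>))"
proof
  show "\<xi> * (z * qstar z) = \<xi> - \<xi> * \<xi>" "\<xi> * (qstar z * z) = \<xi> - of_real p *s (\<xi> * \<xi>)"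
    by (simp_all add: z_zs zs_z algebra_simps)
qed (use p_pos in \<open>simp_all add: \<xi>_z \<xi>_zs \<xi>_b bs_\<xi> \<xi>_b_bs b_z \<xi>_b_zs \<xi>_bs_z bs_zs\<close>)

text \<open>
  \<open>\<xi>\<close> absorbs \<open>b\<^sup>* b\<close>, so \<open>b a = z ^ \<beta>\<close> can be solved for \<open>a\<close> on the part of \<open>\<xi>\<close>, and in the
  same way for \<open>b\<close> on the part of \<open>\<eta>\<close>.
\<close>

lemma a_\<xi>: "a * \<xi> = qstar b * (z ^ \<beta> * \<xi>)"
proof -
  have "of_real p ^ \<beta> *s (a * \<xi>) = (\<xi> * (qstar b * b)) * a"
    by (simp add: \<xi>_b_bs \<xi>_a)
  also have "\<dots> = \<xi> * (qstar b * (b * a))"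
    by (simp add: mult.assoc)
  also have "\<dots> = (qstar b * \<xi>) * z ^ \<beta>"
    unfolding b_a by (simp add: bs_\<xi> flip: mult.assoc)
  also have "\<dots> = of_real p ^ \<beta> *s (qstar b * (z ^ \<beta> * \<xi>))"
    by (simp add: \<xi>_z_power mult.assoc)
  finally show ?thesis
    using p_pos by (simp add: quotients.scale_left_imp_eq)
qed

lemma as_\<xi>': "qstar a * \<xi> = qstar z ^ \<beta> * (b * \<xi>)"
proof -
  have "\<xi> * qstar a = \<xi> * (qstar z ^ \<beta> * b)"
    using arg_cong[OF a_\<xi>, of qstar] by (simp add: qstar_simps mult.assoc)
  then have "qstar a * \<xi> = of_real p ^ \<beta> *s ((\<xi> * qstar z ^ \<beta>) * b)"
    by (simp add: as_\<xi> mult.assoc)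
  then show ?thesis
    using p_pos by (simp add: \<xi>_zs_power mult.assoc \<xi>_b power_mult_distrib[symmetric])
qed

text \<open>By the definition of \<eta> the task is to move \<open>a\<close> past
  \<open>z * qstar z\<close>. The correction term in the relation between \<open>a\<close> and
  \<open>qstar z\<close> becomes, after multiplication by \<open>z\<close>, a multiple of
  \<open>a * \<xi>\<close> thanks to \<open>a_\<xi>\<close>, and it cancels exactly against the
  factor \<open>p ^ \<beta>\<close> between \<xi> and \<open>a\<close>. For \<beta> = 0 there is no
  correction term.\<close>

lemma \<eta>_a: "\<eta> * a = a * \<eta>"
proof (cases "\<beta> = 0")
  case True
  have zs_a: "qstar z * a = cis \<theta> *s (a * qstar z)"
    using a_zs True by (simp add: cis_mult)
  have "z * qstar z * a = a * (z * qstar z)"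
    by (simp add: mult.assoc zs_a) (simp add: z_a cis_mult flip: mult.assoc)
  then show ?thesis
    using \<xi>_a True by (simp add: \<eta>_def algebra_simps)
next
  case False
  let ?c = "of_real (p ^ \<beta> - 1)"
  have zs_a: "qstar z * a = cis \<theta> *s (a * qstar z) - (?c * cis \<theta>) *s (qstar b * (z ^ (\<beta> - 1) * \<xi>))"
  proof -
    have "cis (- \<theta>) *s (qstar z * a) = a * qstar z - ?c *s (qstar b * (z ^ (\<beta> - 1) * \<xi>))"
      using a_zs False by (simp add: qpow_cases_nat qstar_simps algebra_simps)
    then have "cis \<theta> *s (cis (- \<theta>) *s (qstar z * a)) = cis \<theta> *s (a * qstar z - ?c *s (qstar b * (z ^ (\<beta> - 1) * \<xi>)))"
      by (rule arg_cong)
    then show ?thesis by (simp add: cis_mult cscale_simps mult.commute)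
  qed
  \<comment> \<open>Moving \<open>z\<close> past \<open>qstar b\<close> produces a correction
    containing \<eta>, followed by powers of \<open>z\<close> and its adjoint and finally by \<xi>;
    as \<eta> passes those powers up to scalars, the correction vanishes.\<close>
  have "(qstar b * z) * (z ^ (\<beta> - 1) * \<xi>) - cis \<theta> *s (z * qstar b) * (z ^ (\<beta> - 1) * \<xi>) =
      (qstar b * z - cis \<theta> *s (z * qstar b)) * (z ^ (\<beta> - 1) * \<xi>)"
    by (simp add: left_diff_distrib)
  also have "\<dots> = of_real (1 - q ^ \<beta>) *s (a * (\<eta> * (qstar z ^ (\<beta> - 1) * z ^ (\<beta> - 1) * \<xi>)))"
    unfolding bs_z using False by (simp add: qpow_cases_nat qstar_simps mult.assoc)
  also have "\<eta> * (qstar z ^ (\<beta> - 1) * z ^ (\<beta> - 1) * \<xi>) = (\<eta> * qstar z ^ (\<beta> - 1)) * z ^ (\<beta> - 1) * \<xi>"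
    by (simp add: mult.assoc)
  also have "\<dots> = inverse (of_real q) ^ (\<beta> - 1) *s (qstar z ^ (\<beta> - 1) * ((\<eta> * z ^ (\<beta> - 1)) * \<xi>))"
    by (simp add: \<eta>_zs_power mult.assoc)
  also have "(\<eta> * z ^ (\<beta> - 1)) * \<xi> = 0"
    by (simp add: \<eta>_z_power mult.assoc)
  finally have bsz: "cis \<theta> *s (z * (qstar b * (z ^ (\<beta> - 1) * \<xi>))) = qstar b * (z * (z ^ (\<beta> - 1) * \<xi>))"
    by (simp add: mult.assoc)
  have zz: "z * (z ^ (\<beta> - 1) * \<xi>) = z ^ \<beta> * \<xi>"
    using False by (cases \<beta>) (simp_all add: mult.assoc)
  have "z * (qstar z * a) = cis \<theta> *s ((z * a) * qstar z) - ?c *s (cis \<theta> *s (z * (qstar b * (z ^ (\<beta> - 1) * \<xi>))))"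
    by (simp add: zs_a algebra_simps)
  also have "\<dots> = a * (z * qstar z) - ?c *s (a * \<xi>)"
    unfolding bsz zz a_\<xi>[symmetric] z_a by (simp add: cis_mult mult.assoc)
  finally have "\<eta> * a = a - (a * (z * qstar z) - ?c *s (a * \<xi>)) - \<xi> * a"
    by (simp add: \<eta>_def algebra_simps)
  also have "\<dots> = a * \<eta>"
    by (simp add: \<eta>_def \<xi>_a algebra_simps quotients.scale_left_diff_distrib)
  finally show ?thesis .
qed

lemma as_\<eta>: "qstar a * \<eta> = \<eta> * qstar a"
  using arg_cong[OF \<eta>_a, of qstar] by (simp add: qstar_simps)

lemma \<eta>_a_zs: "\<eta> * (a * qstar z) = cis (- \<theta>) *s (\<eta> * (qstar z * a))"
proof -
  obtain c where c: "\<xi> * qpow z (1 - int \<beta>) = c *s (qpow z (1 - int \<beta>) * \<xi>)"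
    by (rule skew_qpow[of \<xi> z p "inverse p"]) (simp_all add: \<xi>_z \<xi>_zs)
  have "qstar (qpow z (1 - int \<beta>)) * \<xi> = cnj c *s (\<xi> * qstar (qpow z (1 - int \<beta>)))"
    using arg_cong[OF c, of qstar] by (simp add: qstar_simps)
  then have "qstar b * (qstar (qpow z (1 - int \<beta>)) * \<xi>) = cnj c *s (\<xi> * (qstar b * qstar (qpow z (1 - int \<beta>))))"
    by (simp add: bs_\<xi> flip: mult.assoc)
  then have "\<eta> * (a * qstar z - cis (- \<theta>) *s (qstar z * a)) = 0"
    unfolding a_zs by simp
  then show ?thesis by (simp add: algebra_simps)
qed

lemma \<eta>_as_z: "\<eta> * (qstar a * z) = cis (- \<theta>) *s (\<eta> * (z * qstar a))"
proof -
  have "\<eta> * (z * qstar a - cis \<theta> *s (qstar a * z)) = 0"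
    unfolding z_as by simp
  then have "\<eta> * (z * qstar a) = cis \<theta> *s (\<eta> * (qstar a * z))"
    by (simp add: algebra_simps)
  then show ?thesis by (simp add: cis_mult)
qed

lemma \<eta>_disc_part: "disc_part \<eta> z a (of_real q) (cis \<theta>)"
proof
  show "\<eta> * (z * qstar z) = \<eta> - \<eta> * \<eta>" "\<eta> * (qstar z * z) = \<eta> - of_real q *s (\<eta> * \<eta>)"
    by (simp_all add: z_zs zs_z algebra_simps)
qed (use q_pos in \<open>simp_all add: \<eta>_z \<eta>_zs \<eta>_a as_\<eta> \<eta>_a_as a_z \<eta>_a_zs \<eta>_as_z as_zs\<close>)

lemma b_\<eta>: "b * \<eta> = z ^ \<beta> * (qstar a * \<eta>)"
proof -
  have "b * \<eta> = b * (\<eta> * (a * qstar a))"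
    by (simp only: \<eta>_a_as)
  also have "\<eta> * (a * qstar a) = a * (qstar a * \<eta>)"
    by (metis \<eta>_a as_\<eta> mult.assoc)
  also have "b * (a * (qstar a * \<eta>)) = e * z ^ \<beta> * (qstar a * \<eta>)"
    by (simp add: b_a flip: mult.assoc)
  also have "e * z ^ \<beta> = z ^ \<beta> * e"
    using skew_power_right[of e z 1 \<beta>] by simp
  also have "z ^ \<beta> * e * (qstar a * \<eta>) = z ^ \<beta> * (qstar a * \<eta>)"
    by (simp add: mult.assoc) (simp flip: mult.assoc)
  finally show ?thesis .
qed

text \<open>As for \<open>a\<close>, but now \<xi> commutes with \<open>b\<close> and nothing
  compensates the correction term. It amounts to \<open>1 - q ^ \<beta>\<close> times
  \<open>b * \<eta>\<close>, which leaves the factor \<open>q ^ \<beta>\<close>.\<close>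

lemma \<eta>_b: "\<eta> * b = of_real (q ^ \<beta>) *s (b * \<eta>)"
proof -
  let ?c = "of_real (1 - q ^ \<beta>)"
  have zs_b': "qstar z * b = cis (- \<theta>) *s (b * qstar z) + ?c *s (qpow z (int \<beta> - 1) * (\<eta> * qstar a))"
    using zs_b by (simp add: \<eta>_def diff_eq_eq add.commute)
  have "?c *s (z * (qpow z (int \<beta> - 1) * (\<eta> * qstar a))) = ?c *s (b * \<eta>)"
  proof (cases "\<beta> = 0")
    case False
    then have "z * (qpow z (int \<beta> - 1) * (\<eta> * qstar a)) = z ^ \<beta> * (\<eta> * qstar a)"
      by (cases \<beta>) (simp_all add: qpow_cases_nat mult.assoc)
    then show ?thesis by (simp add: b_\<eta> as_\<eta>)
  qed simp
  moreover have "z * (qstar z * b) = cis (- \<theta>) *s ((z * b) * qstar z) + ?c *s (z * (qpow z (int \<beta> - 1) * (\<eta> * qstar a)))"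
    by (simp add: zs_b' algebra_simps)
  ultimately have "z * (qstar z * b) = b * (z * qstar z) + ?c *s (b * \<eta>)"
    by (simp add: z_b cis_mult mult.assoc)
  then have "\<eta> * b = b * \<eta> - ?c *s (b * \<eta>)"
    by (simp add: \<eta>_def[of] \<xi>_b algebra_simps)
  then show ?thesis by (simp add: quotients.scale_left_diff_distrib)
qed

lemma bs_\<eta>': "qstar b * \<eta> = of_real (q ^ \<beta>) *s (\<eta> * qstar b)"
  using arg_cong[OF \<eta>_b, of qstar] by (simp add: qstar_simps)

lemma bs_\<eta>: "qstar b * \<eta> = a * (qstar z ^ \<beta> * \<eta>)"
proof -
  have "\<eta> * qstar b = \<eta> * (a * qstar z ^ \<beta>)"
    using arg_cong[OF b_\<eta>, of qstar] by (simp add: qstar_simps mult.assoc)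
  also have "\<dots> = a * (\<eta> * qstar z ^ \<beta>)"
    by (simp add: \<eta>_a flip: mult.assoc)
  finally show ?thesis
    using q_pos by (simp add: bs_\<eta>' \<eta>_zs_power power_mult_distrib[symmetric])
qed

lemma boundary_torus:
  assumes "\<xi> = 0" "\<eta> = 0"
  shows "corner_torus e z a (cis \<theta>)"
proof unfold_locales
  show "z * qstar z = e" "qstar z * z = e"
    by (simp_all only: z_zs zs_z assms(2)) (simp_all add: assms(1))
  show "a * qstar a = e" "qstar a * a = e"
    by (simp_all add: a_as as_a assms corner_poly_0 p_pos)
  show "a * qstar z = inverse (cis \<theta>) *s (qstar z * a)"
    using a_zs by (simp add: assms)
  have "z * qstar a = cis \<theta> *s (qstar a * z)"
    using z_as by (simp add: assms)
  then show "qstar a * z = inverse (cis \<theta>) *s (z * qstar a)"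
    by (simp add: cis_mult)
qed (simp_all add: a_z as_zs)

lemma boundary_b:
  assumes "\<xi> = 0" "\<eta> = 0"
  shows "b = z ^ \<beta> * qstar a" "qstar b = a * qstar z ^ \<beta>"
proof -
  have "b = b * (a * qstar a)"
    by (simp add: a_as assms corner_poly_0 p_pos)
  also have "\<dots> = e * z ^ \<beta> * qstar a"
    by (simp add: b_a flip: mult.assoc)
  also have "e * z ^ \<beta> = z ^ \<beta> * e"
    using skew_power_right[of e z 1 \<beta>] by simp
  finally show "b = z ^ \<beta> * qstar a"
    by (simp add: mult.assoc)
  then show "qstar b = a * qstar z ^ \<beta>"
    by (simp add: qstar_simps)
qed

end

subsection \<open>The presented algebra\<close>

lemma residue_modulus_poly:
  "residue E (modulus_poly r n t) = corner_poly (residue E 1) (modulus_coeff r n) n (residue E t)"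
  "residue E (comodulus_poly r n t) = corner_poly (residue E 1) (comodulus_coeff r n) n (residue E t)"
  unfolding modulus_poly_def comodulus_poly_def corner_poly_def residue_sum residue_scal_mult residue_power
  by (simp_all add: modulus_coeff_def comodulus_coeff_def sum_distrib_left atMost_atLeast0)

lemma subst_gens_modulus_poly:
  "subst_gens s (modulus_poly r n t) = modulus_poly r n (subst_gens s t)"
  "subst_gens s (comodulus_poly r n t) = comodulus_poly r n (subst_gens s t)"
  by (simp_all add: modulus_poly_def comodulus_poly_def subst_gens_simps)

text \<open>With \<open>gen\<close> as substitution this yields the relations in the lens space;
  with the two components of the isomorphism it reduces well-definedness to identities in a solid
  torus.\<close>

lemma lens_relations_iff:
  fixes s :: "lens_gen \<Rightarrow> 'g free_star" and E :: "('g free_star \<times> 'g free_star) set"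
  assumes "0 < p" "0 < q"
  defines "\<rho> \<equiv> (\<lambda>g. residue E (s g))"
  shows "lens_relations (residue E 1) (\<rho> Xi_Gen) (\<rho> Z_Gen) (\<rho> A_Gen) (\<rho> B_Gen) p q \<theta> \<beta> \<and>
      \<rho> A_Gen * \<rho> B_Gen = cis (real \<beta> * \<theta>) *s (\<rho> B_Gen * \<rho> A_Gen) \<and>
      \<rho> A_Gen * qstar (\<rho> B_Gen) = cis (- (real \<beta> * \<theta>)) *s (qstar (\<rho> B_Gen) * \<rho> A_Gen) \<longleftrightarrow>
    (\<forall>(l, r) \<in> lens_rels p q \<theta> \<beta>. residue E (subst_gens s l) = residue E (subst_gens s r))"
proof -
  define e where "e = residue E 1"
  define \<eta> where "\<eta> = e - \<rho> Z_Gen * qstar (\<rho> Z_Gen) - \<rho> Xi_Gen"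
  have \<rho>: "residue E (s g) = \<rho> g" for g by (simp add: \<rho>_def)
  have e: "e * \<rho> g = \<rho> g" "\<rho> g * e = \<rho> g" "e * (\<rho> g * w) = \<rho> g * w"
      "e * (qstar (\<rho> g) * w) = qstar (\<rho> g) * w" "\<rho> g * (e * w) = \<rho> g * w" "e * (e * w) = e * w" "e * e = e" "qstar e = e" for g w
    by (simp_all add: \<rho>_def e_def flip: mult.assoc residue_star)
  have \<eta>: "residue E (1 - s Z_Gen * (s Z_Gen)\<^sup>\<star> - s Xi_Gen) = \<eta>"
    by (simp add: \<eta>_def e_def residue_diff residue_mult residue_star \<rho>)
  have \<eta>_mult: "residue E ((1 - s Z_Gen * (s Z_Gen)\<^sup>\<star> - s Xi_Gen) * f) = \<eta> * residue E f" for f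
    by (simp only: residue_mult \<eta>)
  have e_qpow: "e * (qpow (\<rho> Z_Gen) m * (\<eta> * w)) = qpow (\<rho> Z_Gen) m * (\<eta> * w)" for m w
  proof -
    have "e * qpow (\<rho> Z_Gen) m = qpow (\<rho> Z_Gen) m * e"
      unfolding \<rho>_def e_def by (rule residue_1_qpow_commute[symmetric])
    moreover have "e * \<eta> = \<eta>"
      by (simp add: \<eta>_def right_diff_distrib e)
    ultimately show ?thesis
      by (metis mult.assoc)
  qed
  show ?thesis
    unfolding lens_relations_def lens_rels_def e_def[symmetric] \<eta>_def[symmetric]
    apply (simp only: ball_simps prod.case subst_gens_simps subst_gens_gen subst_gens_gen_star subst_gens_scal
        subst_gens_1 subst_gens_0 subst_gens_modulus_poly residue_modulus_poly mult.assoc \<eta> \<eta>_mult assms(1,2) simp_thms)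
    apply (simp only: residue_diff residue_mult residue_star residue_scal residue_scal_mult residue_0
        residue_star_power residue_power \<eta> \<rho> mult.assoc cscale_mult_left cscale_mult_right e_def[symmetric] e e_qpow simp_thms)
    apply (simp only: \<eta>_def[symmetric] e e_qpow simp_thms)
    by blast
qed

lemma lens_relations_residue:
  assumes "0 < p" "0 < q" "lens_rels p q \<theta> \<beta> \<subseteq> E"
  shows "lens_relations (residue E 1) (residue E L\<xi>) (residue E Lz) (residue E La) (residue E Lb) p q \<theta> \<beta>"
proof -
  have "\<forall>(l, r) \<in> lens_rels p q \<theta> \<beta>. residue E (subst_gens gen l) = residue E (subst_gens gen r)"
    unfolding subst_gens_gen_id using residue_relation assms(3) by blast
  then show ?thesis
    unfolding lens_relations_iff[OF assms(1,2), symmetric] by blast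
qed

abbreviation L\<eta> :: "lens_gen free_star" where "L\<eta> \<equiv> 1 - Lz * Lz\<^sup>\<star> - L\<xi>"

definition lens_monomial :: "lens_index \<Rightarrow> lens_gen free_star" where
  "lens_monomial i = (case i of
     Inl (k, m, n) \<Rightarrow> L\<xi> ^ k * Lz \<^bold>^ m * Lb \<^bold>^ n
   | Inr (k, m, n) \<Rightarrow> L\<eta> ^ k * Lz \<^bold>^ m * La \<^bold>^ n)"

lemma lens_vec_alt: "lens_vec p q \<theta> \<beta> i = residue_class (lens_rels p q \<theta> \<beta>) (lens_monomial i)"
  by (simp add: lens_vec_def lens_monomial_def)

lemma lens_spanned:
  fixes p q \<theta> :: real and \<beta> :: nat and f :: "lens_gen free_star"
  assumes pq: "0 < p" "0 < q"
  defines "E \<equiv> lens_rels p q \<theta> \<beta>"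
  shows "residue E f \<in> quotients.span ((\<lambda>i. residue E (lens_monomial i)) ` lens_indices)"
proof -
  let ?e = "residue E 1" and ?\<xi> = "residue E L\<xi>" and ?z = "residue E Lz" and ?a = "residue E La" and ?b = "residue E Lb"
  \<comment> \<open>Killing both normal elements leaves the common boundary, where \<open>z\<close>
    and \<open>a\<close> become unitary.\<close>
  define F where "F = {(L\<xi>, 0 :: lens_gen free_star), (L\<eta>, 0)}"
  define E' where "E' = E \<union> F"
  interpret S: lens_relations "?e" "?\<xi>" "?z" "?a" "?b" p q \<theta> \<beta>
    by (rule lens_relations_residue) (auto simp: assms)
  interpret S': lens_relations "residue E' 1" "residue E' L\<xi>" "residue E' Lz" "residue E' La" "residue E' Lb" p q \<theta> \<beta>
    by (rule lens_relations_residue) (auto simp: assms E'_def E_def)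
  have \<eta>: "residue E L\<eta> = S.\<eta>"
    by (simp add: S.\<eta>_def residue_diff residue_mult residue_star)
  have \<xi>': "residue E' L\<xi> = 0"
    using residue_relation[of L\<xi> 0 E'] by (simp add: E'_def F_def)
  have "S'.\<eta> = residue E' L\<eta>"
    unfolding S'.\<eta>_def by (simp add: residue_diff residue_mult residue_star)
  also have "\<dots> = 0"
    using residue_relation[of L\<eta> 0 E'] by (simp add: E'_def F_def)
  finally have \<eta>': "S'.\<eta> = 0" .
  interpret P: disc_part "?\<xi>" "?z" "?b" "of_real p" "cis (- \<theta>)"
    by (rule S.\<xi>_disc_part)
  have \<xi>_gen: "\<exists>c. ?\<xi> * residue E (gen g) = c *s (residue E (gen g) * ?\<xi>)" for g
    by (cases g) (auto simp: S.\<xi>_z S.\<xi>_a S.\<xi>_b intro: exI[of _ 1])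
  have \<xi>_as: "?\<xi> * qstar ?a = of_real (inverse (p ^ \<beta>)) *s (qstar ?a * ?\<xi>)"
    using pq by (simp add: S.as_\<xi>)
  have \<xi>_gen_star: "\<exists>c. ?\<xi> * qstar (residue E (gen g)) = c *s (qstar (residue E (gen g)) * ?\<xi>)" for g
    by (cases g) (auto simp: S.\<xi>_zs \<xi>_as S.bs_\<xi> intro: exI[of _ 1])
  \<comment> \<open>The monomials of this ideal contain only \<xi>, \<open>z\<close> and
    \<open>b\<close>; on it, \<open>a\<close> and its adjoint act as words in \<open>z\<close>,
    \<open>b\<close> and their adjoints.\<close>
  have P_a: "?a * x \<in> P.part" if "x \<in> P.part" for x
    by (rule P.left_closed_via[OF _ _ that, of _ "qstar ?b * ?z ^ \<beta>"])
      (simp_all add: S.a_\<xi> mult.assoc P.closed P.z_power_closed)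
  have P_as: "qstar ?a * x \<in> P.part" if "x \<in> P.part" for x
    by (rule P.left_closed_via[OF _ _ that, of _ "qstar ?z ^ \<beta> * ?b"])
      (simp_all add: S.as_\<xi>' mult.assoc P.closed P.z_power_closed)
  interpret P: ideal_part "?\<xi>" "?z" "?b" "of_real p" "cis (- \<theta>)" E L\<xi> Lz Lb
  proof
    show "x \<in> P.part \<Longrightarrow> residue E (gen g) * x \<in> P.part" for x g
      by (cases g) (auto intro: P.closed P_a)
    show "x \<in> P.part \<Longrightarrow> qstar (residue E (gen g)) * x \<in> P.part" for x g
      by (cases g) (auto intro: P.closed P_as)
  qed (simp_all add: \<xi>_gen \<xi>_gen_star)
  interpret Q: disc_part S.\<eta> "?z" "?a" "of_real q" "cis \<theta>"
    by (rule S.\<eta>_disc_part)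
  have \<eta>_gen: "\<exists>c. S.\<eta> * residue E (gen g) = c *s (residue E (gen g) * S.\<eta>)" for g
    by (cases g) (auto simp: S.\<eta>_z S.\<eta>_a S.\<eta>_b intro: exI[of _ 0] exI[of _ 1])
  have \<eta>_bs: "S.\<eta> * qstar ?b = of_real (inverse (q ^ \<beta>)) *s (qstar ?b * S.\<eta>)"
    using pq by (simp add: S.bs_\<eta>')
  have \<eta>_gen_star: "\<exists>c. S.\<eta> * qstar (residue E (gen g)) = c *s (qstar (residue E (gen g)) * S.\<eta>)" for g
    by (cases g) (auto simp: S.\<eta>_zs S.as_\<eta> \<eta>_bs intro: exI[of _ 0] exI[of _ 1])
  have Q_b: "?b * x \<in> Q.part" if "x \<in> Q.part" for x
    by (rule Q.left_closed_via[OF _ _ that, of _ "?z ^ \<beta> * qstar ?a"])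
      (simp_all add: S.b_\<eta> mult.assoc Q.closed Q.z_power_closed)
  have Q_bs: "qstar ?b * x \<in> Q.part" if "x \<in> Q.part" for x
    by (rule Q.left_closed_via[OF _ _ that, of _ "?a * qstar ?z ^ \<beta>"])
      (simp_all add: S.bs_\<eta> mult.assoc Q.closed Q.z_power_closed)
  \<comment> \<open>Since \<xi> annihilates \<eta>, it acts on this ideal as 0.\<close>
  have Q_\<xi>: "?\<xi> * x \<in> Q.part" if "x \<in> Q.part" for x
    by (rule Q.left_closed_via[OF _ _ that, of _ 0]) (simp_all add: Q.part_def quotients.span_zero)
  interpret Q: ideal_part S.\<eta> "?z" "?a" "of_real q" "cis \<theta>" E L\<eta> Lz La
  proof
    show "x \<in> Q.part \<Longrightarrow> residue E (gen g) * x \<in> Q.part" for x g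
      by (cases g) (auto intro: Q.closed Q_b Q_\<xi>)
    show "x \<in> Q.part \<Longrightarrow> qstar (residue E (gen g)) * x \<in> Q.part" for x g
      by (cases g) (auto intro: Q.closed Q_bs Q_\<xi>)
  qed (simp_all add: \<eta> \<eta>_gen \<eta>_gen_star)
  interpret T: corner_torus "residue E' 1" "residue E' Lz" "residue E' La" "cis \<theta>"
    by (rule S'.boundary_torus) (rule \<xi>' \<eta>')+
  note b' = S'.boundary_b[OF \<xi>' \<eta>']
  let ?S = "quotients.span T.monomials"
  have T_power: "residue E' Lz ^ n * x \<in> ?S" "qstar (residue E' Lz) ^ n * x \<in> ?S" if "x \<in> ?S" for n x
    by (induction n) (simp_all add: that T.z_closed T.zs_closed mult.assoc)
  have E'_span: "residue E' f \<in> ?S"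
  proof (rule residue_in_span)
    show "x \<in> ?S \<Longrightarrow> residue E' (gen g) * x \<in> ?S" for x g
      by (cases g) (auto simp: \<xi>' b'(1) quotients.span_zero mult.assoc intro: T.z_closed T.u_closed T.us_closed T_power)
    show "x \<in> ?S \<Longrightarrow> qstar (residue E' (gen g)) * x \<in> ?S" for x g
      by (cases g) (auto simp: \<xi>' b'(2) quotients.span_zero mult.assoc intro: T.zs_closed T.u_closed T.us_closed T_power)
  qed (rule T.e_in_span)
  \<comment> \<open>The boundary monomials are lifted to \<open>Inr\<close> vectors with k = 0,
    which is the origin of the asymmetry between the two index ranges.\<close>
  have mono: "residue E' (lens_monomial (Inr (0, m, n))) = residue E' 1 * (qpow (residue E' Lz) m * qpow (residue E' La) n)" for m n
    by (simp add: lens_monomial_def residue_star_powers)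
  have monomials: "T.monomials = (\<lambda>i. residue E' (lens_monomial (Inr (0, fst i, snd i)))) ` UNIV"
    unfolding mono by (force simp: T.monomials_def image_def)
  define N where "N = quotients.span ({P.monomial k m n |k m n. 0 < k} \<union> {Q.monomial k m n |k m n. 0 < k})"
  \<comment> \<open>Written as a sum, \<open>N\<close> inherits stability under multiplication on
    both sides from its two summands.\<close>
  have N: "N = {x + y |x y. x \<in> P.part \<and> y \<in> Q.part}"
    unfolding N_def P.part_def Q.part_def quotients.span_Un by auto
  have PN: "x \<in> N" if "x \<in> P.part" for x
    using that unfolding N_def P.part_def by (rule subsetD[OF quotients.span_mono, rotated]) auto
  have QN: "x \<in> N" if "x \<in> Q.part" for x
    using that unfolding N_def Q.part_def by (rule subsetD[OF quotients.span_mono, rotated]) auto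
  let ?C = "(\<lambda>i. residue E (lens_monomial i)) ` lens_indices"
  have P_mono: "P.monomial (Suc k) m n = residue E (lens_monomial (Inl (Suc k, m, n)))" for k m n
    unfolding P.monomial_residue lens_monomial_def by (simp only: sum.case prod.case mult.assoc)
  have Q_mono: "Q.monomial (Suc k) m n = residue E (lens_monomial (Inr (Suc k, m, n)))" for k m n
    unfolding Q.monomial_residue lens_monomial_def by (simp only: sum.case prod.case mult.assoc)
  show ?thesis
  proof (rule spanning_modulo_ideal[OF E'_def E'_span[unfolded monomials] N_def, of ?C])
    show "x \<in> quotients.span ?C" if "x \<in> N" for x
    proof -
      have "{P.monomial k m n |k m n. 0 < k} \<union> {Q.monomial k m n |k m n. 0 < k} \<subseteq> ?C"
        by (auto simp: gr0_conv_Suc P_mono Q_mono lens_indices_def)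
      with that show ?thesis
        unfolding N_def using quotients.span_mono by blast
    qed
    show "residue E (lens_monomial (Inr (0, fst i, snd i))) \<in> quotients.span ?C" for i
      by (rule quotients.span_base, rule imageI) (simp add: lens_indices_def)
    show "residue E g * x \<in> N" if "x \<in> N" for g x
      using that P.part_mult_left Q.part_mult_left unfolding N by (fastforce simp: ring_distribs)
    show "x * residue E g \<in> N" if "x \<in> N" for g x
      using that P.part_mult_right Q.part_mult_right unfolding N by (fastforce simp: ring_distribs)
    show "residue E (l - r) \<in> N" if "(l, r) \<in> F" for l r
      using that PN[OF P.t_in_part] QN[OF Q.t_in_part] by (auto simp: F_def \<eta>)
    have "(L\<eta>)\<^sup>\<star> = 1 - Lz * Lz\<^sup>\<star> - L\<xi>\<^sup>\<star>"
      by (simp add: fstar_diff fstar_mult)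
    then have "residue E ((L\<eta>)\<^sup>\<star>) = S.\<eta>"
      by (simp add: residue_diff residue_mult residue_star S.\<eta>_def)
    then show "residue E ((l - r)\<^sup>\<star>) \<in> N" if "(l, r) \<in> F" for l r
      using that PN[OF P.t_in_part] QN[OF Q.t_in_part] by (auto simp: F_def residue_star)
  qed
qed

subsection \<open>Maps into solid tori\<close>

context solid_torus_relations
begin

lemma cis_power: "cis t ^ n = cis (real n * t)"
  by (simp add: DeMoivre)

lemma h_powers:
  "h * x ^ n = cis (real n * \<theta>) *s (x ^ n * h)" "h * qstar x ^ n = cis (- (real n * \<theta>)) *s (qstar x ^ n * h)"
  "qstar h * x ^ n = cis (- (real n * \<theta>)) *s (x ^ n * qstar h)" "qstar h * qstar x ^ n = cis (real n * \<theta>) *s (qstar x ^ n * qstar h)"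
  using skew_power_right[OF h_x, of n] skew_power_right[OF h_xs, of n]
    skew_power_right[OF hs_x, of n] skew_power_right[OF hs_xs, of n]
  by (simp_all add: cis_power)

lemma e_power_commute: "e * x ^ n = x ^ n * e" "e * qstar x ^ n = qstar x ^ n * e"
  using skew_power_right[of e x 1 n] skew_power_right[of e "qstar x" 1 n] by simp_all

lemma corner_poly_X_e: "corner_poly e c n X * e = corner_poly e c n X"
proof -
  have "X ^ m * e = e * X ^ m" for m
    using skew_power_right[of e X 1 m] by simp
  then have "(\<Sum>m\<le>n. of_real (c m) *s X ^ m) * e = e * (\<Sum>m\<le>n. of_real (c m) *s X ^ m)"
    by (simp add: sum_distrib_left sum_distrib_right)
  then show ?thesis
    by (simp add: corner_poly_def mult.assoc)
qed

lemma corner_poly_Suc: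
  assumes "(\<Sum>m\<le>Suc n. of_real (c' m) *s X ^ m) =
    (\<Sum>m\<le>n. of_real (c m) *s X ^ m) * (1 - s *s X)"
  shows "corner_poly e c' (Suc n) X = corner_poly e c n X * (e - s *s X)"
proof -
  have "corner_poly e c' (Suc n) X = corner_poly e c n X * (1 - s *s X)"
    unfolding corner_poly_def assms by (simp only: mult.assoc)
  then show ?thesis
    by (simp add: right_diff_distrib corner_poly_X_e)
qed

text \<open>The q-binomial theorem in the form needed for the moduli: both sides gain the same
  factor when n grows, the left by cancelling the innermost pair, the right by the q-Pascal
  rule.\<close>

lemma xs_power_x_power:
  assumes p: "0 < p"
  shows "e * (qstar x ^ n * x ^ n) = corner_poly e (modulus_coeff p n) n X"
proof (induction n)
  case 0
  then show ?case by (simp add: corner_poly_def p)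
next
  case (Suc n)
  have "(\<Sum>m\<le>Suc n. of_real (modulus_coeff p (Suc n) m) *s X ^ m) =
      (\<Sum>m\<le>n. of_real (modulus_coeff p n m) *s X ^ m) * (1 - of_real (p ^ Suc n) *s X)"
    by (rule sum_coeff_recursion)
      (use p modulus_coeff_Suc modulus_coeff_top in \<open>simp_all del: power_Suc\<close>)
  from corner_poly_Suc[OF this] have "corner_poly e (modulus_coeff p (Suc n)) (Suc n) X =
      e * (qstar x ^ n * x ^ n) * (e - of_real (p ^ Suc n) *s X)"
    by (simp only: Suc)
  then show ?case
    by (simp only: xs_power_x_power_Suc of_real_power mult.assoc)
qed

lemma x_power_xs_power:
  assumes p: "0 < p"
  shows "e * (x ^ n * qstar x ^ n) = corner_poly e (comodulus_coeff p n) n X"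
proof (induction n)
  case 0
  then show ?case by (simp add: corner_poly_def p)
next
  case (Suc n)
  have "(\<Sum>m\<le>Suc n. of_real (comodulus_coeff p (Suc n) m) *s X ^ m) =
      (\<Sum>m\<le>n. of_real (comodulus_coeff p n m) *s X ^ m) * (1 - of_real (inverse p ^ n) *s X)"
    by (rule sum_coeff_recursion)
      (use p comodulus_coeff_Suc comodulus_coeff_top in \<open>simp_all del: power_Suc\<close>)
  from corner_poly_Suc[OF this] have "corner_poly e (comodulus_coeff p (Suc n)) (Suc n) X =
      e * (x ^ n * qstar x ^ n) * (e - of_real (inverse p ^ n) *s X)"
    by (simp only: Suc)
  then show ?case
    by (simp only: x_power_xs_power_Suc of_real_power of_real_inverse mult.assoc)
qed

text \<open>Splitting off an adjacent pair at the left end gives \<open>e - X\<close>, at the right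
  end \<open>e - p *s X\<close>; carrying the second \<open>X\<close> through the other factors
  raises p to \<open>p ^ Suc n\<close>. The difference is the correction term in the relation
  between \<open>z\<close> and \<open>qstar a\<close>.\<close>

lemma x_xs_power_commutator:
  "x * qstar x ^ Suc n - qstar x ^ Suc n * x = of_real (p ^ Suc n - 1) *s (X * qstar x ^ n)"
proof -
  have "qstar x ^ n * X = of_real p ^ n *s (X * qstar x ^ n)"
    by (rule skew_power_left) (simp add: xs_X)
  moreover have "x * qstar x ^ Suc n - qstar x ^ Suc n * x =
      (x * qstar x) * qstar x ^ n - qstar x ^ n * (qstar x * x)"
    by (simp only: power_Suc2 mult.assoc) (simp only: power_commutes flip: mult.assoc)
  ultimately show ?thesis
    by (simp add: x_xs xs_x left_diff_distrib right_diff_distrib e_power_commute quotients.scale_left_diff_distrib)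
qed

lemma xs_x_power_commutator:
  "qstar x * x ^ Suc n - x ^ Suc n * qstar x = of_real (1 - p ^ Suc n) *s (x ^ n * X)"
proof -
  have "X * x ^ n = of_real p ^ n *s (x ^ n * X)"
    by (rule skew_power_right) (rule X_x)
  moreover have "qstar x * x ^ Suc n - x ^ Suc n * qstar x =
      (qstar x * x) * x ^ n - x ^ n * (x * qstar x)"
    by (simp only: power_Suc2 mult.assoc) (simp only: power_commutes flip: mult.assoc)
  ultimately show ?thesis
    by (simp add: x_xs xs_x left_diff_distrib right_diff_distrib e_power_commute quotients.scale_left_diff_distrib)
qed

lemma x_left: "x * (x ^ n * w) = x ^ n * (x * w)"
  by (simp add: power_commutes flip: mult.assoc)

lemma power_e_left: "x ^ n * (e * w) = e * (x ^ n * w)"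
  by (simp add: e_power_commute flip: mult.assoc)

lemma h_powers_left:
  "h * (x ^ n * w) = cis (real n * \<theta>) *s (x ^ n * (h * w))"
  "h * (qstar x ^ n * w) = cis (- (real n * \<theta>)) *s (qstar x ^ n * (h * w))"
  "qstar h * (x ^ n * w) = cis (- (real n * \<theta>)) *s (x ^ n * (qstar h * w))"
  by (simp_all add: h_powers flip: mult.assoc)

lemma corner_poly_X_commute:
  assumes "X * w = w * X" "e * w = w * e"
  shows "corner_poly e c n X * w = w * corner_poly e c n X"
proof -
  have "X ^ m * w = w * X ^ m" for m
    using skew_power_left[of X w 1 m] assms(1) by simp
  moreover have "e * (w * v) = w * (e * v)" for v
    by (simp add: assms(2) flip: mult.assoc)
  ultimately show ?thesis
    by (simp add: corner_poly_def sum_distrib_left sum_distrib_right mult.assoc)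
qed

text \<open>In the first solid torus \<eta> becomes 0, so the relations governed by q collapse and
  those governed by p turn into identities for powers of the shift.\<close>

lemma lens_relations_first:
  fixes q :: real and \<beta> :: nat and \<mu> :: complex
  assumes p: "0 < p" and q: "0 < q" and \<mu>: "\<mu> = cis (real \<beta> * \<theta> / 2)"
  defines "a \<equiv> \<mu> *s (x ^ \<beta> * h)" and "b \<equiv> \<mu> *s qstar h"
  shows "lens_relations e X x a b p q \<theta> \<beta>"
    and "a * b = cis (real \<beta> * \<theta>) *s (b * a)"
    and "a * qstar b = cis (- (real \<beta> * \<theta>)) *s (qstar b * a)"
proof -
  have \<mu>\<mu>: "\<mu> * \<mu> = cis (real \<beta> * \<theta>)" "\<mu> * cnj \<mu> = 1" "cnj \<mu> * \<mu> = 1"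
    by (simp_all add: \<mu> cis_mult cis_cnj mult.commute)
  \<comment> \<open>In \<open>b * a\<close> the adjoint of \<open>h\<close> has to pass
    \<open>x ^ \<beta>\<close>; the square of \<mu> is chosen to cancel the resulting phase.\<close>
  have \<mu>3: "\<mu> * (\<mu> * cis (- (real \<beta> * \<theta>))) = 1"
    by (simp only: mult.assoc[symmetric] \<mu>\<mu>) (simp add: cis_mult)
  have qa: "qstar a = cnj \<mu> *s (qstar h * qstar x ^ \<beta>)" and qb: "qstar b = cnj \<mu> *s h"
    by (simp_all add: a_def b_def qstar_simps)
  have zero: "e - x * qstar x - X = 0" by (simp add: X_def)
  have X_pow: "X * x ^ \<beta> = of_real (p ^ \<beta>) *s (x ^ \<beta> * X)"
    using skew_power_right[OF X_x, of \<beta>] by simp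
  show "a * b = cis (real \<beta> * \<theta>) *s (b * a)"
    by (simp add: a_def b_def h_hs hs_h h_powers_left h_powers power_e_left cis_mult mult.assoc e_power_commute)
  show "a * qstar b = cis (- (real \<beta> * \<theta>)) *s (qstar b * a)"
    by (simp add: a_def qb h_powers_left h_powers cis_mult mult.assoc)
  show "lens_relations e X x a b p q \<theta> \<beta>"
  proof
    show "e * a = a" "a * e = a" "e * b = b" "b * e = b"
      by (simp_all add: a_def b_def mult.assoc power_e_left[symmetric])
    show "X * x = of_real p *s (x * X)" by (rule X_x)
    show "qstar x * x - of_real q *s (x * qstar x) =
        of_real (1 - q) *s e - of_real (p - q) *s X"
      by (simp add: x_xs xs_x cscale_simps quotients.scale_left_diff_distrib)
    show "(e - x * qstar x - X) * X = 0" by (simp add: zero)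
    show "X * a = of_real (p ^ \<beta>) *s (a * X)"
      by (simp add: a_def X_pow mult.assoc mult.commute flip: X_h) (simp add: X_pow flip: mult.assoc)
    show "X * b = b * X" by (simp add: b_def X_hs)
    show "x * a = cis (- \<theta>) *s (a * x)"
      by (simp add: a_def h_x cis_mult mult.assoc x_left mult.commute)
    show "x * b = cis \<theta> *s (b * x)"
      by (simp add: b_def hs_x cis_mult mult.commute)
    show "x * qstar a - cis \<theta> *s (qstar a * x) =
        of_real (p ^ \<beta> - 1) *s (X * (qpow x (1 - int \<beta>) * b))"
    proof (cases \<beta>)
      case 0
      then show ?thesis by (simp add: qa hs_x cis_mult mult.commute)
    next
      case (Suc n)
      \<comment> \<open>Reordering the adjoint of \<open>a\<close> turns the conjugate of \<mu> back
        into \<mu>, the very phase carried by \<open>b\<close>.\<close>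
      have \<mu>_cnj: "cnj \<mu> * cis (real \<beta> * \<theta>) = \<mu>"
        by (simp add: \<mu> cis_mult cis_cnj) (simp add: field_simps)
      have qa': "qstar a = \<mu> *s (qstar x ^ \<beta> * qstar h)"
        by (simp add: qa h_powers \<mu>_cnj)
      have "x * qstar a - cis \<theta> *s (qstar a * x) = \<mu> *s ((x * qstar x ^ \<beta> - qstar x ^ \<beta> * x) * qstar h)"
        by (simp add: qa' hs_x cis_mult algebra_simps)
      also have "\<dots> = of_real (p ^ \<beta> - 1) *s (X * (qstar x ^ n * b))"
        unfolding Suc x_xs_power_commutator by (simp add: b_def mult.assoc mult.commute)
      finally show ?thesis by (simp add: Suc qpow_def)
    qed
    show "qstar x * b - cis (- \<theta>) *s (b * qstar x) =
        of_real (1 - q ^ \<beta>) *s (qpow x (int \<beta> - 1) * ((e - x * qstar x - X) * qstar a))"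
      by (simp add: zero b_def hs_xs cis_mult mult.commute)
    show "b * a = e * x ^ \<beta>"
      by (simp add: a_def b_def h_powers_left hs_h \<mu>3 e_power_commute)
    show "qstar a * a = corner_poly e (modulus_coeff p \<beta>) \<beta> X"
    proof -
      have "qstar a * a = qstar h * (e * (qstar x ^ \<beta> * x ^ \<beta>)) * h"
        unfolding qa unfolding a_def by (simp add: \<mu>\<mu> flip: mult.assoc)
      also have "\<dots> = (qstar h * h) * corner_poly e (modulus_coeff p \<beta>) \<beta> X"
        unfolding xs_power_x_power[OF p] by (simp add: mult.assoc corner_poly_X_commute X_h)
      also have "\<dots> = corner_poly e (modulus_coeff p \<beta>) \<beta> X"
        by (simp add: hs_h corner_poly_def)
      finally show ?thesis .
    qed
    show "a * qstar a = corner_poly e (comodulus_coeff p \<beta>) \<beta> X"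
      unfolding qa unfolding a_def by (simp add: \<mu>\<mu> mult.assoc h_left power_e_left x_power_xs_power[OF p])
    show "qstar b * b = corner_poly e (modulus_coeff q \<beta>) \<beta> (e - x * qstar x - X)"
      "b * qstar b = corner_poly e (comodulus_coeff q \<beta>) \<beta> (e - x * qstar x - X)"
      by (simp_all add: zero corner_poly_0 q b_def qb qstar_simps \<mu>\<mu> h_hs hs_h)
  qed (simp_all add: p q)
qed

text \<open>The roles are exchanged: the parameter p of this solid torus is the second parameter of
  the lens space, \<open>r\<close> the first. Now \<xi> becomes 0 and \<open>X\<close> is the image
  of \<eta>.\<close>

lemma lens_relations_second:
  fixes r :: real and \<beta> :: nat
  assumes p: "0 < p" and r: "0 < r"
  defines "b \<equiv> x ^ \<beta> * qstar h"
  shows "lens_relations e 0 x h b r p \<theta> \<beta>"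
    and "h * b = cis (real \<beta> * \<theta>) *s (b * h)"
    and "h * qstar b = cis (- (real \<beta> * \<theta>)) *s (qstar b * h)"
proof -
  have qb: "qstar b = h * qstar x ^ \<beta>"
    by (simp add: b_def qstar_simps)
  have X: "e - x * qstar x - 0 = X" by (simp add: X_def)
  show "h * b = cis (real \<beta> * \<theta>) *s (b * h)"
    by (simp add: b_def h_powers_left h_hs hs_h mult.assoc)
  show "h * qstar b = cis (- (real \<beta> * \<theta>)) *s (qstar b * h)"
    by (simp add: qb h_powers_left h_powers mult.assoc cis_mult)
  show "lens_relations e 0 x h b r p \<theta> \<beta>"
  proof
    show "e * b = b" "b * e = b"
      by (simp_all add: b_def mult.assoc power_e_left[symmetric])
    show "qstar x * x - of_real p *s (x * qstar x) =
        of_real (1 - p) *s e - of_real (r - p) *s 0"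
      by (simp add: x_xs xs_x cscale_simps quotients.scale_left_diff_distrib)
    show "x * h = cis (- \<theta>) *s (h * x)" by (simp add: h_x cis_mult)
    show "x * b = cis \<theta> *s (b * x)"
      by (simp add: b_def hs_x cis_mult mult.assoc x_left)
    show "x * qstar h - cis \<theta> *s (qstar h * x) =
        of_real (r ^ \<beta> - 1) *s (0 * (qpow x (1 - int \<beta>) * b))"
      by (simp add: hs_x cis_mult)
    show "qstar x * b - cis (- \<theta>) *s (b * qstar x) =
        of_real (1 - p ^ \<beta>) *s (qpow x (int \<beta> - 1) * ((e - x * qstar x - 0) * qstar h))"
    proof (cases \<beta>)
      case 0
      then show ?thesis by (simp add: b_def hs_xs cis_mult)
    next
      case (Suc n)
      have "qstar x * b - cis (- \<theta>) *s (b * qstar x) = (qstar x * x ^ \<beta> - x ^ \<beta> * qstar x) * qstar h"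
        by (simp add: b_def hs_xs cis_mult algebra_simps)
      also have "\<dots> = of_real (1 - p ^ \<beta>) *s (x ^ n * (X * qstar h))"
        unfolding Suc xs_x_power_commutator by (simp add: mult.assoc)
      finally show ?thesis unfolding X by (simp add: Suc qpow_def)
    qed
    show "b * h = e * x ^ \<beta>"
      by (simp add: b_def hs_h mult.assoc e_power_commute)
    show "qstar b * b = corner_poly e (modulus_coeff p \<beta>) \<beta> (e - x * qstar x - 0)"
    proof -
      have "qstar b * b = h * (e * (qstar x ^ \<beta> * x ^ \<beta>)) * qstar h"
        unfolding qb unfolding b_def by (simp flip: mult.assoc)
      also have "\<dots> = (h * qstar h) * corner_poly e (modulus_coeff p \<beta>) \<beta> X"
        unfolding xs_power_x_power[OF p] by (simp add: mult.assoc corner_poly_X_commute X_hs)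
      also have "\<dots> = corner_poly e (modulus_coeff p \<beta>) \<beta> X"
        by (simp add: h_hs corner_poly_def)
      finally show ?thesis unfolding X .
    qed
    show "b * qstar b = corner_poly e (comodulus_coeff p \<beta>) \<beta> (e - x * qstar x - 0)"
      unfolding X qb unfolding b_def by (simp add: mult.assoc h_left power_e_left x_power_xs_power[OF p])
  qed (simp_all add: p r corner_poly_0 h_hs hs_h)
qed

end

section \<open>The gluing maps\<close>

context corner_unitary
begin

lemma e_left: "y * (e * v) = e * (y * v)" if "y * e = y" "e * y = y"
  using that by (metis mult.assoc)

lemma qpow_add: "e * (qpow w m * qpow w n) = e * qpow w (m + n)"
proof -
  have e_ws: "qstar w * e = qstar w" "e * qstar w = qstar w"
    by (metis e_w w_e qstar_e qstar_mult)+
  have "e * (w ^ k * qpow w n) = e * qpow w (int k + n)" for k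
  proof (induction k)
    case (Suc k)
    have "e * (w ^ Suc k * qpow w n) = w * (e * (w ^ k * qpow w n))"
      by (simp add: e_left[OF w_e e_w] mult.assoc)
    then show ?case
      by (simp only: Suc e_left[OF w_e e_w] mult_qpow) (simp add: algebra_simps)
  qed simp
  moreover have "e * (qstar w ^ k * qpow w n) = e * qpow w (- int k + n)" for k
  proof (induction k)
    case (Suc k)
    have "e * (qstar w ^ Suc k * qpow w n) = qstar w * (e * (qstar w ^ k * qpow w n))"
      by (simp add: e_left[OF e_ws] mult.assoc)
    then show ?case
      by (simp only: Suc e_left[OF e_ws] star_mult_qpow) (simp add: algebra_simps)
  qed simp
  ultimately show ?thesis
    by (cases m rule: int_cases2) auto
qed

end

section \<open>The quantum torus and the unitary assigned to the circle generator by the second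
  gluing map\<close>

locale torus_relations =
  fixes e V U :: "'g quotients" and \<theta> :: real
  assumes e_e [simp]: "e * e = e" and qstar_e [simp]: "qstar e = e"
    and e_mult [simp]: "e * V = V" "V * e = V" "e * U = U" "U * e = U"
    and V_Vs: "V * qstar V = e" and Vs_V: "qstar V * V = e"
    and U_Us: "U * qstar U = e" and Us_U: "qstar U * U = e"
    and U_V: "U * V = cis \<theta> *s (V * U)"
begin

lemma e_stars [simp]: "e * qstar V = qstar V" "qstar V * e = qstar V" "e * qstar U = qstar U" "qstar U * e = qstar U"
  by (metis e_mult qstar_e qstar_mult)+

lemma U_Vs: "U * qstar V = cis (- \<theta>) *s (qstar V * U)"
proof -
  have "qstar V * U = qstar V * (U * V) * qstar V"
    by (simp add: V_Vs mult.assoc)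
  also have "\<dots> = cis \<theta> *s ((qstar V * V) * (U * qstar V))"
    by (simp add: U_V mult.assoc)
  also have "\<dots> = cis \<theta> *s (U * qstar V)"
    by (simp add: Vs_V flip: mult.assoc)
  finally show ?thesis by (simp add: cis_mult)
qed

lemma unitary_V: "corner_unitary e V" and unitary_U: "corner_unitary e U"
  by unfold_locales (simp_all add: V_Vs Vs_V U_Us Us_U)

lemma e_V_powers: "e * V ^ n = V ^ n * e" "e * qstar V ^ n = qstar V ^ n * e"
  using skew_power_right[of e V 1 n] skew_power_right[of e "qstar V" 1 n] by simp_all

lemma e_left [simp]: "e * (V * w) = V * w" "e * (qstar V * w) = qstar V * w" "e * (U * w) = U * w"
    "e * (qstar U * w) = qstar U * w" "e * (e * w) = e * w"
  by (simp_all flip: mult.assoc)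

lemma U_V_power: "U * V ^ n = cis (real n * \<theta>) *s (V ^ n * U)"
  using skew_power_right[OF U_V, of n] by (simp add: DeMoivre)

lemma V_powers_cancel: "e * (V ^ n * (qstar V ^ n * w)) = e * w" "e * (qstar V ^ n * (V ^ n * w)) = e * w"
  using corner_unitary.qpow_add[OF unitary_V, of "int n" "- int n"]
    corner_unitary.qpow_add[OF unitary_V, of "- int n" "int n"]
  by (simp_all flip: mult.assoc)

text \<open>The value prescribed for the second gluing map at k = m = 0 and n = 1.\<close>

definition glued_unitary :: "nat \<Rightarrow> 'g quotients" where
  "glued_unitary \<beta> = cis (real \<beta> * \<theta> / 2) *s (V ^ \<beta> * U)"

lemma glued_relations:
  fixes q :: real and \<beta> :: nat
  assumes "q \<noteq> 0"
  shows "solid_torus_relations e V (glued_unitary \<beta>) q \<theta>"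
proof
  let ?G = "glued_unitary \<beta>"
  have e_V: "V ^ n * (e * w) = e * (V ^ n * w)" "qstar V ^ n * (e * w) = e * (qstar V ^ n * w)" for n w
    by (simp_all add: e_V_powers flip: mult.assoc)
  have U_e: "U * (qstar U * w) = e * w" "qstar U * (U * w) = e * w" for w
    by (simp_all add: U_Us Us_U flip: mult.assoc)
  show "e * ?G = ?G" "?G * e = ?G"
    by (simp_all add: glued_unitary_def mult.assoc e_V[symmetric])
  have phase: "cis (real \<beta> * \<theta> / 2) * cis (- (real \<beta> * \<theta> / 2)) = 1"
    by (simp add: cis_mult)
  show "?G * qstar ?G = e"
    using V_powers_cancel(1)[of \<beta> e]
    by (simp add: glued_unitary_def qstar_simps cis_cnj mult.assoc U_e phase e_V cis_mult e_V_powers(2)[symmetric])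
  show "qstar ?G * ?G = e"
  proof -
    have "qstar ?G * ?G = qstar U * (e * (qstar V ^ \<beta> * (V ^ \<beta> * U)))"
      by (simp add: glued_unitary_def qstar_simps cis_cnj mult.assoc cis_mult) (simp flip: mult.assoc)
    then show ?thesis unfolding V_powers_cancel by (simp add: Us_U)
  qed
  show "qstar V * V = complex_of_real q *s (V * qstar V) + complex_of_real (1 - q) *s e"
    by (simp add: V_Vs Vs_V flip: quotients.scale_left_distrib)
  show "?G * V = cis \<theta> *s (V * ?G)"
    by (simp add: glued_unitary_def mult.assoc U_V power_commutes mult.commute) (simp add: power_commutes flip: mult.assoc)
  have "V ^ \<beta> * qstar V = qstar V * V ^ \<beta>"
    by (rule skew_power_left[of V "qstar V" 1, simplified]) (simp add: V_Vs Vs_V)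
  then show "?G * qstar V = cis (- \<theta>) *s (qstar V * ?G)"
    by (simp add: glued_unitary_def mult.assoc U_Vs mult.commute) (simp flip: mult.assoc)
qed (simp_all add: assms)

text \<open>The quadratic phase accumulates from reordering: passing \<open>U\<close> through
  \<open>V ^ (\<beta> * n)\<close> contributes n units of \<beta> \<theta>, the new factor itself
  one half, and n^2/2 + n + 1/2 = (n + 1)^2/2.\<close>

lemma glued_unitary_power:
  "e * glued_unitary \<beta> ^ n = cis (real \<beta> * \<theta> * (real n)\<^sup>2 / 2) *s (e * (V ^ (\<beta> * n) * U ^ n))"
proof (induction n)
  case (Suc n)
  let ?G = "glued_unitary \<beta>" and ?c = "cis (real \<beta> * \<theta> * (real n)\<^sup>2 / 2)"
  interpret G: solid_torus_relations e V ?G 1 \<theta>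
    by (rule glued_relations) simp
  have "e * ?G ^ Suc n = ?G * (e * ?G ^ n)"
    by (simp flip: mult.assoc)
  also have "\<dots> = ?c *s (?G * (V ^ (\<beta> * n) * U ^ n))"
    unfolding Suc by (simp flip: mult.assoc)
  also have "\<dots> = ?c *s (e * (?G * V ^ (\<beta> * n)) * U ^ n)"
    by (simp flip: mult.assoc)
  also have "\<dots> = (?c * cis (real \<beta> * \<theta> / 2) * cis (real (\<beta> * n) * \<theta>)) *s
      (e * (V ^ (\<beta> + \<beta> * n) * (U * U ^ n)))"
    by (simp add: glued_unitary_def U_V_power mult.assoc power_add)
  also have "?c * cis (real \<beta> * \<theta> / 2) * cis (real (\<beta> * n) * \<theta>) = cis (real \<beta> * \<theta> * (real (Suc n))\<^sup>2 / 2)"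
    by (simp add: cis_mult power2_eq_square field_simps)
  finally show ?case by simp
qed simp

lemma U_powers_V_powers:
  "qstar U ^ n * qstar V ^ m = cis (real n * real m * \<theta>) *s (qstar V ^ m * qstar U ^ n)"
proof -
  have "qstar V * qstar U = cis (- \<theta>) *s (qstar U * qstar V)"
    using arg_cong[OF U_V, of qstar] by (simp add: qstar_simps cis_cnj)
  then have "qstar U * qstar V = cis \<theta> *s (qstar V * qstar U)"
    by (simp add: cis_mult)
  from skew_power_left[OF this, of n]
  have "qstar U ^ n * qstar V = cis (real n * \<theta>) *s (qstar V * qstar U ^ n)"
    by (simp add: DeMoivre)
  from skew_power_right[OF this, of m] show ?thesis
    by (simp add: DeMoivre mult_ac)
qed

lemma glued_unitary_qpow:
  "e * qpow (glued_unitary \<beta>) n =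
    cis (real \<beta> * \<theta> * (real_of_int n)\<^sup>2 / 2) *s (e * (qpow V (int \<beta> * n) * qpow U n))"
proof (cases n rule: int_cases2)
  case (nonneg k)
  then show ?thesis
    using glued_unitary_power[of \<beta> k] by (simp add: qpow_def nat_mult_distrib)
next
  case (nonpos k)
  have "qstar (glued_unitary \<beta>) ^ k * e =
      cis (- (real \<beta> * \<theta> * (real k)\<^sup>2 / 2)) *s (qstar U ^ k * qstar V ^ (\<beta> * k) * e)"
    using arg_cong[OF glued_unitary_power[of \<beta> k], of qstar] by (simp add: qstar_simps cis_cnj)
  also have "\<dots> = (cis (- (real \<beta> * \<theta> * (real k)\<^sup>2 / 2)) * cis (real k * real (\<beta> * k) * \<theta>)) *s
      (qstar V ^ (\<beta> * k) * qstar U ^ k * e)"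
    by (simp add: U_powers_V_powers)
  \<comment> \<open>Adjoints reverse the order of the factors; restoring it costs k^2 units of
    \<beta> \<theta>, which turns the phase -k^2/2 into +k^2/2. Hence the phase is even in
    n.\<close>
  also have "cis (- (real \<beta> * \<theta> * (real k)\<^sup>2 / 2)) * cis (real k * real (\<beta> * k) * \<theta>) =
      cis (real \<beta> * \<theta> * (real k)\<^sup>2 / 2)"
    by (simp add: cis_mult power2_eq_square field_simps)
  finally have *: "qstar (glued_unitary \<beta>) ^ k * e =
      cis (real \<beta> * \<theta> * (real k)\<^sup>2 / 2) *s (qstar V ^ (\<beta> * k) * qstar U ^ k * e)" .
  interpret G: solid_torus_relations e V "glued_unitary \<beta>" 1 \<theta>
    by (rule glued_relations) simp
  have eG: "qstar (glued_unitary \<beta>) ^ k * e = e * qstar (glued_unitary \<beta>) ^ k"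
    using skew_power_right[of e "qstar (glued_unitary \<beta>)" 1 k] by simp
  have eU: "qstar U ^ k * e = e * qstar U ^ k"
    using skew_power_right[of e "qstar U" 1 k] by simp
  have "qstar V ^ (\<beta> * k) * qstar U ^ k * e = e * (qstar V ^ (\<beta> * k) * qstar U ^ k)"
    by (simp add: eU mult.assoc) (simp add: e_V_powers flip: mult.assoc)
  moreover have "qpow V (int \<beta> * n) = qstar V ^ (\<beta> * k)"
    using nonpos by (cases "\<beta> * k = 0") (auto simp: qpow_def mult_le_0_iff nat_mult_distrib simp flip: of_nat_mult)
  ultimately show ?thesis
    using * nonpos by (simp add: eG)
qed

end

lemma torus_relations_residue:
  "torus_relations (residue (torus_rels \<theta>) 1) (residue (torus_rels \<theta>) Tv) (residue (torus_rels \<theta>) Tu) \<theta>"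
proof -
  have rel: "residue (torus_rels \<theta>) l = residue (torus_rels \<theta>) r" if "(l, r) \<in> torus_rels \<theta>" for l r
    using that by (rule residue_relation)
  show ?thesis
  proof
    show "qstar (residue (torus_rels \<theta>) 1) = residue (torus_rels \<theta>) 1"
      by (simp flip: residue_star)
    show "residue (torus_rels \<theta>) Tu * residue (torus_rels \<theta>) Tv =
        cis \<theta> *s (residue (torus_rels \<theta>) Tv * residue (torus_rels \<theta>) Tu)"
      using rel[of "Tu * Tv" "scal (cis \<theta>) * Tv * Tu"] by (simp add: torus_rels_def residue_mult residue_scal)
  qed (use rel[of "Tu * Tu\<^sup>\<star>" 1] rel[of "Tu\<^sup>\<star> * Tu" 1] rel[of "Tv * Tv\<^sup>\<star>" 1] rel[of "Tv\<^sup>\<star> * Tv" 1]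
      in \<open>simp_all add: torus_rels_def residue_mult residue_star\<close>)
qed

section \<open>Existence and surjectivity of the gluing maps\<close>

lemma solid_relations_respected:
  fixes p \<theta> :: real
  assumes "p \<noteq> 0"
    and "solid_torus_relations (residue E 1) (residue E (s Disc_Gen)) (residue E (s Circle_Gen)) p \<theta>"
    and "(l, r) \<in> solid_torus_rels p \<theta>"
  shows "subst_gens s (l - r) \<in> relation_ideal E"
  using assms(2,3) unfolding solid_torus_relations_iff[OF assms(1)]
  by (auto simp: subst_gens_diff residue_diff simp flip: residue_eq_0_iff)

lemma quotient_map_surjective:
  assumes "\<And>l r. (l, r) \<in> E \<Longrightarrow> subst_gens s (l - r) \<in> relation_ideal E'"
    and "\<And>g. \<exists>f. residue E' (subst_gens s f) = residue E' (gen g)"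
  shows "surjective_star_hom (presented E) (presented E') (quotient_map E s E')"
proof -
  obtain t where t: "\<And>g. residue E' (subst_gens s (t g)) = residue E' (gen g)"
    using choice[of "\<lambda>g f. residue E' (subst_gens s f) = residue E' (gen g)"] assms(2) by blast
  have "residue E' (subst_gens s (subst_gens t f)) = residue E' f" for f
    unfolding subst_gens_subst_gens
    by (induction f rule: free_star_induct) (simp_all add: subst_gens_simps residue_simps t)
  then have "residue_class E' f = quotient_map E s E' (residue_class E (subst_gens t f))" for f
    by (simp add: quotient_map_residue_class[OF assms(1)] flip: residue_eq_iff)
  then have "carrier (presented E') \<subseteq> quotient_map E s E' ` carrier (presented E)"
    by (auto simp: carrier_presented)
  moreover have "quotient_map E s E' ` carrier (presented E) \<subseteq> carrier (presented E')"
    by (auto simp: carrier_presented quotient_map_residue_class[OF assms(1)])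
  ultimately show ?thesis
    unfolding surjective_star_hom_def using quotient_map_star_hom[OF assms(1)] by auto
qed

lemma quotient_map_solid_monomial:
  fixes \<theta> :: real and s :: "solid_gen \<Rightarrow> torus_gen free_star"
  defines "E \<equiv> torus_rels \<theta>"
  assumes "s Disc_Gen = Tv"
  shows "residue E (subst_gens s (solid_monomial k m n)) =
    (if k = 0 then 1 else 0) *s (residue E 1 * (qpow (residue E Tv) m * qpow (residue E (s Circle_Gen)) n))"
proof (cases k)
  case 0
  then show ?thesis
    by (simp add: solid_monomial_def subst_gens_simps residue_star_powers assms(2))
next
  case (Suc j)
  interpret torus_relations "residue E 1" "residue E Tv" "residue E Tu" \<theta>
    unfolding E_def by (rule torus_relations_residue)
  have "residue E (1 - Tv * Tv\<^sup>\<star>) = 0"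
    by (simp add: residue_simps V_Vs)
  then have "residue E ((1 - Tv * Tv\<^sup>\<star>) * f) = 0" for f
    by (simp only: residue_mult) simp
  then show ?thesis
    by (simp add: Suc solid_monomial_def subst_gens_simps assms(2) mult.assoc)
qed

lemma ex_gluing_map2:
  fixes q \<theta> :: real and \<beta> :: nat
  assumes "q \<noteq> 0"
  shows "\<exists>\<chi>. gluing_map2 q \<theta> \<beta> \<chi>"
proof -
  define E where "E = torus_rels \<theta>"
  define \<mu> where "\<mu> = cis (real \<beta> * \<theta> / 2)"
  define s where "s g = (case g of Disc_Gen \<Rightarrow> Tv | Circle_Gen \<Rightarrow> scal \<mu> * (Tv ^ \<beta> * Tu))" for g
  interpret T: torus_relations "residue E 1" "residue E Tv" "residue E Tu" \<theta>
    unfolding E_def by (rule torus_relations_residue)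
  have eV: "residue E 1 * (residue E Tv ^ n * residue E Tu) = residue E Tv ^ n * residue E Tu" for n
    by (simp add: T.e_V_powers mult.assoc[symmetric]) (simp add: mult.assoc)
  have h: "residue E (s Circle_Gen) = T.glued_unitary \<beta>"
    by (simp add: s_def T.glued_unitary_def \<mu>_def residue_scal_mult residue_mult[of _ _ Tu] residue_power mult.assoc eV)
  have "solid_torus_relations (residue E 1) (residue E (s Disc_Gen)) (residue E (s Circle_Gen)) q \<theta>"
    unfolding h using T.glued_relations[OF assms, of \<beta>] by (simp add: s_def)
  note resp = solid_relations_respected[OF assms this]
  have surj: "\<exists>f. residue E (subst_gens s f) = residue E (gen g)" for g
  proof (cases g)
    case V_Gen
    then show ?thesis by (intro exI[of _ Sx]) (simp add: s_def)
  next
    case U_Gen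
    \<comment> \<open>\<open>U\<close> is recovered from the glued unitary by removing its phase and
      cancelling \<open>V ^ \<beta>\<close> with the adjoint of the disc generator's image.\<close>
    have "residue E (subst_gens s (scal (cnj \<mu>) * ((Sx\<^sup>\<star>) ^ \<beta> * Sh))) =
        cnj \<mu> *s (residue E 1 * (qstar (residue E Tv) ^ \<beta> * T.glued_unitary \<beta>))"
      by (simp add: subst_gens_simps residue_scal_mult residue_mult residue_power residue_star mult.assoc)
        (simp add: s_def[of Disc_Gen] residue_scal h)
    also have "\<dots> = residue E 1 * (qstar (residue E Tv) ^ \<beta> * (residue E Tv ^ \<beta> * residue E Tu))"
      by (simp add: T.glued_unitary_def \<mu>_def cis_cnj cis_mult)
    also have "\<dots> = residue E Tu"
      unfolding T.V_powers_cancel by simp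
    finally show ?thesis unfolding U_Gen by blast
  qed
  have vec: "quotient_map (solid_torus_rels q \<theta>) s E (solid_torus_vec q \<theta> k m n) =
      ((if k = 0 then 1 else 0) * cis (real \<beta> * \<theta> * (real_of_int n)\<^sup>2 / 2))
        \<odot>\<^bsub>quantum_torus \<theta>\<^esub> torus_vec \<theta> (m + int \<beta> * n) n" for k m n
  proof -
    let ?c = "cis (real \<beta> * \<theta> * (real_of_int n)\<^sup>2 / 2)"
    have V: "residue E 1 * qpow (residue E Tv) m = qpow (residue E Tv) m * residue E 1" for m
      by (rule residue_1_qpow_commute[symmetric])
    have "residue E 1 * (qpow (residue E Tv) m * qpow (T.glued_unitary \<beta>) n) =
        qpow (residue E Tv) m * (residue E 1 * qpow (T.glued_unitary \<beta>) n)"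
      by (simp add: V flip: mult.assoc)
    also have "\<dots> = ?c *s ((residue E 1 * (qpow (residue E Tv) m * qpow (residue E Tv) (int \<beta> * n))) * qpow (residue E Tu) n)"
      unfolding T.glued_unitary_qpow by (simp add: residue_1_qpow_commute flip: mult.assoc)
    also have "\<dots> = ?c *s (residue E 1 * (qpow (residue E Tv) (m + int \<beta> * n) * qpow (residue E Tu) n))"
      unfolding corner_unitary.qpow_add[OF T.unitary_V] by (simp add: mult.assoc)
    finally have "residue E (subst_gens s (solid_monomial k m n)) =
        ((if k = 0 then 1 else 0) * ?c) *s (residue E 1 * (qpow (residue E Tv) (m + int \<beta> * n) * qpow (residue E Tu) n))"
      using quotient_map_solid_monomial[of s \<theta> k m n] h by (simp add: s_def E_def)
    then show ?thesis
      by (simp add: solid_torus_vec_alt quotient_map_residue_class[OF resp] quantum_torus_def torus_vec_def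
        residue_scal_mult residue_star_powers flip: residue_eq_iff E_def)
  qed
  then show ?thesis
    using quotient_map_surjective[OF resp surj]
    unfolding gluing_map2_def solid_torus_def quantum_torus_def E_def by blast
qed

text \<open>For \<beta> = 0 both the phase and the shift of the exponent disappear from the second
  gluing map.\<close>

lemma ex_gluing_map1:
  fixes p \<theta> :: real
  assumes "p \<noteq> 0"
  shows "\<exists>\<chi>. gluing_map1 p \<theta> \<chi>"
  using ex_gluing_map2[OF assms, of \<theta> 0] by (simp add: gluing_map1_def gluing_map2_def)

section \<open>The isomorphism with the gluing\<close>

text \<open>The phase is forced by the requirement that both components agree in the quantum torus.\<close>

definition lens_phase :: "real \<Rightarrow> nat \<Rightarrow> complex" where
  "lens_phase \<theta> \<beta> = cis (real \<beta> * \<theta> / 2)"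

definition lens_first :: "real \<Rightarrow> nat \<Rightarrow> lens_gen \<Rightarrow> solid_gen free_star" where
  "lens_first \<theta> \<beta> g = (case g of Xi_Gen \<Rightarrow> 1 - Sx * Sx\<^sup>\<star> | Z_Gen \<Rightarrow> Sx
     | A_Gen \<Rightarrow> scal (lens_phase \<theta> \<beta>) * (Sx ^ \<beta> * Sh) | B_Gen \<Rightarrow> scal (lens_phase \<theta> \<beta>) * Sh\<^sup>\<star>)"

definition lens_second :: "nat \<Rightarrow> lens_gen \<Rightarrow> solid_gen free_star" where
  "lens_second \<beta> g = (case g of Xi_Gen \<Rightarrow> 0 | Z_Gen \<Rightarrow> Sx | A_Gen \<Rightarrow> Sh | B_Gen \<Rightarrow> Sx ^ \<beta> * Sh\<^sup>\<star>)"

lemma residue_power_mult: "residue E (f ^ n * g) = residue E f ^ n * residue E g"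
proof -
  have "residue E 1 * residue E f ^ n = residue E f ^ n * residue E 1"
    using skew_power_right[of "residue E 1" "residue E f" 1 n] by simp
  then show ?thesis
    by (simp add: residue_mult residue_power mult.assoc)
qed

lemma lens_first_respects:
  fixes p q \<theta> :: real
  assumes "0 < p" "0 < q" "(l, r) \<in> lens_rels p q \<theta> \<beta>"
  shows "subst_gens (lens_first \<theta> \<beta>) (l - r) \<in> relation_ideal (solid_torus_rels p \<theta>)"
proof -
  define E where "E = solid_torus_rels p \<theta>"
  let ?s = "lens_first \<theta> \<beta>"
  interpret S: solid_torus_relations "residue E 1" "residue E Sx" "residue E Sh" p \<theta>
    by (rule solid_torus_relations_residue) (use assms in \<open>auto simp: E_def\<close>)
  have X: "residue E (?s Xi_Gen) = S.X" and Z: "residue E (?s Z_Gen) = residue E Sx"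
    by (simp_all add: lens_first_def S.X_def residue_simps)
  have A: "residue E (?s A_Gen) = cis (real \<beta> * \<theta> / 2) *s (residue E Sx ^ \<beta> * residue E Sh)"
    and B: "residue E (?s B_Gen) = cis (real \<beta> * \<theta> / 2) *s qstar (residue E Sh)"
    by (simp_all add: lens_first_def lens_phase_def residue_scal_mult residue_power_mult residue_star)
  have "\<forall>(l, r) \<in> lens_rels p q \<theta> \<beta>. residue E (subst_gens ?s l) = residue E (subst_gens ?s r)"
    unfolding lens_relations_iff[OF assms(1,2), symmetric] X Z A B
    by (intro conjI S.lens_relations_first[OF assms(1,2) refl])
  with assms(3) have "residue E (subst_gens ?s l) = residue E (subst_gens ?s r)"
    by blast
  then show ?thesis
    by (simp add: E_def subst_gens_diff residue_diff flip: residue_eq_0_iff)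
qed

lemma lens_second_respects:
  fixes p q \<theta> :: real
  assumes "0 < p" "0 < q" "(l, r) \<in> lens_rels p q \<theta> \<beta>"
  shows "subst_gens (lens_second \<beta>) (l - r) \<in> relation_ideal (solid_torus_rels q \<theta>)"
proof -
  define E where "E = solid_torus_rels q \<theta>"
  let ?s = "lens_second \<beta>"
  interpret S: solid_torus_relations "residue E 1" "residue E Sx" "residue E Sh" q \<theta>
    by (rule solid_torus_relations_residue) (use assms in \<open>auto simp: E_def\<close>)
  have X: "residue E (?s Xi_Gen) = 0" and Z: "residue E (?s Z_Gen) = residue E Sx"
    and A: "residue E (?s A_Gen) = residue E Sh"
    and B: "residue E (?s B_Gen) = residue E Sx ^ \<beta> * qstar (residue E Sh)"
    by (simp_all add: lens_second_def residue_power_mult residue_star)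
  have "\<forall>(l, r) \<in> lens_rels p q \<theta> \<beta>. residue E (subst_gens ?s l) = residue E (subst_gens ?s r)"
    unfolding lens_relations_iff[OF assms(1,2), symmetric] X Z A B
    by (intro conjI S.lens_relations_second[OF assms(2,1)])
  with assms(3) have "residue E (subst_gens ?s l) = residue E (subst_gens ?s r)"
    by blast
  then show ?thesis
    by (simp add: E_def subst_gens_diff residue_diff flip: residue_eq_0_iff)
qed

text \<open>Needed because \<open>b\<close> goes to a phase times an adjoint in the first component.
  For negative n the conjugate of \<mu> appears, and modulus 1 makes it the inverse.\<close>

lemma star_power_phase:
  assumes "cmod \<mu> = 1"
  shows "(scal \<mu> * f\<^sup>\<star>) \<^bold>^ n = scal (\<mu> powi n) * f \<^bold>^ (- n)"
proof -
  have pow: "(scal c * g) ^ k = scal (c ^ k) * g ^ k" for c k and g :: "'a free_star"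
  proof (induction k)
    case (Suc k)
    have "(scal c * g) ^ Suc k = scal c * (g * scal (c ^ k)) * g ^ k"
      by (simp add: Suc mult.assoc)
    also have "\<dots> = scal (c ^ Suc k) * g ^ Suc k"
      unfolding scal_commute[of g] by (simp add: scal_mult mult.assoc)
    finally show ?case .
  qed simp
  have "\<mu> * cnj \<mu> = 1"
    using assms complex_norm_square[of \<mu>] by simp
  then have "cnj \<mu> = inverse \<mu>"
    by (simp add: inverse_unique)
  then show ?thesis
    by (cases n rule: int_cases2)
      (auto simp: star_power_def fstar_mult scal_commute[of f] pow power_int_minus power_inverse)
qed

lemma cmod_lens_phase: "cmod (lens_phase \<theta> \<beta>) = 1"
  by (simp add: lens_phase_def)

lemma lens_phase_powi_nonzero: "lens_phase \<theta> \<beta> powi n \<noteq> 0"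
  using cmod_lens_phase[of \<theta> \<beta>] by auto

section \<open>Images of the lens monomials and elimination of coefficients\<close>

lemma subst_lens_first_Inl:
  "subst_gens (lens_first \<theta> \<beta>) (lens_monomial (Inl (k, m, n))) =
    scal (lens_phase \<theta> \<beta> powi n) * solid_monomial k m (- n)"
proof -
  have "subst_gens (lens_first \<theta> \<beta>) (lens_monomial (Inl (k, m, n))) =
      (((1 - Sx * Sx\<^sup>\<star>) ^ k * Sx \<^bold>^ m) * scal (lens_phase \<theta> \<beta> powi n)) * Sh \<^bold>^ (- n)"
    by (simp add: lens_monomial_def subst_gens_simps lens_first_def star_power_phase[OF cmod_lens_phase] mult.assoc)
  then show ?thesis
    unfolding scal_commute[of "(1 - Sx * Sx\<^sup>\<star>) ^ k * Sx \<^bold>^ m"]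
    by (simp add: solid_monomial_def mult.assoc)
qed

lemma subst_lens_second:
  "0 < k \<Longrightarrow> subst_gens (lens_second \<beta>) (lens_monomial (Inl (k, m, n))) = 0"
  "subst_gens (lens_second \<beta>) (lens_monomial (Inr (k, m, n))) = solid_monomial k m n"
  by (cases k) (simp_all add: lens_monomial_def subst_gens_simps lens_second_def solid_monomial_def)

text \<open>Serves both the independence of the basis and the injectivity of the isomorphism. The
  second component forces the \<open>Inr\<close> coefficients to vanish, after which the first sees
  only the \<open>Inl\<close> ones.\<close>

lemma lens_combination_zero:
  fixes p q \<theta> :: real
  assumes pq: "0 < p" "p < 1" "0 < q" "q < 1" and F: "finite F" "F \<subseteq> lens_indices"
    and 1: "subst_gens (lens_first \<theta> \<beta>) (\<Sum>i\<in>F. scal (c i) * lens_monomial i) \<in> relation_ideal (solid_torus_rels p \<theta>)"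
    and 2: "subst_gens (lens_second \<beta>) (\<Sum>i\<in>F. scal (c i) * lens_monomial i) \<in> relation_ideal (solid_torus_rels q \<theta>)"
    and "i \<in> F"
  shows "c i = 0"
proof -
  have split: "sum f F = (\<Sum>j\<in>Inl -` F. f (Inl j)) + (\<Sum>j\<in>Inr -` F. f (Inr j))" for f :: "lens_index \<Rightarrow> solid_gen free_star"
  proof -
    have "F = Inl ` (Inl -` F) \<union> Inr ` (Inr -` F)"
    proof (rule Set.set_eqI)
      show "i \<in> F \<longleftrightarrow> i \<in> Inl ` (Inl -` F) \<union> Inr ` (Inr -` F)" for i
        by (cases i) auto
    qed
    moreover have "finite (Inl -` F)" "finite (Inr -` F)"
      using F(1) by (simp_all add: finite_vimageI)
    ultimately have "sum f F = sum f (Inl ` (Inl -` F)) + sum f (Inr ` (Inr -` F))"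
      by (subst sum.union_disjoint[symmetric]) (use F(1) in auto)
    then show ?thesis unfolding sum.reindex[OF inj_Inl] sum.reindex[OF inj_Inr] comp_def .
  qed
  have pos: "0 < k" if "Inl (k, m, n) \<in> F" for k m n
    using that F(2) by (auto simp: lens_indices_def)
  have fin: "finite (Inl -` F)" "finite (Inr -` F)"
    using F(1) by (simp_all add: finite_vimageI)
  have "subst_gens (lens_second \<beta>) (\<Sum>i\<in>F. scal (c i) * lens_monomial i) =
      (\<Sum>i\<in>Inr -` F. scal (c (Inr i)) * (case i of (k, m, n) \<Rightarrow> solid_monomial k m n))"
  proof -
    have "(\<Sum>j\<in>Inl -` F. scal (c (Inl j)) * subst_gens (lens_second \<beta>) (lens_monomial (Inl j))) = 0"
      by (rule sum.neutral) (auto simp: subst_lens_second pos)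
    moreover have "(\<Sum>j\<in>Inr -` F. scal (c (Inr j)) * subst_gens (lens_second \<beta>) (lens_monomial (Inr j))) =
        (\<Sum>i\<in>Inr -` F. scal (c (Inr i)) * (case i of (k, m, n) \<Rightarrow> solid_monomial k m n))"
      by (rule sum.cong) (auto simp: subst_lens_second)
    ultimately show ?thesis
      by (simp add: subst_gens_sum subst_gens_mult split)
  qed
  with 2 have "(\<Sum>i\<in>Inr -` F. scal (c (Inr i)) * (case i of (k, m, n) \<Rightarrow> solid_monomial k m n))
      \<in> relation_ideal (solid_torus_rels q \<theta>)" by simp
  then have Inr: "c (Inr j) = 0" if "Inr j \<in> F" for j
    by (rule solid_independent[OF pq(3,4) fin(2)]) (use that in simp)
  \<comment> \<open>In the first component a power of \<open>b\<close> becomes the opposite power of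
    \<open>h\<close>, so the indices are relabelled by the involution reversing the sign of
    n.\<close>
  define \<sigma> :: "nat \<times> int \<times> int \<Rightarrow> nat \<times> int \<times> int" where "\<sigma> = (\<lambda>(k, m, n). (k, m, - n))"
  have \<sigma>\<sigma>: "\<sigma> (\<sigma> j) = j" for j by (cases j) (simp add: \<sigma>_def)
  have inj: "inj_on \<sigma> A" for A by (rule inj_on_inverseI[of _ \<sigma>]) (rule \<sigma>\<sigma>)
  define d where "d = (\<lambda>i. c (Inl (\<sigma> i)) * lens_phase \<theta> \<beta> powi (snd (snd (\<sigma> i))))"
  have "subst_gens (lens_first \<theta> \<beta>) (\<Sum>i\<in>F. scal (c i) * lens_monomial i) =
      (\<Sum>j\<in>Inl -` F. scal (c (Inl j)) * subst_gens (lens_first \<theta> \<beta>) (lens_monomial (Inl j)))"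
  proof -
    have "(\<Sum>j\<in>Inr -` F. scal (c (Inr j)) * subst_gens (lens_first \<theta> \<beta>) (lens_monomial (Inr j))) = 0"
      by (rule sum.neutral) (auto simp: Inr)
    then show ?thesis
      by (simp add: subst_gens_sum subst_gens_mult split)
  qed
  also have "\<dots> = (\<Sum>j\<in>Inl -` F. scal (d (\<sigma> j)) * (case \<sigma> j of (k, m, n) \<Rightarrow> solid_monomial k m n))"
    by (rule sum.cong) (auto simp: subst_lens_first_Inl d_def \<sigma>_def scal_mult mult.assoc)
  also have "\<dots> = (\<Sum>i\<in>\<sigma> ` (Inl -` F). scal (d i) * (case i of (k, m, n) \<Rightarrow> solid_monomial k m n))"
    by (simp add: sum.reindex[OF inj])
  finally have "(\<Sum>i\<in>\<sigma> ` (Inl -` F). scal (d i) * (case i of (k, m, n) \<Rightarrow> solid_monomial k m n))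
      \<in> relation_ideal (solid_torus_rels p \<theta>)"
    using 1 by simp
  then have "d (\<sigma> j) = 0" if "Inl j \<in> F" for j
    by (rule solid_independent[OF pq(1,2) finite_imageI[OF fin(1)]]) (use that in auto)
  then have "c (Inl j) = 0" if "Inl j \<in> F" for j
    using that lens_phase_powi_nonzero[of \<theta> \<beta>] by (fastforce simp: d_def \<sigma>\<sigma>)
  with Inr \<open>i \<in> F\<close> show ?thesis by (cases i) auto
qed

lemma span_residue_explicit:
  assumes "residue E f \<in> quotients.span ((\<lambda>i. residue E (v i)) ` A)"
  shows "\<exists>F c. finite F \<and> F \<subseteq> A \<and> residue E f = residue E (\<Sum>i\<in>F. scal (c i) * v i)"
proof -
  have "\<exists>F c. finite F \<and> F \<subseteq> A \<and> x = residue E (\<Sum>i\<in>F. scal (c i) * v i)"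
    if "x \<in> quotients.span ((\<lambda>i. residue E (v i)) ` A)" for x
    using that
  proof (induction rule: quotients.span_induct_alt)
    case base
    show ?case by (intro exI[of _ "{}"]) simp
  next
    case (step c x y)
    then obtain F d i where F: "finite F" "F \<subseteq> A" "y = residue E (\<Sum>i\<in>F. scal (d i) * v i)"
      and i: "i \<in> A" "x = residue E (v i)" by blast
    \<comment> \<open>The new index may already belong to \<open>F\<close>, so its coefficient is
      increased and not overwritten.\<close>
    define d' where "d' j = (if j \<in> F then d j else 0) + (if j = i then c else 0)" for j
    have "(\<Sum>j\<in>insert i F. scal (d' j) * v j) =
        (\<Sum>j\<in>insert i F. scal (if j \<in> F then d j else 0) * v j) + (\<Sum>j\<in>insert i F. scal (if j = i then c else 0) * v j)"
      by (simp only: d'_def scal_add distrib_right sum.distrib)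
    also have "(\<Sum>j\<in>insert i F. scal (if j \<in> F then d j else 0) * v j) = (\<Sum>j\<in>F. scal (d j) * v j)"
      using F(1) by (intro sum.mono_neutral_cong_right) auto
    also have "(\<Sum>j\<in>insert i F. scal (if j = i then c else 0) * v j) = (\<Sum>j\<in>{i}. scal c * v j)"
      using F(1) by (intro sum.mono_neutral_cong_right) auto
    finally have "residue E (\<Sum>j\<in>insert i F. scal (d' j) * v j) = c *s x + y"
      by (simp add: F(3) i(2) residue_add residue_scal_mult)
    then show ?case
      using F(1,2) i(1) by (intro exI[of _ "insert i F"] exI[of _ d']) simp
  qed
  with assms show ?thesis by blast
qed

lemma lens_basis:
  fixes p q \<theta> :: real
  assumes pq: "0 < p" "p < 1" "0 < q" "q < 1"
  shows "basis_family (lens_space p q \<theta> \<beta>) lens_indices (lens_vec p q \<theta> \<beta>)"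
proof -
  let ?E = "lens_rels p q \<theta> \<beta>"
  have vec: "lens_vec p q \<theta> \<beta> = (\<lambda>i. residue_class ?E (lens_monomial i))"
    by (simp add: fun_eq_iff lens_vec_alt)
  note respects = subst_gens_relation_ideal[OF lens_first_respects[OF pq(1,3)]]
    subst_gens_relation_ideal[OF lens_second_respects[OF pq(1,3)]]
  show ?thesis
    unfolding basis_family_def lens_space_def
  proof (intro conjI)
    show "lens_vec p q \<theta> \<beta> \<in> lens_indices \<rightarrow> carrier (presented ?E)"
      by (simp add: vec)
    show "lin_independent_family (presented ?E) lens_indices (lens_vec p q \<theta> \<beta>)"
      unfolding lin_independent_family_def vec
    proof (intro allI impI ballI, elim conjE)
      fix F c i
      assume F: "finite F" "F \<subseteq> lens_indices" "i \<in> F"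
        and "lin_comb (presented ?E) (\<lambda>i. residue_class ?E (lens_monomial i)) c F = \<zero>\<^bsub>presented ?E\<^esub>"
      then have "(\<Sum>i\<in>F. scal (c i) * lens_monomial i) \<in> relation_ideal ?E"
        by (simp add: lin_comb_presented zero_presented residue_class_eq_iff)
      then show "c i = 0"
        by (intro lens_combination_zero[OF pq F(1,2) _ _ F(3)] respects)
    qed
    show "spanning_family (presented ?E) lens_indices (lens_vec p q \<theta> \<beta>)"
      unfolding spanning_family_def vec
    proof
      fix X assume "X \<in> carrier (presented ?E)"
      then obtain f where X: "X = residue_class ?E f" by (auto simp: carrier_presented)
      obtain F c where "finite F" "F \<subseteq> lens_indices" "residue ?E f = residue ?E (\<Sum>i\<in>F. scal (c i) * lens_monomial i)"
        using span_residue_explicit[OF lens_spanned[OF pq(1,3), of \<theta> \<beta> f]] by blast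
      then show "\<exists>F c. finite F \<and> F \<subseteq> lens_indices \<and>
          X = lin_comb (presented ?E) (\<lambda>i. residue_class ?E (lens_monomial i)) c F"
        by (intro exI[of _ F] exI[of _ c]) (simp add: X lin_comb_presented residue_eq_iff)
    qed
  qed
qed

section \<open>Compatibility on the boundary and the isomorphism with the gluing\<close>

lemma star_homD:
  assumes "f \<in> star_hom (presented E) (presented E')"
  shows "f (residue_class E (u * v)) = f (residue_class E u) \<otimes>\<^bsub>presented E'\<^esub> f (residue_class E v)"
    and "f (residue_class E (u + v)) = f (residue_class E u) \<oplus>\<^bsub>presented E'\<^esub> f (residue_class E v)"
    and "f (residue_class E (scal c * u)) = c \<odot>\<^bsub>presented E'\<^esub> f (residue_class E u)"
    and "f (residue_class E (u\<^sup>\<star>)) = invol (presented E') (f (residue_class E u))"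
    and "f (residue_class E 1) = residue_class E' 1"
proof -
  have hom: "f \<in> ring_hom (presented E) (presented E')"
    and scale: "\<And>c x. x \<in> carrier (presented E) \<Longrightarrow> f (c \<odot>\<^bsub>presented E\<^esub> x) = c \<odot>\<^bsub>presented E'\<^esub> f x"
    and star: "\<And>x. x \<in> carrier (presented E) \<Longrightarrow> f (invol (presented E) x) = invol (presented E') (f x)"
    using assms by (auto simp: star_hom_def)
  show "f (residue_class E (u * v)) = f (residue_class E u) \<otimes>\<^bsub>presented E'\<^esub> f (residue_class E v)"
    using ring_hom_mult[OF hom, of "residue_class E u" "residue_class E v"] by simp
  show "f (residue_class E (u + v)) = f (residue_class E u) \<oplus>\<^bsub>presented E'\<^esub> f (residue_class E v)"
    using ring_hom_add[OF hom, of "residue_class E u" "residue_class E v"] by simp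
  show "f (residue_class E (scal c * u)) = c \<odot>\<^bsub>presented E'\<^esub> f (residue_class E u)"
    using scale[of "residue_class E u" c] by simp
  show "f (residue_class E (u\<^sup>\<star>)) = invol (presented E') (f (residue_class E u))"
    using star[of "residue_class E u"] by simp
  show "f (residue_class E 1) = residue_class E' 1"
    using ring_hom_one[OF hom] by (simp add: one_presented)
qed

text \<open>Reduces the agreement of the two components in the quantum torus to the generators of
  the lens space.\<close>

lemma star_hom_subst_eq:
  assumes f: "f \<in> star_hom (presented E) (presented E'')" and g: "g \<in> star_hom (presented E') (presented E'')"
    and gens: "\<And>a. f (residue_class E (s a)) = g (residue_class E' (t a))"
  shows "f (residue_class E (subst_gens s w)) = g (residue_class E' (subst_gens t w))"
proof (induction w rule: free_star_induct)
  case (scal c)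
  show ?case
    using star_homD(3)[OF f, of c 1] star_homD(3)[OF g, of c 1] star_homD(5)[OF f] star_homD(5)[OF g] by simp
next
  case (gen a w)
  then show ?case
    using star_homD(1)[OF f, of "s a"] star_homD(1)[OF g, of "t a"] by (simp add: subst_gens_mult gens)
next
  case (star a w)
  then show ?case
    using star_homD(1)[OF f, of "(s a)\<^sup>\<star>"] star_homD(1)[OF g, of "(t a)\<^sup>\<star>"]
      star_homD(4)[OF f, of "s a"] star_homD(4)[OF g, of "t a"] by (simp add: subst_gens_mult gens)
next
  case (add v w)
  then show ?case
    by (simp add: subst_gens_add star_homD(2)[OF f] star_homD(2)[OF g])
qed

lemma solid_spanned_explicit:
  fixes p \<theta> :: real
  assumes "p \<noteq> 0"
  obtains F c where "finite F" "residue (solid_torus_rels p \<theta>) f =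
    residue (solid_torus_rels p \<theta>) (\<Sum>i\<in>F. scal (c i) * (case i of (k, m, n) \<Rightarrow> solid_monomial k m n))"
proof -
  have eq: "(\<lambda>i. residue (solid_torus_rels p \<theta>) (case i of (k, m, n) \<Rightarrow> solid_monomial k m n)) =
      (\<lambda>(k, m, n). residue (solid_torus_rels p \<theta>) (solid_monomial k m n))"
    by (auto simp: fun_eq_iff)
  have "residue (solid_torus_rels p \<theta>) f \<in> quotients.span
      ((\<lambda>i. residue (solid_torus_rels p \<theta>) (case i of (k, m, n) \<Rightarrow> solid_monomial k m n)) ` UNIV)"
    unfolding eq by (rule solid_torus_spanned[OF assms])
  from span_residue_explicit[OF this] show ?thesis using that by blast
qed

lemma lens_gluing_isomorphism:
  fixes p q \<theta> :: real and \<beta> :: nat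
  assumes pq: "0 < p" "p < 1" "0 < q" "q < 1"
    and \<chi>12: "gluing_map1 p \<theta> \<chi>12" and \<chi>21: "gluing_map2 q \<theta> \<beta> \<chi>21"
  shows "star_isomorphic (lens_space p q \<theta> \<beta>) (gluing (solid_torus p \<theta>) (solid_torus q \<theta>) \<chi>12 \<chi>21)"
proof -
  define E where "E = lens_rels p q \<theta> \<beta>"
  define Ep where "Ep = solid_torus_rels p \<theta>"
  define Eq where "Eq = solid_torus_rels q \<theta>"
  define Et where "Et = torus_rels \<theta>"
  let ?s = "lens_first \<theta> \<beta>" and ?t = "lens_second \<beta>" and ?\<mu> = "lens_phase \<theta> \<beta>"
  let ?P = "gluing (presented Ep) (presented Eq) \<chi>12 \<chi>21"
  have f: "\<chi>12 \<in> star_hom (presented Ep) (presented Et)" and g: "\<chi>21 \<in> star_hom (presented Eq) (presented Et)"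
    using \<chi>12 \<chi>21 by (simp_all add: gluing_map1_def gluing_map2_def surjective_star_hom_def solid_torus_def
        quantum_torus_def Ep_def Eq_def Et_def)
  have vec1: "\<chi>12 (residue_class Ep (solid_monomial k m n)) =
      residue_class Et (scal (if k = 0 then 1 else 0) * (Tv \<^bold>^ m * Tu \<^bold>^ n))" for k m n
    using \<chi>12 by (simp add: gluing_map1_def solid_torus_vec_alt torus_vec_def quantum_torus_def Ep_def Et_def)
  have vec2: "\<chi>21 (residue_class Eq (solid_monomial k m n)) =
      residue_class Et (scal ((if k = 0 then 1 else 0) * cis (real \<beta> * \<theta> * (real_of_int n)\<^sup>2 / 2)) *
        (Tv \<^bold>^ (m + int \<beta> * n) * Tu \<^bold>^ n))" for k m n
    using \<chi>21 by (simp add: gluing_map2_def solid_torus_vec_alt torus_vec_def quantum_torus_def Eq_def Et_def)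
  have mono: "solid_monomial 1 0 0 = 1 - Sx * Sx\<^sup>\<star>" "solid_monomial 0 1 0 = Sx" "solid_monomial 0 0 1 = Sh"
      "solid_monomial 0 (int \<beta>) 1 = Sx ^ \<beta> * Sh" "solid_monomial 0 0 (- 1) = Sh\<^sup>\<star>"
      "solid_monomial 0 (int \<beta>) (- 1) = Sx ^ \<beta> * Sh\<^sup>\<star>"
    by (simp_all add: solid_monomial_def star_power_def)
  \<comment> \<open>On \<open>a\<close> and \<open>b\<close> the second map is evaluated at n = 1
    and n = -1, where its quadratic phase is that of \<mu>; for \<open>b\<close> the exponents of
    \<open>V\<close> cancel.\<close>
  have gens: "\<chi>12 (residue_class Ep (?s a)) = \<chi>21 (residue_class Eq (?t a))" for a
  proof (cases a)
    case Xi_Gen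
    have "\<chi>21 (residue_class Eq 0) = residue_class Et 0"
      using star_homD(3)[OF g, of 0 1] star_homD(5)[OF g] by simp
    then show ?thesis
      using vec1[of 1 0 0] by (simp add: Xi_Gen lens_first_def lens_second_def mono[unfolded One_nat_def])
  next
    case Z_Gen
    then show ?thesis
      using vec1[of 0 1 0] vec2[of 0 1 0] by (simp add: lens_first_def lens_second_def mono)
  next
    case A_Gen
    then show ?thesis
      using vec1[of 0 "int \<beta>" 1] vec2[of 0 0 1]
      by (simp add: lens_first_def lens_second_def mono star_homD(3)[OF f] lens_phase_def)
  next
    case B_Gen
    then show ?thesis
      using vec1[of 0 0 "- 1"] vec2[of 0 "int \<beta>" "- 1"]
      by (simp add: lens_first_def lens_second_def mono star_homD(3)[OF f] lens_phase_def)
  qed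
  note compatible = star_hom_subst_eq[OF f g gens]
  note resp1 = lens_first_respects[OF pq(1,3), of _ _ \<theta> \<beta>, folded E_def Ep_def]
  note resp2 = lens_second_respects[OF pq(1,3), of _ _ \<theta> \<beta>, folded E_def Eq_def]
  define \<Phi> where "\<Phi> X = (quotient_map E ?s Ep X, quotient_map E ?t Eq X)" for X
  have \<Phi>: "\<Phi> (residue_class E w) = (residue_class Ep (subst_gens ?s w), residue_class Eq (subst_gens ?t w))" for w
    by (simp add: \<Phi>_def quotient_map_residue_class[OF resp1] quotient_map_residue_class[OF resp2])
  have in_carrier: "\<Phi> (residue_class E w) \<in> carrier ?P" for w
    by (simp add: \<Phi> gluing_def compatible)
  have hom: "\<Phi> \<in> star_hom (presented E) ?P"
    unfolding star_hom_def ring_hom_def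
    using in_carrier
    by (auto simp: carrier_presented \<Phi> one_presented) (auto simp: gluing_def one_presented subst_gens_simps)
  have inj: "inj_on \<Phi> (carrier (presented E))"
  proof (rule inj_onI, unfold carrier_presented, elim imageE)
    fix X Y u v
    assume eq: "\<Phi> X = \<Phi> Y" and X: "X = residue_class E u" and Y: "Y = residue_class E v"
    from eq have w: "subst_gens ?s (u - v) \<in> relation_ideal Ep" "subst_gens ?t (u - v) \<in> relation_ideal Eq"
      by (simp_all add: X Y \<Phi> residue_class_eq_iff subst_gens_diff)
    obtain F c where F: "finite F" "F \<subseteq> lens_indices"
      and sum: "residue E (u - v) = residue E (\<Sum>i\<in>F. scal (c i) * lens_monomial i)"
      using span_residue_explicit[OF lens_spanned[OF pq(1,3), of \<theta> \<beta> "u - v"]] unfolding E_def by blast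
    let ?y = "\<Sum>i\<in>F. scal (c i) * lens_monomial i"
    have "\<Phi> (residue_class E (u - v)) = \<Phi> (residue_class E ?y)"
      using sum by (simp add: residue_eq_iff)
    then have "residue Ep (subst_gens ?s (u - v)) = residue Ep (subst_gens ?s ?y)"
      "residue Eq (subst_gens ?t (u - v)) = residue Eq (subst_gens ?t ?y)"
      unfolding \<Phi> by (simp_all add: residue_eq_iff)
    with w have y: "subst_gens ?s ?y \<in> relation_ideal Ep" "subst_gens ?t ?y \<in> relation_ideal Eq"
      by (simp_all flip: residue_eq_0_iff)
    have "c i = 0" if "i \<in> F" for i
      using lens_combination_zero[OF pq F y[unfolded Ep_def Eq_def] that] .
    then have "?y = 0" by simp
    with sum show "X = Y"
      by (simp add: X Y residue_class_eq_iff residue_eq_0_iff)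
  qed
  have surj: "\<exists>w. \<Phi> (residue_class E w) = Z" if Z_in: "Z \<in> carrier ?P" for Z
  proof -
    obtain u v where Z: "Z = (residue_class Ep u, residue_class Eq v)"
      and uv: "\<chi>12 (residue_class Ep u) = \<chi>21 (residue_class Eq v)"
      using Z_in by (auto simp: gluing_def carrier_presented)
    obtain F c where F: "finite F" and v: "residue Eq v =
        residue Eq (\<Sum>i\<in>F. scal (c i) * (case i of (k, m, n) \<Rightarrow> solid_monomial k m n))"
      using solid_spanned_explicit[of q \<theta> v] pq unfolding Eq_def by blast
    \<comment> \<open>The \<open>Inr\<close> monomials map exactly to solid torus monomials in the
      second component, so the coefficients of \<open>v\<close> can be copied.\<close>
    define w1 where "w1 = (\<Sum>i\<in>F. scal (c i) * lens_monomial (Inr i))"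
    have "subst_gens ?t w1 = (\<Sum>i\<in>F. scal (c i) * (case i of (k, m, n) \<Rightarrow> solid_monomial k m n))"
      unfolding w1_def subst_gens_sum by (rule sum.cong) (auto simp: subst_gens_mult subst_lens_second)
    with v have v': "residue_class Eq v = residue_class Eq (subst_gens ?t w1)"
      by (simp add: residue_eq_iff)
    have "\<chi>12 (residue_class Ep u) = \<chi>12 (residue_class Ep (subst_gens ?s w1))"
      unfolding uv v' compatible ..
    moreover obtain y where y: "\<chi>12 (residue_class Ep (subst_gens ?s w1)) = residue_class Et y"
      using ring_hom_closed[of \<chi>12 "presented Ep" "presented Et" "residue_class Ep (subst_gens ?s w1)"] f
      by (auto simp: star_hom_def carrier_presented)
    ultimately have diff: "\<chi>12 (residue_class Ep (u + scal (- 1) * subst_gens ?s w1)) = residue_class Et 0"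
      unfolding star_homD(2)[OF f] star_homD(3)[OF f] by (simp add: scal_minus)
    obtain G d where G: "finite G" and u: "residue Ep (u + scal (- 1) * subst_gens ?s w1) =
        residue Ep (\<Sum>i\<in>G. scal (d i) * (case i of (k, m, n) \<Rightarrow> solid_monomial k m n))"
      using solid_spanned_explicit[of p \<theta> "u + scal (- 1) * subst_gens ?s w1"] pq unfolding Ep_def by blast
    \<comment> \<open>Only monomials with k = 0 survive under \<open>\<chi>12\<close>; for a
      combination that it sends to 0 this becomes a linear relation between torus monomials.\<close>
    have "\<chi>12 (residue_class Ep (\<Sum>i\<in>A. scal (d i) * (case i of (k, m, n) \<Rightarrow> solid_monomial k m n))) =
        residue_class Et (\<Sum>i\<in>A. case i of (k, m, n) \<Rightarrow> scal (if k = 0 then d i else 0) * (Tv \<^bold>^ m * Tu \<^bold>^ n))"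
      if "finite A" for A
      using that
    proof induction
      case empty
      show ?case
        using star_homD(3)[OF f, of 0 1] star_homD(5)[OF f] by simp
    next
      case (insert i A)
      obtain k m n where "i = (k, m, n)" by (cases i)
      then show ?case
        using insert by (simp add: star_homD(2,3)[OF f] vec1)
    qed
    from this[OF G] have "residue_class Et (\<Sum>i\<in>G. case i of (k, m, n) \<Rightarrow> scal (if k = 0 then d i else 0) * (Tv \<^bold>^ m * Tu \<^bold>^ n)) =
        residue_class Et 0"
      using u diff by (simp add: residue_eq_iff)
    moreover have "(\<Sum>i\<in>G. case i of (k, m, n) \<Rightarrow> scal (if k = 0 then d i else 0) * (Tv \<^bold>^ m * Tu \<^bold>^ n)) =
        (\<Sum>i\<in>Pair 0 ` (Pair 0 -` G). case i of (k, m, n) \<Rightarrow> scal (d i) * (Tv \<^bold>^ m * Tu \<^bold>^ n))"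
      by (rule sum.mono_neutral_cong_right) (use G in \<open>auto split: if_splits\<close>)
    moreover have "\<dots> = (\<Sum>(m, n)\<in>Pair 0 -` G. scal (d (0, m, n)) * (Tv \<^bold>^ m * Tu \<^bold>^ n))"
      by (subst sum.reindex) (auto simp: inj_on_def case_prod_beta)
    ultimately have torus: "(\<Sum>(m, n)\<in>Pair 0 -` G. scal (d (0, m, n)) * (Tv \<^bold>^ m * Tu \<^bold>^ n)) \<in> relation_ideal (torus_rels \<theta>)"
      by (simp add: residue_class_eq_iff Et_def)
    have "finite (Pair (0 :: nat) -` G)"
      using G by (rule finite_vimageI) (simp add: inj_on_def)
    from torus_independent[OF this torus] have d0: "d (0, m, n) = 0" if "(0, m, n) \<in> G" for m n
      using that by simp
    define H where "H = {i \<in> G. 0 < fst i}"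
    \<comment> \<open>Corrects the first component alone: \<open>Inl\<close> monomials with positive
      k vanish in the second. The opposite exponent and the inverse phase undo the effect of
      \<open>lens_first\<close>.\<close>
    define w2 where "w2 = (\<Sum>i\<in>H. case i of (k, m, n) \<Rightarrow>
      scal (d i * inverse (?\<mu> powi (- n))) * lens_monomial (Inl (k, m, - n)))"
    have "subst_gens ?t w2 = 0"
      unfolding w2_def subst_gens_sum by (rule sum.neutral) (auto simp: H_def subst_gens_mult subst_lens_second)
    have "subst_gens ?s w2 = (\<Sum>i\<in>H. scal (d i) * (case i of (k, m, n) \<Rightarrow> solid_monomial k m n))"
      unfolding w2_def subst_gens_sum
    proof (rule sum.cong[OF refl])
      fix i assume "i \<in> H"
      obtain k m n where i: "i = (k, m, n)" by (cases i)
      have "scal (d i * inverse (?\<mu> powi (- n))) * (scal (?\<mu> powi (- n)) * solid_monomial k m n) =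
          scal (d i * inverse (?\<mu> powi (- n)) * ?\<mu> powi (- n)) * solid_monomial k m n"
        by (simp only: scal_mult mult.assoc)
      also have "d i * inverse (?\<mu> powi (- n)) * ?\<mu> powi (- n) = d i"
        using lens_phase_powi_nonzero[of \<theta> \<beta> "- n"] by (simp only: mult.assoc left_inverse mult_1_right not_False_eq_True)
      finally show "subst_gens ?s (case i of (k, m, n) \<Rightarrow>
          scal (d i * inverse (?\<mu> powi (- n))) * lens_monomial (Inl (k, m, - n))) =
          scal (d i) * (case i of (k, m, n) \<Rightarrow> solid_monomial k m n)"
        unfolding i prod.case subst_gens_mult subst_gens_scal subst_lens_first_Inl minus_minus .
    qed
    also have "\<dots> = (\<Sum>i\<in>G. scal (d i) * (case i of (k, m, n) \<Rightarrow> solid_monomial k m n))"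
      by (rule sum.mono_neutral_left) (use G d0 in \<open>auto simp: H_def intro: gr0I\<close>)
    finally have "residue Ep (subst_gens ?s (w1 + w2)) = residue Ep u"
      using u by (simp add: subst_gens_add residue_add scal_minus residue_diff diff_eq_eq add.commute)
    moreover have "residue Eq (subst_gens ?t (w1 + w2)) = residue Eq v"
      using v' \<open>subst_gens ?t w2 = 0\<close> by (simp add: subst_gens_add residue_eq_iff)
    ultimately have "\<Phi> (residue_class E (w1 + w2)) = Z"
      by (simp add: \<Phi> Z residue_eq_iff)
    then show ?thesis ..
  qed
  have "bij_betw \<Phi> (carrier (presented E)) (carrier ?P)"
    unfolding bij_betw_def
  proof (intro conjI inj equalityI subsetI)
    show "Z \<in> carrier ?P" if "Z \<in> \<Phi> ` carrier (presented E)" for Z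
      using that in_carrier by (auto simp: carrier_presented)
    show "Z \<in> \<Phi> ` carrier (presented E)" if "Z \<in> carrier ?P" for Z
      using surj[OF that] by (auto simp: carrier_presented)
  qed
  with hom show ?thesis
    unfolding star_isomorphic_def lens_space_def solid_torus_def E_def Ep_def Eq_def by blast
qed

theorem proposition8p6:
  fixes p q \<theta> :: real and \<beta> :: nat
  assumes "0 < p" "p < 1" and "0 < q" "q < 1" and "0 \<le> \<theta>" "\<theta> < 2 * pi"
  shows "basis_family (lens_space p q \<theta> \<beta>) lens_indices (lens_vec p q \<theta> \<beta>) \<and>
    (\<exists>\<chi>12. gluing_map1 p \<theta> \<chi>12) \<and>
    (\<exists>\<chi>21. gluing_map2 q \<theta> \<beta> \<chi>21) \<and>
    (\<forall>\<chi>12 \<chi>21. gluing_map1 p \<theta> \<chi>12 \<and> gluing_map2 q \<theta> \<beta> \<chi>21 \<longrightarrow>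
       star_isomorphic (lens_space p q \<theta> \<beta>)
         (gluing (solid_torus p \<theta>) (solid_torus q \<theta>) \<chi>12 \<chi>21))"
proof (intro conjI allI impI)
  show "basis_family (lens_space p q \<theta> \<beta>) lens_indices (lens_vec p q \<theta> \<beta>)"
    using assms(1-4) by (rule lens_basis)
  show "\<exists>\<chi>12. gluing_map1 p \<theta> \<chi>12" "\<exists>\<chi>21. gluing_map2 q \<theta> \<beta> \<chi>21"
    using assms by (simp_all add: ex_gluing_map1 ex_gluing_map2)
qed (use lens_gluing_isomorphism[OF assms(1-4)] in blast)

end
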